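(* Let $k$ be an algebraically closed field of characteristic $2$ and let $G=SL_2$ over $k$. For every integer $m>2$, \[\dim_k H^{2m}(G,L(2^{2m}))\geq 2^{m-1},\] and so $\dim_k H^{m}(G,L(2^{m}))$ grows exponentially with $m$; that is, there exist real constants $C>0$ and $c>1$ such that $\dim_k H^m(G,L(2^m))\geq C\,c^m$ for all sufficiently large $m$.
   Context: $G=SL_2$ is regarded as an algebraic group over $k$, and $H^m(G,V)=\mathrm{Ext}^m_G(k,V)$ denotes rational cohomology, computed in the category of rational $G$-modules. Dominant weights of $G$ are identified with non-negative integers, and $L(r)$ denotes the simple $G$-module of highest weight $r$. Thus $L(1)$ is the natural $2$-dimensional module, and $L(2^m)\cong L(1)^{[m]}$ is its $m$-th Frobenius twist. *)

theory Defs
  imports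
    "HOL-Analysis.Analysis"
    "HOL-Computational_Algebra.Computational_Algebra"
    "HOL-Library.Function_Algebras"
    "HOL-Library.Infinite_Typeclass"
begin

section \<open>The algebraic group of 2 by 2 matrices of determinant 1\<close>

definition SL2 :: "('k::field ^ 2 ^ 2) set" where
  "SL2 = {g. det g = 1}"

definition torus :: "'k::field \<Rightarrow> 'k ^ 2 ^ 2" where
  "torus t = vector [vector [t, 0], vector [0, inverse t]]"

text \<open>
  The group is closed in the affine space of all matrices, so its regular functions are the
  restrictions to \<^const>\<open>SL2\<close> of the polynomial functions in the matrix entries.
\<close>

inductive polynomial_fun :: "('k::field ^ 2 ^ 2 \<Rightarrow> 'k) \<Rightarrow> bool" where
  const: "polynomial_fun (\<lambda>g. a)"
| coord: "polynomial_fun (\<lambda>g. g $ i $ j)"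
| add: "polynomial_fun p \<Longrightarrow> polynomial_fun q \<Longrightarrow> polynomial_fun (\<lambda>g. p g + q g)"
| mult: "polynomial_fun p \<Longrightarrow> polynomial_fun q \<Longrightarrow> polynomial_fun (\<lambda>g. p g * q g)"


section \<open>Rational modules\<close>

text \<open>
  The underlying vector space of a module is a subspace \<open>car\<close> of an ambient vector space
  on the type \<open>'v\<close> with scalar multiplication \<open>scl\<close>.  The values of \<open>act\<close> matter only
  on \<^const>\<open>SL2\<close> and on \<open>car\<close>.
\<close>

record ('k, 'v) gmod =
  scl :: "'k \<Rightarrow> 'v \<Rightarrow> 'v"
  car :: "'v set"
  act :: "'k ^ 2 ^ 2 \<Rightarrow> 'v \<Rightarrow> 'v"

definition group_module :: "('k::field, 'v::ab_group_add) gmod \<Rightarrow> bool" where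
  "group_module M \<longleftrightarrow>
     vector_space (scl M) \<and> module.subspace (scl M) (car M) \<and>
     (\<forall>g\<in>SL2. \<forall>v\<in>car M. act M g v \<in> car M) \<and>
     (\<forall>g\<in>SL2. \<forall>v\<in>car M. \<forall>w\<in>car M. act M g (v + w) = act M g v + act M g w) \<and>
     (\<forall>g\<in>SL2. \<forall>a. \<forall>v\<in>car M. act M g (scl M a v) = scl M a (act M g v)) \<and>
     (\<forall>v\<in>car M. act M (mat 1) v = v) \<and>
     (\<forall>g\<in>SL2. \<forall>h\<in>SL2. \<forall>v\<in>car M. act M (g ** h) v = act M g (act M h v))"

text \<open>
  Rational means locally finite and rational: every vector lies in a finite-dimensional
  stable subspace (with basis \<open>B\<close>) on which the matrix entries of the action are regular.
\<close>

definition rational_module :: "('k::field, 'v::ab_group_add) gmod \<Rightarrow> bool" where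
  "rational_module M \<longleftrightarrow> group_module M \<and>
     (\<forall>v\<in>car M. \<exists>B c. finite B \<and> B \<subseteq> car M \<and>
        \<not> module.dependent (scl M) B \<and> v \<in> module.span (scl M) B \<and>
        (\<forall>b\<in>B. \<forall>b'\<in>B. polynomial_fun (c b' b)) \<and>
        (\<forall>g\<in>SL2. \<forall>b\<in>B. act M g b = (\<Sum>b'\<in>B. scl M (c b' b g) b')))"

definition trivial_module :: "('k::field, 'k) gmod" where
  "trivial_module = \<lparr>scl = (*), car = UNIV, act = (\<lambda>g v. v)\<rparr>"

text \<open>
  Equivariant linear maps.  They are set to zero outside the carrier, so that functions on
  the ambient type represent maps on the carrier uniquely.
\<close>

definition Hom_G :: "('k::field, 'v::ab_group_add) gmod \<Rightarrow> ('k, 'w::ab_group_add) gmod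
    \<Rightarrow> ('v \<Rightarrow> 'w) set" where
  "Hom_G M N = {f.
     (\<forall>x\<in>car M. f x \<in> car N) \<and> (\<forall>x. x \<notin> car M \<longrightarrow> f x = 0) \<and>
     (\<forall>x\<in>car M. \<forall>y\<in>car M. f (x + y) = f x + f y) \<and>
     (\<forall>a. \<forall>x\<in>car M. f (scl M a x) = scl N a (f x)) \<and>
     (\<forall>g\<in>SL2. \<forall>x\<in>car M. f (act M g x) = act N g (f x))}"


section \<open>Simple modules and highest weights\<close>

definition simple_module :: "('k::field, 'v::ab_group_add) gmod \<Rightarrow> bool" where
  "simple_module M \<longleftrightarrow> rational_module M \<and> car M \<noteq> {0} \<and>
     (\<forall>W. W \<subseteq> car M \<and> module.subspace (scl M) W \<and> (\<forall>g\<in>SL2. \<forall>w\<in>W. act M g w \<in> W)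
        \<longrightarrow> W = {0} \<or> W = car M)"

definition weight_space :: "('k::field, 'v::ab_group_add) gmod \<Rightarrow> int \<Rightarrow> 'v set" where
  "weight_space M n = {v \<in> car M. \<forall>t. t \<noteq> 0 \<longrightarrow> act M (torus t) v = scl M (t powi n) v}"

definition highest_weight :: "('k::field, 'v::ab_group_add) gmod \<Rightarrow> nat \<Rightarrow> bool" where
  "highest_weight M r \<longleftrightarrow> weight_space M (int r) \<noteq> {0} \<and>
     (\<forall>n. weight_space M n \<noteq> {0} \<longrightarrow> n \<le> int r)"

text \<open>
  The module is determined up to isomorphism.  The ambient type is required to be a space
  of functions on an infinite set, which has room for every finite-dimensional module.
\<close>

definition L :: "nat \<Rightarrow> ('k::field, 'i::infinite \<Rightarrow> 'k) gmod" where
  "L r = (SOME M. simple_module M \<and> highest_weight M r)"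


section \<open>Rational cohomology\<close>

text \<open>
  HOL cannot quantify over all types inside a formula, so injectivity refers to the
  rational modules carried by the same type as \<open>J\<close>.  When this type is \<open>'i \<Rightarrow> 'k\<close> with
  \<open>'i\<close> infinite, there is room for every finite-dimensional module, and since rational
  modules are locally finite, such a \<open>J\<close> is injective among all rational modules.
\<close>

definition injective_module :: "('k::field, 'u::ab_group_add) gmod \<Rightarrow> bool" where
  "injective_module J \<longleftrightarrow> rational_module J \<and>
     (\<forall>(A :: ('k, 'u) gmod) (B :: ('k, 'u) gmod). rational_module A \<longrightarrow> rational_module B \<longrightarrow>
        (\<forall>f\<in>Hom_G A B. inj_on f (car A) \<longrightarrow>
           (\<forall>h\<in>Hom_G A J. \<exists>h'\<in>Hom_G B J. \<forall>x\<in>car A. h' (f x) = h x)))"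

definition injective_resolution ::
  "('k::field, 'u::ab_group_add) gmod \<Rightarrow> (nat \<Rightarrow> ('k, 'u) gmod) \<Rightarrow> (nat \<Rightarrow> 'u \<Rightarrow> 'u)
     \<Rightarrow> ('u \<Rightarrow> 'u) \<Rightarrow> bool" where
  "injective_resolution V I d e \<longleftrightarrow>
     (\<forall>n. injective_module (I n)) \<and>
     e \<in> Hom_G V (I 0) \<and> inj_on e (car V) \<and>
     (\<forall>n. d n \<in> Hom_G (I n) (I (Suc n))) \<and>
     e ` car V = {x \<in> car (I 0). d 0 x = 0} \<and>
     (\<forall>n. d n ` car (I n) = {x \<in> car (I (Suc n)). d (Suc n) x = 0})"

definition cocycles :: "('k::field, 'v::ab_group_add) gmod \<Rightarrow>
    (nat \<Rightarrow> ('k, 'u::ab_group_add) gmod) \<Rightarrow> (nat \<Rightarrow> 'u \<Rightarrow> 'u) \<Rightarrow> nat \<Rightarrow> ('v \<Rightarrow> 'u) set" where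
  "cocycles M I d n = {f \<in> Hom_G M (I n). d n \<circ> f = 0}"

fun coboundaries :: "('k::field, 'v::ab_group_add) gmod \<Rightarrow>
    (nat \<Rightarrow> ('k, 'u::ab_group_add) gmod) \<Rightarrow> (nat \<Rightarrow> 'u \<Rightarrow> 'u) \<Rightarrow> nat \<Rightarrow> ('v \<Rightarrow> 'u) set" where
  "coboundaries M I d 0 = {0}"
| "coboundaries M I d (Suc n) = {d n \<circ> f | f. f \<in> Hom_G M (I n)}"

text \<open>
  The dimension of the quotient \<open>Z / B\<close> of a subspace \<open>Z\<close> by a subspace \<open>B\<close>, computed
  from representatives of linearly independent families of cosets.
\<close>

definition quotient_dim :: "('k::field \<Rightarrow> 'v::ab_group_add \<Rightarrow> 'v) \<Rightarrow> 'v set \<Rightarrow> 'v set \<Rightarrow> enat"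
  where
  "quotient_dim s Z B = Sup {enat (card X) | X. finite X \<and> X \<subseteq> Z \<and>
     (\<forall>a. (\<Sum>x\<in>X. s (a x) x) \<in> B \<longrightarrow> (\<forall>x\<in>X. a x = 0))}"

text \<open>
  The groups \<open>Ext\<^sup>n(M, V)\<close> are computed from an injective resolution of \<open>V\<close>; their
  dimension does not depend on which one is chosen.
\<close>

definition Ext_dim :: "('k::field, 'v::ab_group_add) gmod \<Rightarrow> ('k, 'u::ab_group_add) gmod
    \<Rightarrow> nat \<Rightarrow> enat" where
  "Ext_dim M V n =
     (case (SOME (I, d). \<exists>e. injective_resolution V I d e) of (I, d) \<Rightarrow>
        quotient_dim (\<lambda>a f x. scl (I n) a (f x)) (cocycles M I d n) (coboundaries M I d n))"

definition H_dim :: "nat \<Rightarrow> ('k::field, 'u::ab_group_add) gmod \<Rightarrow> enat" where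
  "H_dim n V = Ext_dim trivial_module V n"

end

theory Submission
  imports Defs
begin

text \<open>
  The cohomology of \<open>SL\<^sub>2\<close> agrees with that of its Borel subgroup. In characteristic 2 the latter
  is computed, for a rational module \<open>V\<close>, by the part of torus weight 0 of the complex
  \<open>V \<otimes> k[\<lambda>\<^sub>0, \<lambda>\<^sub>1, \<dots>]\<close> with differential \<open>\<Sum>\<^sub>i \<lambda>\<^sub>i e\<^sub>i\<close>, where \<open>\<lambda>\<^sub>i\<close> has degree 1 and
  weight \<open>- 2\<^sup>i\<^sup>+\<^sup>1\<close> and \<open>e\<^sub>i\<close> is the \<open>2\<^sup>i\<close>-th divided power of the upper root vector.
  This complex is exact in \<open>V\<close>, its cocycles of degree 0 are the invariants, and it is acyclic for
  injective \<open>V\<close>: sending \<open>v\<close> to the function whose value at \<open>h\<close> is the part of \<open>h v\<close> of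
  nonnegative weight embeds \<open>V\<close> as a direct summand into functions on the group, and there
  the image of a cocycle is contracted explicitly. By dimension shifting, independent classes
  of the complex give independent classes in every injective resolution.

  For \<open>V = L(2\<^sup>m)\<close> the only weights are \<open>2\<^sup>m\<close> and \<open>- 2\<^sup>m\<close>, so the monomials of degree \<open>m\<close> and
  weight \<open>- 2\<^sup>m\<close> times a highest weight vector are independent classes. Such monomials
  are solutions of \<open>1 = \<Sum>\<^sub>j 2\<^sup>-\<^sup>d\<^sup>j\<close> with \<open>m\<close> terms, for example the leaf depths of a binary tree;
  two ways of adding two leaves to a tree double their number.
\<close>

text \<open>Only a lower bound is wanted, so the complex is never identified with the cohomology of
  the group: it is enough that independent classes survive every dimension shift until they become
  invariants. Why nonnegative weights: on the big cell, with first row a, b and with c below a, a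
  vector of weight w yields terms a^(w+s-r) b^s c^r. The contraction lowers w by 2^(i+1) and raises
  s by 2^i, so the exponent of a drops by 2^i. For the full orbit map it can become negative, and
  regularity is lost. The number w+2s-2r, the weight of the coefficient vector, does not change; if
  it is nonnegative, then so is 2(w+s-r) = w + (w+2s-2r), because the weights w of monomials are
  nonnegative. Discarding negative weights loses no vector, since the Weyl element exchanges the
  weights n and -n. The other obstacle is typing: injectivity is tested on modules carried by one
  fixed type, whereas functions on the group live on another. Countable dimension is tracked so that
  modules can be moved back.\<close>

no_notation fps_nth (infixl "$" 75)

section \<open>Polynomial functions on the group\<close>

lemma infinite_UNIV_alg_closed: "infinite (UNIV :: 'k::alg_closed_field set)"
proof
  assume fin: "finite (UNIV :: 'k set)"
  define p :: "'k poly" where "p = (\<Prod>a\<in>UNIV. [:- a, 1:]) + 1"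
  have "degree (\<Prod>a\<in>(UNIV::'k set). [:- a, 1:]) = card (UNIV :: 'k set)"
    by (subst degree_prod_eq_sum_degree) auto
  moreover have "card (UNIV :: 'k set) > 0" using fin by (simp add: finite_UNIV_card_ge_0)
  ultimately have "degree p > 0"
    unfolding p_def by (simp add: degree_add_eq_left)
  then obtain x where "poly p x = 0" using alg_closed_imp_poly_has_root by blast
  moreover have "poly (\<Prod>a\<in>(UNIV::'k set). [:- a, 1:]) x = 0"
    using fin by (auto simp: poly_prod prod_zero_iff)
  ultimately show False by (simp add: p_def)
qed

section \<open>Two by two matrices and the big cell\<close>

definition mat2 :: "'k \<Rightarrow> 'k \<Rightarrow> 'k \<Rightarrow> 'k \<Rightarrow> 'k::zero ^ 2 ^ 2" where
  "mat2 a b c d = vector [vector [a, b], vector [c, d]]"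

lemma mat2_nth [simp]:
  "mat2 a b c d $ 1 $ 1 = a" "mat2 a b c d $ 1 $ 2 = b"
  "mat2 a b c d $ 2 $ 1 = c" "mat2 a b c d $ 2 $ 2 = d"
  by (simp_all add: mat2_def)

lemma mat2_eq_iff: "A = B \<longleftrightarrow> A $ 1 $ 1 = B $ 1 $ 1 \<and> A $ 1 $ 2 = B $ 1 $ 2 \<and>
    A $ 2 $ 1 = B $ 2 $ 1 \<and> A $ 2 $ 2 = B $ 2 $ (2::2)" for A B :: "'k ^ 2 ^ 2"
  by (auto simp: vec_eq_iff forall_2)

lemma mat2_mult: "mat2 a b c d ** mat2 a' b' c' d' =
    mat2 (a * a' + b * c') (a * b' + b * d') (c * a' + d * c') (c * b' + d * (d'::'k::semiring_1))"
  by (simp add: mat2_eq_iff matrix_matrix_mult_def sum_2)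

lemma mat2_one: "mat 1 = mat2 1 0 0 (1::'k::semiring_1)"
  by (simp add: mat2_eq_iff mat_def)

lemma mult_nth2: "((A::'k::semiring_1^2^2) ** B) $ i $ j = A $ i $ 1 * B $ 1 $ j + A $ i $ 2 * B $ 2 $ j"
  by (simp add: matrix_matrix_mult_def sum_2)

lemma SL2_iff: "A \<in> SL2 \<longleftrightarrow> A $ 1 $ 1 * A $ 2 $ 2 - A $ 1 $ 2 * A $ 2 $ 1 = (1::'k::field)"
  by (simp add: SL2_def det_2)

lemma mat2_in_SL2 [simp]: "mat2 a b c d \<in> SL2 \<longleftrightarrow> a * d - b * c = (1::'k::field)"
  by (simp add: SL2_iff)

lemma SL2_mult [simp]: "g \<in> SL2 \<Longrightarrow> h \<in> SL2 \<Longrightarrow> g ** h \<in> SL2"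
  by (simp add: SL2_def det_mul)

lemma one_SL2 [simp]: "mat 1 \<in> SL2" by (simp add: SL2_def)

definition upper :: "'k::field \<Rightarrow> 'k ^ 2 ^ 2" where "upper t = mat2 1 t 0 1"
definition lower :: "'k::field \<Rightarrow> 'k ^ 2 ^ 2" where "lower t = mat2 1 0 t 1"
text \<open>A representative of the nontrivial Weyl group element; conjugation by it inverts the
  torus.\<close>

definition swap :: "'k::field ^ 2 ^ 2" where "swap = mat2 0 1 (-1) 0"

lemma torus_mat2: "torus t = mat2 t 0 0 (inverse t)"
  by (simp add: torus_def mat2_def)

lemma upper_SL2 [simp]: "upper t \<in> SL2" and lower_SL2 [simp]: "lower t \<in> SL2"
  and swap_SL2 [simp]: "swap \<in> SL2" and torus_SL2 [simp]: "t \<noteq> 0 \<Longrightarrow> torus t \<in> SL2"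
  by (simp_all add: upper_def lower_def swap_def torus_mat2)

lemma inverse_SL2:
  assumes "g \<in> SL2" obtains h where "h \<in> SL2" "g ** h = mat 1" "h ** g = mat 1"
proof
  let ?h = "mat2 (g$2$2) (- (g$1$2)) (- (g$2$1)) (g$1$1)"
  show "?h \<in> SL2" "g ** ?h = mat 1" "?h ** g = mat 1"
    using assms by (auto simp: SL2_iff mat2_eq_iff mult_nth2 mat2_one algebra_simps)
qed

text \<open>Gauss decomposition on the open cell; the lower right entry is forced by the
  determinant. It reduces the action of a group element to weights and divided powers.\<close>

lemma big_cell:
  assumes "g \<in> SL2" "g $ 1 $ 1 \<noteq> 0"
  shows "g = lower (g$2$1 / g$1$1) ** (torus (g$1$1) ** upper (g$1$2 / g$1$1))"
  using assms by (auto simp: SL2_iff lower_def upper_def torus_mat2 mat2_mult mat2_eq_iff field_simps)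

text \<open>Words over the finite set of index pairs, so there are only countably many; this is what
  keeps \<open>coind M\<close> of countable dimension.\<close>

definition monomial_fun :: "(2 \<times> 2) list \<Rightarrow> 'k::field ^ 2 ^ 2 \<Rightarrow> 'k" where
  "monomial_fun l g = (\<Prod>(i, j)\<leftarrow>l. g $ i $ j)"

lemma polynomial_fun_monomial_fun: "polynomial_fun (monomial_fun l)"
proof (induction l)
  case Nil then show ?case using polynomial_fun.const[of 1] by (simp add: monomial_fun_def[abs_def])
next
  case (Cons x l)
  obtain i j where x: "x = (i, j)" by (cases x)
  show ?case using polynomial_fun.mult[OF polynomial_fun.coord Cons, of i j]
    by (simp add: monomial_fun_def[abs_def] x)
qed

lemma polynomial_fun_sum_monomials:
  assumes "polynomial_fun p"
  shows "\<exists>xs. \<forall>g. p g = (\<Sum>(a, l)\<leftarrow>xs. a * monomial_fun l g)"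
  using assms
proof induction
  case (const a)
  show ?case by (rule exI[of _ "[(a, [])]"]) (simp add: monomial_fun_def)
next
  case (coord i j)
  show ?case by (rule exI[of _ "[(1, [(i, j)])]"]) (simp add: monomial_fun_def)
next
  case (add p q)
  then obtain xs ys where "\<forall>g. p g = (\<Sum>(a, l)\<leftarrow>xs. a * monomial_fun l g)"
    "\<forall>g. q g = (\<Sum>(a, l)\<leftarrow>ys. a * monomial_fun l g)" by blast
  then show ?case by (intro exI[of _ "xs @ ys"]) simp
next
  case (mult p q)
  then obtain xs ys where xs: "\<forall>g. p g = (\<Sum>(a, l)\<leftarrow>xs. a * monomial_fun l g)"
    and ys: "\<forall>g. q g = (\<Sum>(a, l)\<leftarrow>ys. a * monomial_fun l g)" by blast
  have *: "(\<Sum>(a, l)\<leftarrow>xs. a * monomial_fun l g) * (\<Sum>(a, l)\<leftarrow>ys. a * monomial_fun l g) =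
      (\<Sum>(a, l)\<leftarrow>concat (map (\<lambda>(a, l). map (\<lambda>(b, m). (a * b, l @ m)) ys) xs). a * monomial_fun l g)"
    for g :: "'a ^ 2 ^ 2"
  proof (induction xs)
    case (Cons x xs)
    have "a * monomial_fun l g * (\<Sum>(a, l)\<leftarrow>ys. a * monomial_fun l g) =
        (\<Sum>(a, l)\<leftarrow>map (\<lambda>(b, m). (a * b, l @ m)) ys. a * monomial_fun l g)" for a l
      by (induction ys) (auto simp: monomial_fun_def algebra_simps)
    with Cons show ?case by (cases x) (simp add: algebra_simps)
  qed simp
  show ?case unfolding xs[rule_format] ys[rule_format] * by blast
qed

lemma polynomial_fun_power: "polynomial_fun p \<Longrightarrow> polynomial_fun (\<lambda>g. p g ^ n)"
  by (induction n) (auto intro: polynomial_fun.intros)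

text \<open>The comultiplication of the coordinate ring: matrix multiplication gives it on entries,
  and it extends multiplicatively. It makes right translation of functions a rational
  action.\<close>

lemma polynomial_fun_comult:
  assumes "polynomial_fun p"
  shows "\<exists>xs. set xs \<subseteq> Collect polynomial_fun \<times> Collect polynomial_fun \<and>
    (\<forall>h g. p (h ** g) = (\<Sum>(P, Q)\<leftarrow>xs. P h * Q g))"
  using assms
proof induction
  case (const a)
  show ?case by (rule exI[of _ "[(\<lambda>_. a, \<lambda>_. 1)]"]) (auto intro: polynomial_fun.intros)
next
  case (coord i j)
  show ?case by (rule exI[of _ "[(\<lambda>g. g $ i $ 1, \<lambda>g. g $ 1 $ j), (\<lambda>g. g $ i $ 2, \<lambda>g. g $ 2 $ j)]"])
      (auto intro: polynomial_fun.intros simp: mult_nth2)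
next
  case (add p q)
  then obtain xs ys where "set xs \<subseteq> Collect polynomial_fun \<times> Collect polynomial_fun"
    "\<forall>h g. p (h ** g) = (\<Sum>(P, Q)\<leftarrow>xs. P h * Q g)"
    "set ys \<subseteq> Collect polynomial_fun \<times> Collect polynomial_fun"
    "\<forall>h g. q (h ** g) = (\<Sum>(P, Q)\<leftarrow>ys. P h * Q g)" by auto
  then show ?case by (intro exI[of _ "xs @ ys"]) simp
next
  case (mult p q)
  then obtain xs ys where xs: "set xs \<subseteq> Collect polynomial_fun \<times> Collect polynomial_fun"
    "\<forall>h g. p (h ** g) = (\<Sum>(P, Q)\<leftarrow>xs. P h * Q g)"
    and ys: "set ys \<subseteq> Collect polynomial_fun \<times> Collect polynomial_fun"
    "\<forall>h g. q (h ** g) = (\<Sum>(P, Q)\<leftarrow>ys. P h * Q g)" by auto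
  let ?zs = "concat (map (\<lambda>(P, Q). map (\<lambda>(P', Q'). (\<lambda>h. P h * P' h, \<lambda>g. Q g * Q' g)) ys) xs)"
  have *: "(\<Sum>(P, Q)\<leftarrow>xs. P h * Q g) * (\<Sum>(P, Q)\<leftarrow>ys. P h * Q g) = (\<Sum>(P, Q)\<leftarrow>?zs. P h * Q g)"
    for h g :: "'a ^ 2 ^ 2"
  proof (induction xs)
    case (Cons x xs)
    have "P h * Q g * (\<Sum>(P, Q)\<leftarrow>ys. P h * Q g) =
        (\<Sum>(P, Q)\<leftarrow>map (\<lambda>(P', Q'). (\<lambda>h. P h * P' h, \<lambda>g. Q g * Q' g)) ys. P h * Q g)" for P Q
      by (induction ys) (auto simp: algebra_simps)
    with Cons show ?case by (cases x) (simp add: algebra_simps)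
  qed simp
  have "set ?zs \<subseteq> Collect polynomial_fun \<times> Collect polynomial_fun"
    using xs(1) ys(1) by (fastforce intro: polynomial_fun.mult)
  then show ?case using xs(2) ys(2) * by (intro exI[of _ ?zs]) simp
qed

text \<open>Curves along which regular functions become polynomials in the parameter, so that
  coefficients can be compared. The instances are the two root subgroups and translates of
  them.\<close>

definition polynomial_curve :: "('k::field \<Rightarrow> 'k ^ 2 ^ 2) \<Rightarrow> bool" where
  "polynomial_curve \<gamma> \<longleftrightarrow> (\<forall>t. \<gamma> t \<in> SL2) \<and> (\<forall>i j. \<exists>q. \<forall>t. \<gamma> t $ i $ j = poly q t)"

lemma polynomial_fun_curve:
  assumes "polynomial_fun c" "polynomial_curve \<gamma>"
  shows "\<exists>q. \<forall>t. c (\<gamma> t) = poly q t"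
  using assms(1)
proof induction
  case (const a) show ?case by (rule exI[of _ "[:a:]"]) simp
next
  case (coord i j) then show ?case using assms(2) by (simp add: polynomial_curve_def)
next
  case (add p q) then show ?case by (metis poly_add)
next
  case (mult p q) then show ?case by (metis poly_mult)
qed

lemma polynomial_curve_mult:
  assumes "polynomial_curve \<gamma>" "h \<in> SL2" shows "polynomial_curve (\<lambda>t. \<gamma> t ** h)"
  unfolding polynomial_curve_def
proof (intro conjI allI)
  show "\<gamma> t ** h \<in> SL2" for t using assms by (simp add: polynomial_curve_def)
  fix i j :: 2
  obtain p q where "\<forall>t. \<gamma> t $ i $ 1 = poly p t" "\<forall>t. \<gamma> t $ i $ 2 = poly q t"
    using assms by (meson polynomial_curve_def)
  then show "\<exists>q. \<forall>t. (\<gamma> t ** h) $ i $ j = poly q t"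
    by (intro exI[of _ "smult (h$1$j) p + smult (h$2$j) q"]) (simp add: mult_nth2 algebra_simps)
qed

lemma polynomial_curve_upper: "polynomial_curve upper"
  unfolding polynomial_curve_def
proof (intro conjI allI)
  fix i j :: 2
  have "\<forall>t. upper t $ i $ j = poly (mat2 1 [:0,1:] 0 1 $ i $ j) (t::'a)"
    using exhaust_2[of i] exhaust_2[of j] by (auto simp: upper_def)
  then show "\<exists>q. \<forall>t. upper t $ i $ j = poly q (t::'a)" by blast
qed simp

lemma polynomial_curve_lower: "polynomial_curve lower"
  unfolding polynomial_curve_def
proof (intro conjI allI)
  fix i j :: 2
  have "\<forall>t. lower t $ i $ j = poly (mat2 1 0 [:0,1:] 1 $ i $ j) (t::'a)"
    using exhaust_2[of i] exhaust_2[of j] by (auto simp: lower_def)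
  then show "\<exists>q. \<forall>t. lower t $ i $ j = poly q (t::'a)" by blast
qed simp

text \<open>The entry \<open>inverse t\<close> has a pole at 0, so only Laurent polynomials arise;
  \<open>t ^ N\<close> clears the denominator.\<close>

lemma polynomial_fun_torus:
  assumes "polynomial_fun c"
  shows "\<exists>N q. \<forall>t. t \<noteq> 0 \<longrightarrow> t ^ N * c (torus t) = poly q t"
  using assms
proof induction
  case (const a) show ?case by (intro exI[of _ 0] exI[of _ "[:a:]"]) simp
next
  case (coord i j)
  have "\<forall>t. t \<noteq> 0 \<longrightarrow> t ^ 1 * torus t $ i $ j = poly (mat2 [:0,0,1:] 0 0 1 $ i $ j) (t::'a)"
    using exhaust_2[of i] exhaust_2[of j] by (auto simp: torus_mat2)
  then show ?case by blast
next
  case (add p q)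
  then obtain N p' N' q' where "\<And>t. t \<noteq> 0 \<Longrightarrow> t ^ N * p (torus t) = poly p' t"
    "\<And>t. t \<noteq> 0 \<Longrightarrow> t ^ N' * q (torus t) = poly q' t" by auto
  moreover have "t ^ (N + N') * (p (torus t) + q (torus t)) =
      t ^ N' * (t ^ N * p (torus t)) + t ^ N * (t ^ N' * q (torus t))" for t
    by (simp add: power_add algebra_simps)
  ultimately have "\<forall>t. t \<noteq> 0 \<longrightarrow> t ^ (N + N') * (p (torus t) + q (torus t)) =
      poly (monom 1 N' * p' + monom 1 N * q') t"
    by (simp add: poly_monom)
  then show ?case by blast
next
  case (mult p q)
  then obtain N p' N' q' where "\<And>t. t \<noteq> 0 \<Longrightarrow> t ^ N * p (torus t) = poly p' t"
    "\<And>t. t \<noteq> 0 \<Longrightarrow> t ^ N' * q (torus t) = poly q' t" by auto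
  moreover have "t ^ (N + N') * (p (torus t) * q (torus t)) =
      (t ^ N * p (torus t)) * (t ^ N' * q (torus t))" for t
    by (simp add: power_add algebra_simps)
  ultimately have "\<forall>t. t \<noteq> 0 \<longrightarrow> t ^ (N + N') * (p (torus t) * q (torus t)) = poly (p' * q') t"
    by (metis poly_mult)
  then show ?case by blast
qed

section \<open>Uniqueness of the coefficients of vector-valued polynomials and Laurent
  polynomials\<close>

context vector_space
begin

text \<open>If \<open>v n\<close> were nonzero, a linear functional with value 1 there would give a
  polynomial that vanishes at all nonzero scalars although its coefficient in degree
  \<open>n\<close> is 1.\<close>

lemma nat_coeffs_zero:
  assumes inf: "infinite (UNIV :: 'a set)"
    and z: "\<And>t. t \<noteq> 0 \<Longrightarrow> (\<Sum>n\<le>N. scale (t ^ n) (v n)) = 0" and n: "n \<le> N"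
  shows "v n = 0"
proof (rule ccontr)
  assume nz: "v n \<noteq> 0"
  interpret vp: vector_space_pair scale "(*)"
    by unfold_locales (auto simp: algebra_simps)
  have "independent {v n}" using nz by simp
  from vp.linear_independent_extend[OF this, of "\<lambda>_. 1"]
  obtain l where l: "Vector_Spaces.linear scale (*) l" "l (v n) = 1" by auto
  interpret l: Vector_Spaces.linear scale "(*)" l by fact
  define p where "p = (\<Sum>n\<le>N. monom (l (v n)) n)"
  have "poly p t = 0" if "t \<noteq> 0" for t
  proof -
    have "poly p t = (\<Sum>n\<le>N. l (scale (t ^ n) (v n)))"
      by (simp add: p_def poly_sum poly_monom l.scale mult.commute)
    also have "\<dots> = l (\<Sum>n\<le>N. scale (t ^ n) (v n))" by (simp add: l.sum)
    finally show ?thesis using z[OF that] by simp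
  qed
  then have "- {0} \<subseteq> {t. poly p t = 0}" by auto
  moreover have "infinite (- {0} :: 'a set)" using inf by (simp add: Compl_eq_Diff_UNIV)
  ultimately have "p = 0" using poly_roots_finite finite_subset by blast
  then have "coeff p n = 0" by simp
  moreover have "coeff p n = l (v n)" using n
    by (simp add: p_def coeff_sum sum.delta)
  ultimately show False using l by simp
qed

lemma nat_coeffs_unique:
  assumes inf: "infinite (UNIV :: 'a set)"
    and v: "\<And>n. n > N \<Longrightarrow> v n = 0" and w: "\<And>n. n > M \<Longrightarrow> w n = 0"
    and z: "\<And>t. t \<noteq> 0 \<Longrightarrow> (\<Sum>n\<le>N. scale (t ^ n) (v n)) = (\<Sum>n\<le>M. scale (t ^ n) (w n))"
  shows "v = w"
proof
  fix n
  let ?K = "max n (max N M)"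
  have N: "(\<Sum>n\<le>N. scale (t ^ n) (v n)) = (\<Sum>n\<le>?K. scale (t ^ n) (v n))" for t
    by (rule sum.mono_neutral_left) (use v in auto)
  have M: "(\<Sum>n\<le>M. scale (t ^ n) (w n)) = (\<Sum>n\<le>?K. scale (t ^ n) (w n))" for t
    by (rule sum.mono_neutral_left) (use w in auto)
  have "(\<Sum>n\<le>?K. scale (t ^ n) (v n - w n)) = 0" if "t \<noteq> 0" for t
    using z[OF that] N M by (simp add: scale_right_diff_distrib sum_subtractf)
  from nat_coeffs_zero[OF inf this, of n] show "v n = w n" by simp
qed

text \<open>Multiplication by a high power of \<open>t\<close> makes all exponents nonnegative and
  reduces the claim to \<open>nat_coeffs_zero\<close>.\<close>

lemma int_coeffs_unique:
  assumes inf: "infinite (UNIV :: 'a set)" and fin: "finite A" "finite B"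
    and v: "\<And>n. n \<notin> A \<Longrightarrow> v n = 0" and w: "\<And>n. n \<notin> B \<Longrightarrow> w n = 0"
    and z: "\<And>t. t \<noteq> 0 \<Longrightarrow> (\<Sum>n\<in>A. scale (t powi n) (v n)) = (\<Sum>n\<in>B. scale (t powi n) (w n))"
  shows "v = w"
proof
  fix m
  obtain K :: nat where K: "\<And>n. n \<in> insert m (A \<union> B) \<Longrightarrow> \<bar>n\<bar> \<le> int K"
  proof
    fix n assume "n \<in> insert m (A \<union> B)"
    then have "nat \<bar>n\<bar> \<le> Max ((\<lambda>n. nat \<bar>n\<bar>) ` insert m (A \<union> B))"
      using fin by (intro Max_ge) auto
    then show "\<bar>n\<bar> \<le> int (Max ((\<lambda>n. nat \<bar>n\<bar>) ` insert m (A \<union> B)))" by linarith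
  qed
  define x where "x n = v (int n - int K) - w (int n - int K)" for n :: nat
  have *: "(\<Sum>n\<in>C. scale (t powi n) (u n)) =
      scale (t powi (- int K)) (\<Sum>n\<le>2*K. scale (t ^ n) (u (int n - int K)))"
    if C: "finite C" "C \<subseteq> A \<union> B" "\<And>n. n \<notin> C \<Longrightarrow> u n = 0" and t: "t \<noteq> 0" for C u t
  proof -
    have "(\<Sum>n\<in>C. scale (t powi n) (u n)) = (\<Sum>n\<in>{-int K..int K}. scale (t powi n) (u n))"
      by (rule sum.mono_neutral_left) (use K C in \<open>force+\<close>)
    also have "\<dots> = (\<Sum>n\<le>2*K. scale (t powi (int n - int K)) (u (int n - int K)))"
      by (rule sum.reindex_bij_witness[of _ "\<lambda>n. int n - int K" "\<lambda>n. nat (n + int K)"]) auto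
    also have "\<dots> = scale (t powi (- int K)) (\<Sum>n\<le>2*K. scale (t ^ n) (u (int n - int K)))"
      using t by (simp add: scale_sum_right power_int_diff power_int_minus field_simps)
    finally show ?thesis .
  qed
  have "(\<Sum>n\<le>2*K. scale (t ^ n) (x n)) = 0" if t: "t \<noteq> 0" for t
    using z[OF t] *[OF fin(1) _ v t] *[OF fin(2) _ w t] t
    by (simp add: x_def scale_right_diff_distrib sum_subtractf)
  from nat_coeffs_zero[OF inf this, of "nat (m + int K)"] have "x (nat (m + int K)) = 0"
    using K[of m] by fastforce
  moreover have "int (nat (m + int K)) - int K = m" using K[of m] by auto
  ultimately show "v m = w m" by (simp add: x_def)
qed

end

section \<open>Rational modules\<close>

text \<open>The elements of k[G] \<otimes> M written as functions. Only the values on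
  \<open>SL2\<close> are constrained, hence the congruence case in
  \<open>regular_induct\<close>.\<close>

definition regular :: "('k::field, 'v::ab_group_add) gmod \<Rightarrow> ('k ^ 2 ^ 2 \<Rightarrow> 'v) \<Rightarrow> bool" where
  "regular M f \<longleftrightarrow> (\<exists>xs. set xs \<subseteq> Collect polynomial_fun \<times> car M \<and>
     (\<forall>g\<in>SL2. f g = (\<Sum>(c, b)\<leftarrow>xs. scl M (c g) b)))"

locale gmodule =
  fixes M :: "('k::field, 'v::ab_group_add) gmod"
  assumes group_module: "group_module M"
begin

sublocale vector_space "scl M"
  using group_module by (simp add: group_module_def)

lemma subspace_car: "subspace (car M)"
  and act_closed [simp, intro]: "g \<in> SL2 \<Longrightarrow> v \<in> car M \<Longrightarrow> act M g v \<in> car M"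
  and act_add: "g \<in> SL2 \<Longrightarrow> v \<in> car M \<Longrightarrow> w \<in> car M \<Longrightarrow> act M g (v + w) = act M g v + act M g w"
  and act_scale: "g \<in> SL2 \<Longrightarrow> v \<in> car M \<Longrightarrow> act M g (scl M a v) = scl M a (act M g v)"
  and act_one: "v \<in> car M \<Longrightarrow> act M (mat 1) v = v"
  and act_mult: "g \<in> SL2 \<Longrightarrow> h \<in> SL2 \<Longrightarrow> v \<in> car M \<Longrightarrow> act M (g ** h) v = act M g (act M h v)"
  using group_module unfolding group_module_def by auto

lemma car_zero [simp]: "0 \<in> car M" and car_add [intro]: "v \<in> car M \<Longrightarrow> w \<in> car M \<Longrightarrow> v + w \<in> car M"
  and car_scale [intro]: "v \<in> car M \<Longrightarrow> scl M a v \<in> car M"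
  and car_diff [intro]: "v \<in> car M \<Longrightarrow> w \<in> car M \<Longrightarrow> v - w \<in> car M"
  using subspace_car subspace_0 subspace_add subspace_scale subspace_diff by auto

lemma car_sum [intro]: "(\<And>i. i \<in> A \<Longrightarrow> f i \<in> car M) \<Longrightarrow> sum f A \<in> car M"
  by (rule subspace_sum[OF subspace_car])

lemma act_zero: "g \<in> SL2 \<Longrightarrow> act M g 0 = 0"
  using act_add[of g 0 0] by simp

lemma act_sum: "g \<in> SL2 \<Longrightarrow> (\<And>i. i \<in> A \<Longrightarrow> f i \<in> car M) \<Longrightarrow> act M g (sum f A) = (\<Sum>i\<in>A. act M g (f i))"
  by (induction A rule: infinite_finite_induct) (simp_all add: act_zero act_add car_sum)

lemma act_inj:
  assumes "g \<in> SL2" "v \<in> car M" "w \<in> car M" "act M g v = act M g w" shows "v = w"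
proof -
  obtain h where h: "h \<in> SL2" "h ** g = mat 1" using inverse_SL2[OF assms(1)] by blast
  then show ?thesis using assms act_mult[of h g] act_one by metis
qed

lemma regular_cong: "(\<And>g. g \<in> SL2 \<Longrightarrow> f g = f' g) \<Longrightarrow> regular M f \<longleftrightarrow> regular M f'"
  by (simp add: regular_def)

lemma regular_transfer: "regular M f' \<Longrightarrow> (\<And>g. g \<in> SL2 \<Longrightarrow> f g = f' g) \<Longrightarrow> regular M f"
  using regular_cong by blast

lemma regular_tensor: "polynomial_fun c \<Longrightarrow> b \<in> car M \<Longrightarrow> regular M (\<lambda>g. scl M (c g) b)"
  unfolding regular_def by (rule exI[of _ "[(c, b)]"]) simp

lemma regular_zero: "regular M (\<lambda>g. 0)"
  unfolding regular_def by (rule exI[of _ "[]"]) simp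

lemma regular_add: "regular M f \<Longrightarrow> regular M f' \<Longrightarrow> regular M (\<lambda>g. f g + f' g)"
  unfolding regular_def
proof (elim exE conjE)
  fix xs ys
  assume "set xs \<subseteq> Collect polynomial_fun \<times> car M" "set ys \<subseteq> Collect polynomial_fun \<times> car M"
    "\<forall>g\<in>SL2. f g = (\<Sum>(c, b)\<leftarrow>xs. scl M (c g) b)" "\<forall>g\<in>SL2. f' g = (\<Sum>(c, b)\<leftarrow>ys. scl M (c g) b)"
  then show "\<exists>xs. set xs \<subseteq> Collect polynomial_fun \<times> car M \<and>
      (\<forall>g\<in>SL2. f g + f' g = (\<Sum>(c, b)\<leftarrow>xs. scl M (c g) b))"
    by (intro exI[of _ "xs @ ys"]) simp
qed

lemma regular_sum: "(\<And>i. i \<in> A \<Longrightarrow> regular M (f i)) \<Longrightarrow> regular M (\<lambda>g. \<Sum>i\<in>A. f i g)"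
  by (induction A rule: infinite_finite_induct) (auto simp: regular_zero regular_add)

lemma regular_induct [consumes 1, case_names zero add cong]:
  assumes "regular M f" and "P (\<lambda>g. 0)"
    and "\<And>c b f. polynomial_fun c \<Longrightarrow> b \<in> car M \<Longrightarrow> P f \<Longrightarrow> P (\<lambda>g. scl M (c g) b + f g)"
    and "\<And>f f'. (\<And>g. g \<in> SL2 \<Longrightarrow> f g = f' g) \<Longrightarrow> P f \<Longrightarrow> P f'"
  shows "P f"
proof -
  obtain xs where xs: "set xs \<subseteq> Collect polynomial_fun \<times> car M"
    and f: "\<And>g. g \<in> SL2 \<Longrightarrow> f g = (\<Sum>(c, b)\<leftarrow>xs. scl M (c g) b)"
    using assms(1) by (auto simp: regular_def)
  from xs have "P (\<lambda>g. \<Sum>(c, b)\<leftarrow>xs. scl M (c g) b)"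
    by (induction xs) (auto simp: assms(2) intro: assms(3))
  then show ?thesis by (rule assms(4)[rotated]) (simp add: f)
qed

lemma regular_mult: "regular M f \<Longrightarrow> polynomial_fun p \<Longrightarrow> regular M (\<lambda>g. scl M (p g) (f g))"
proof (induction rule: regular_induct)
  case zero then show ?case by (simp add: regular_zero)
next
  case (add c b f)
  then show ?case using regular_add[OF regular_tensor[OF polynomial_fun.mult[of p c]]]
    by (simp add: scale_right_distrib)
next
  case (cong f f')
  then show ?case using regular_cong[of "\<lambda>g. scl M (p g) (f g)" "\<lambda>g. scl M (p g) (f' g)"] by simp
qed

lemma regular_scale: "regular M f \<Longrightarrow> regular M (\<lambda>g. scl M a (f g))"
  by (rule regular_mult) (auto intro: polynomial_fun.intros)

lemma regular_car: "regular M f \<Longrightarrow> g \<in> SL2 \<Longrightarrow> f g \<in> car M"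
  by (induction rule: regular_induct) auto

lemma regular_finite_span:
  assumes "regular M f" obtains B where "finite B" "B \<subseteq> car M" "\<And>g. g \<in> SL2 \<Longrightarrow> f g \<in> span B"
proof -
  obtain xs where xs: "set xs \<subseteq> Collect polynomial_fun \<times> car M"
    and f: "\<And>g. g \<in> SL2 \<Longrightarrow> f g = (\<Sum>(c, b)\<leftarrow>xs. scl M (c g) b)"
    using assms by (auto simp: regular_def)
  have "(\<Sum>(c, b)\<leftarrow>ys. scl M (c g) b) \<in> span (snd ` set xs)" if "set ys \<subseteq> set xs" for ys g
    using that
  proof (induction ys)
    case Nil then show ?case by (simp add: span_zero)
  next
    case (Cons y ys)
    then have "snd y \<in> span (snd ` set xs)" by (auto intro: span_base)
    with Cons show ?case by (cases y) (auto intro: span_add span_scale)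
  qed
  then show ?thesis by (intro that[of "snd ` set xs"]) (use xs f in auto)
qed

lemma regular_linear:
  assumes f: "regular M f" and h0: "h 0 = 0" and N: "gmodule N"
    and hc: "\<And>x. x \<in> car M \<Longrightarrow> h x \<in> car N"
    and ha: "\<And>x y. x \<in> car M \<Longrightarrow> y \<in> car M \<Longrightarrow> h (x + y) = h x + h y"
    and hs: "\<And>a x. x \<in> car M \<Longrightarrow> h (scl M a x) = scl N a (h x)"
  shows "regular N (\<lambda>g. h (f g))"
proof -
  interpret N: gmodule N by fact
  have "regular N (\<lambda>g. h (f g)) \<and> (\<forall>g\<in>SL2. f g \<in> car M)"
    using f
  proof (induction rule: regular_induct)
    case zero then show ?case by (simp add: h0 N.regular_zero)
  next
    case (add c b f)
    have "regular N (\<lambda>g. scl N (c g) (h b) + h (f g))"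
      using add by (intro N.regular_add N.regular_tensor hc) auto
    moreover have "scl N (c g) (h b) + h (f g) = h (scl M (c g) b + f g)" if "g \<in> SL2" for g
      using add that by (simp add: ha hs car_scale)
    ultimately show ?case
      using add N.regular_cong[of "\<lambda>g. scl N (c g) (h b) + h (f g)" "\<lambda>g. h (scl M (c g) b + f g)"]
      by auto
  next
    case (cong f f')
    then show ?case using N.regular_cong[of "\<lambda>g. h (f g)" "\<lambda>g. h (f' g)"] by auto
  qed
  then show ?thesis by blast
qed

lemma polynomial_fun_translate_right: "polynomial_fun p \<Longrightarrow> polynomial_fun (\<lambda>g. p (g ** h))"
proof (induction rule: polynomial_fun.induct)
  case (coord i j)
  show ?case unfolding mult_nth2 by (intro polynomial_fun.intros)
qed (auto intro: polynomial_fun.intros)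

lemma regular_translate_right:
  assumes "regular M f" "h \<in> SL2" shows "regular M (\<lambda>g. f (g ** h))"
  using assms(1)
proof (induction rule: regular_induct)
  case (add c b f)
  then show ?case using regular_add[OF regular_tensor[OF polynomial_fun_translate_right[of c]]] by simp
next
  case (cong f f')
  then show ?case using regular_cong[of "\<lambda>g. f (g ** h)" "\<lambda>g. f' (g ** h)"] assms(2) by simp
qed (simp add: regular_zero)

lemma regular_curve:
  assumes "regular M f" and \<gamma>: "polynomial_curve \<gamma>"
  shows "\<exists>w N. (\<forall>n. w n \<in> car M) \<and> (\<forall>n>N. w n = 0) \<and> (\<forall>t. f (\<gamma> t) = (\<Sum>n\<le>N. scl M (t ^ n) (w n)))"
  using assms(1)
proof (induction rule: regular_induct)
  case zero then show ?case by (intro exI[of _ "\<lambda>_. 0"] exI[of _ 0]) simp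
next
  case (add c b f)
  then obtain w N where w: "\<forall>n. w n \<in> car M" "\<forall>n>N. w n = 0"
    "\<And>t. f (\<gamma> t) = (\<Sum>n\<le>N. scl M (t ^ n) (w n))" by auto
  obtain q where q: "\<And>t. c (\<gamma> t) = poly q t" using polynomial_fun_curve[OF add(1) \<gamma>] by auto
  let ?K = "max N (degree q)"
  let ?w = "\<lambda>n. scl M (coeff q n) b + w n"
  have "scl M (c (\<gamma> t)) b + f (\<gamma> t) = (\<Sum>n\<le>?K. scl M (t ^ n) (?w n))" for t
  proof -
    have "(\<Sum>n\<le>N. scl M (t ^ n) (w n)) = (\<Sum>n\<le>?K. scl M (t ^ n) (w n))"
      by (rule sum.mono_neutral_left) (use w in auto)
    moreover have "c (\<gamma> t) = (\<Sum>n\<le>?K. coeff q n * t ^ n)"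
      unfolding q poly_altdef by (rule sum.mono_neutral_left) (auto simp: coeff_eq_0)
    ultimately show ?thesis
      by (simp add: w(3) scale_sum_left scale_right_distrib sum.distrib mult.commute)
  qed
  then show ?case using w add(2)
    by (intro exI[of _ ?w] exI[of _ ?K]) (auto simp: coeff_eq_0 intro!: car_add car_scale)
next
  case (cong f f')
  have "f' (\<gamma> t) = f (\<gamma> t)" for t using cong(1)[of "\<gamma> t"] \<gamma> by (simp add: polynomial_curve_def)
  then show ?case using cong(2) by simp
qed

lemma regular_torus:
  assumes "regular M f"
  shows "\<exists>w A. (\<forall>n. w n \<in> car M) \<and> finite A \<and> (\<forall>n. n \<notin> A \<longrightarrow> w n = 0) \<and>
    (\<forall>t. t \<noteq> 0 \<longrightarrow> f (torus t) = (\<Sum>n\<in>A. scl M (t powi n) (w n)))"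
  using assms
proof (induction rule: regular_induct)
  case zero then show ?case by (intro exI[of _ "\<lambda>_. 0"] exI[of _ "{}"]) simp
next
  case (add c b f)
  then obtain w A where w: "\<forall>n. w n \<in> car M" "finite A" "\<forall>n. n \<notin> A \<longrightarrow> w n = 0"
    "\<And>t. t \<noteq> 0 \<Longrightarrow> f (torus t) = (\<Sum>n\<in>A. scl M (t powi n) (w n))" by auto
  obtain q N where q: "\<And>t. t \<noteq> 0 \<Longrightarrow> t ^ N * c (torus t) = poly q t"
    using polynomial_fun_torus[OF add(1)] by auto
  define B where "B = (\<lambda>n. int n - int N) ` {..degree q}"
  define u where "u n = scl M (if n \<in> B then coeff q (nat (n + int N)) else 0) b" for n
  have fB: "finite B" by (simp add: B_def)
  have B: "scl M (c (torus t)) b = (\<Sum>n\<in>B. scl M (t powi n) (u n))" if t: "t \<noteq> 0" for t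
  proof -
    have "c (torus t) = t powi (- int N) * poly q t"
      using q[OF t] t by (simp add: power_int_minus field_simps)
    also have "\<dots> = (\<Sum>n\<le>degree q. t powi (int n - int N) * coeff q n)"
      using t by (simp add: poly_altdef sum_distrib_left power_int_diff power_int_minus field_simps)
    also have "\<dots> = (\<Sum>n\<in>B. t powi n * coeff q (nat (n + int N)))"
      unfolding B_def by (subst sum.reindex) (auto simp: inj_on_def)
    finally show ?thesis by (simp add: scale_sum_left u_def)
  qed
  have "scl M (c (torus t)) b + f (torus t) = (\<Sum>n\<in>A \<union> B. scl M (t powi n) (u n + w n))"
    if t: "t \<noteq> 0" for t
  proof -
    have "(\<Sum>n\<in>A. scl M (t powi n) (w n)) = (\<Sum>n\<in>A \<union> B. scl M (t powi n) (w n))"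
      by (rule sum.mono_neutral_left) (use w fB in auto)
    moreover have "(\<Sum>n\<in>B. scl M (t powi n) (u n)) = (\<Sum>n\<in>A \<union> B. scl M (t powi n) (u n))"
      by (rule sum.mono_neutral_left) (use w fB in \<open>auto simp: u_def\<close>)
    ultimately show ?thesis
      by (simp add: w(4)[OF t] B[OF t] scale_right_distrib sum.distrib)
  qed
  then show ?case using w add(2) fB
    by (intro exI[of _ "\<lambda>n. u n + w n"] exI[of _ "A \<union> B"]) (auto simp: u_def intro!: car_add car_scale)
next
  case (cong f f')
  have "f' (torus t) = f (torus t)" if "t \<noteq> 0" for t using cong(1)[of "torus t"] that by simp
  then show ?case using cong(2) by simp
qed

text \<open>The basis is chosen inside the orbit. For \<open>b = act M (\<gamma> b) v\<close> the
  vector \<open>act M g b\<close> is the orbit map at \<open>g ** \<gamma> b\<close>, so its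
  coordinates are right translates of polynomial functions. Moreover every stable subspace
  containing \<open>v\<close> contains this basis, which gives rationality of submodules.\<close>

lemma orbit_basis:
  assumes v: "v \<in> car M" and reg: "regular M (\<lambda>g. act M g v)"
  shows "\<exists>B c. finite B \<and> B \<subseteq> (\<lambda>g. act M g v) ` SL2 \<and> \<not> dependent B \<and> v \<in> span B \<and>
        (\<forall>b\<in>B. \<forall>b'\<in>B. polynomial_fun (c b' b)) \<and>
        (\<forall>g\<in>SL2. \<forall>b\<in>B. act M g b = (\<Sum>b'\<in>B. scl M (c b' b g) b'))"
proof -
  obtain xs where xs: "set xs \<subseteq> Collect polynomial_fun \<times> car M"
    and f: "\<And>g. g \<in> SL2 \<Longrightarrow> act M g v = (\<Sum>(c, b)\<leftarrow>xs. scl M (c g) b)"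
    using reg by (auto simp: regular_def)
  obtain T where T: "finite T" "\<And>g. g \<in> SL2 \<Longrightarrow> act M g v \<in> span T"
    using regular_finite_span[OF reg] by metis
  define Orb where "Orb = (\<lambda>g. act M g v) ` SL2"
  obtain B where B: "B \<subseteq> Orb" "independent B" "Orb \<subseteq> span B"
    using maximal_independent_subset by metis
  have "finite B" using independent_span_bound[OF T(1) B(2)] B(1) T(2) by (auto simp: Orb_def)
  have "v \<in> Orb" using act_one[OF v] one_SL2 unfolding Orb_def by (metis imageI)
  then have vB: "v \<in> span B" using B by auto
  have "\<forall>b\<in>B. \<exists>g\<in>SL2. b = act M g v" using B(1) by (auto simp: Orb_def)
  then obtain \<gamma> where \<gamma>: "\<And>b. b \<in> B \<Longrightarrow> \<gamma> b \<in> SL2" "\<And>b. b \<in> B \<Longrightarrow> b = act M (\<gamma> b) v" by metis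
  interpret vp: vector_space_pair "scl M" "(*)"
    by unfold_locales (auto simp: algebra_simps)
  have "\<exists>l. Vector_Spaces.linear (scl M) (*) l \<and> (\<forall>x\<in>B. l x = (if x = b then 1 else 0))" for b
    using vp.linear_independent_extend[OF B(2), of "\<lambda>x. if x = b then 1 else 0"] by blast
  then obtain l where l: "\<And>b. Vector_Spaces.linear (scl M) (*) (l b)"
    and ld: "\<And>b x. x \<in> B \<Longrightarrow> l b x = (if x = b then 1 else 0)" by metis
  have coords: "w = (\<Sum>b\<in>B. scl M (l b w) b)" if w: "w \<in> span B" for w
  proof -
    obtain u where u: "w = (\<Sum>b\<in>B. scl M (u b) b)"
      using w span_finite[OF \<open>finite B\<close>] by auto
    have "l b w = u b" if b: "b \<in> B" for b
    proof -
      interpret l: Vector_Spaces.linear "scl M" "(*)" "l b" by (rule l)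
      have "l b w = (\<Sum>x\<in>B. u x * (if x = b then 1 else 0))"
        by (simp add: u l.sum l.scale ld cong: sum.cong)
      also have "\<dots> = (\<Sum>x\<in>B. if b = x then u x else 0)" by (rule sum.cong) auto
      also have "\<dots> = u b" using b \<open>finite B\<close> by simp
      finally show ?thesis .
    qed
    then show ?thesis using u by simp
  qed
  define c where "c b' b g = (\<Sum>(p, x)\<leftarrow>xs. p (g ** \<gamma> b) * l b' x)" for b' b g
  have cpoly: "polynomial_fun (c b' b)" for b' b
    using xs unfolding c_def[abs_def]
  proof (induction xs)
    case Nil then show ?case by (simp add: polynomial_fun.const)
  next
    case (Cons y ys)
    obtain p x where y: "y = (p, x)" by (cases y)
    have "polynomial_fun (\<lambda>g. p (g ** \<gamma> b) * l b' x + (\<Sum>(p, x)\<leftarrow>ys. p (g ** \<gamma> b) * l b' x))"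
      using Cons y by (intro polynomial_fun.add polynomial_fun.mult polynomial_fun.const)
        (auto intro: polynomial_fun_translate_right)
    then show ?case by (simp add: y)
  qed
  have cval: "l b' (act M g b) = c b' b g" if "b \<in> B" "g \<in> SL2" for b' b g
  proof -
    interpret l: Vector_Spaces.linear "scl M" "(*)" "l b'" by (rule l)
    have "act M g b = act M (g ** \<gamma> b) v"
      using \<gamma>[OF that(1)] that v act_mult by metis
    also have "\<dots> = (\<Sum>(p, x)\<leftarrow>xs. scl M (p (g ** \<gamma> b)) x)"
      using f \<gamma> that by simp
    finally have "act M g b = (\<Sum>(p, x)\<leftarrow>xs. scl M (p (g ** \<gamma> b)) x)" .
    moreover have "l b' (\<Sum>(p, x)\<leftarrow>ys. scl M (p (g ** \<gamma> b)) x) = (\<Sum>(p, x)\<leftarrow>ys. p (g ** \<gamma> b) * l b' x)" for ys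
      by (induction ys) (auto simp: l.add l.scale l.zero)
    ultimately show ?thesis by (simp add: c_def)
  qed
  have "act M g b \<in> span B" if "b \<in> B" "g \<in> SL2" for b g
  proof -
    have "act M g b = act M (g ** \<gamma> b) v" using \<gamma>[OF that(1)] that v act_mult by metis
    then have "act M g b \<in> Orb" using \<gamma> that by (auto simp: Orb_def)
    then show ?thesis using B by auto
  qed
  then have "act M g b = (\<Sum>b'\<in>B. scl M (c b' b g) b')" if "b \<in> B" "g \<in> SL2" for b g
    using coords[of "act M g b"] cval that by simp
  then show ?thesis
    using \<open>finite B\<close> B(1,2) vB cpoly by (intro exI[of _ B] exI[of _ c]) (simp add: Orb_def)
qed

lemma rational_moduleI:
  assumes reg: "\<And>v. v \<in> car M \<Longrightarrow> regular M (\<lambda>g. act M g v)"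
  shows "rational_module M"
  unfolding rational_module_def
proof (intro conjI ballI)
  show "group_module M" by (rule group_module)
  fix v assume v: "v \<in> car M"
  then have "(\<lambda>g. act M g v) ` SL2 \<subseteq> car M" by auto
  then show "\<exists>B c. finite B \<and> B \<subseteq> car M \<and> \<not> dependent B \<and> v \<in> span B \<and>
        (\<forall>b\<in>B. \<forall>b'\<in>B. polynomial_fun (c b' b)) \<and>
        (\<forall>g\<in>SL2. \<forall>b\<in>B. act M g b = (\<Sum>b'\<in>B. scl M (c b' b g) b'))"
    using orbit_basis[OF v reg[OF v]]
    by (elim exE conjE) (intro exI conjI, assumption, erule subset_trans, assumption+)
qed

end

locale rmodule = gmodule M for M :: "('k::alg_closed_field, 'v::ab_group_add) gmod" +
  assumes rational: "rational_module M"

lemma rmodule_iff: "rmodule M \<longleftrightarrow> rational_module M"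
  by (auto simp: rmodule_def rmodule_axioms_def gmodule_def rational_module_def)

lemma rmoduleI: "rational_module M \<Longrightarrow> rmodule M"
  by (simp add: rmodule_iff)

context rmodule
begin

lemma finite_stable_span:
  assumes "v \<in> car M"
  obtains B where "finite B" "B \<subseteq> car M" "v \<in> span B" "\<And>g b. g \<in> SL2 \<Longrightarrow> b \<in> span B \<Longrightarrow> act M g b \<in> span B"
proof -
  obtain B c where B: "finite B" "B \<subseteq> car M" "v \<in> span B"
    and c: "\<forall>g\<in>SL2. \<forall>b\<in>B. act M g b = (\<Sum>b'\<in>B. scl M (c b' b g) b')"
    using bspec[OF conjunct2[OF rational[unfolded rational_module_def]] assms]
    by (elim exE conjE) (rule that)
  have "act M g x \<in> span B" if g: "g \<in> SL2" and x: "x \<in> span B" for g x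
  proof -
    obtain u where u: "x = (\<Sum>b\<in>B. scl M (u b) b)"
      using x span_finite[OF B(1)] by auto
    have "act M g x = (\<Sum>b\<in>B. scl M (u b) (act M g b))"
      unfolding u by (subst act_sum) (use g B in \<open>auto simp: act_scale subset_iff\<close>)
    also have "\<dots> \<in> span B"
    proof (rule span_sum, rule span_scale)
      fix b assume b: "b \<in> B"
      show "act M g b \<in> span B" unfolding c[rule_format, OF g b]
        by (intro span_sum span_scale span_base)
    qed
    finally show ?thesis .
  qed
  then show ?thesis using that B by blast
qed

lemma regular_orbit:
  assumes "v \<in> car M" shows "regular M (\<lambda>g. act M g v)"
proof -
  obtain B c where B: "finite B" "B \<subseteq> car M" "v \<in> span B"
    and cp: "\<forall>b\<in>B. \<forall>b'\<in>B. polynomial_fun (c b' b)"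
    and c: "\<forall>g\<in>SL2. \<forall>b\<in>B. act M g b = (\<Sum>b'\<in>B. scl M (c b' b g) b')"
    using bspec[OF conjunct2[OF rational[unfolded rational_module_def]] assms]
    by (elim exE conjE) (rule that)
  obtain u where u: "v = (\<Sum>b\<in>B. scl M (u b) b)"
    using B(3) span_finite[OF B(1)] by auto
  have "regular M (\<lambda>g. \<Sum>b\<in>B. scl M (u b) (\<Sum>b'\<in>B. scl M (c b' b g) b'))"
  proof (rule regular_sum, rule regular_scale, rule regular_sum)
    fix b b' assume "b \<in> B" "b' \<in> B"
    then show "regular M (\<lambda>g. scl M (c b' b g) b')"
      using B cp by (intro regular_tensor) auto
  qed
  moreover have "act M g v = (\<Sum>b\<in>B. scl M (u b) (\<Sum>b'\<in>B. scl M (c b' b g) b'))" if g: "g \<in> SL2" for g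
  proof -
    have "act M g v = (\<Sum>b\<in>B. scl M (u b) (act M g b))"
      unfolding u by (subst act_sum) (use g B in \<open>auto simp: act_scale subset_iff\<close>)
    then show ?thesis using c g by simp
  qed
  ultimately show ?thesis by (rule regular_transfer)
qed

lemma rational_submodule:
  assumes W: "W \<subseteq> car M" "subspace W" "\<And>g w. g \<in> SL2 \<Longrightarrow> w \<in> W \<Longrightarrow> act M g w \<in> W"
  shows "rational_module (M\<lparr>car := W\<rparr>)"
  unfolding rational_module_def
proof (intro conjI ballI)
  show "group_module (M\<lparr>car := W\<rparr>)"
    using group_module W unfolding group_module_def by (auto simp: subset_iff)
  have eqs: "scl (M\<lparr>car := W\<rparr>) = scl M" "car (M\<lparr>car := W\<rparr>) = W" "act (M\<lparr>car := W\<rparr>) = act M"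
    by simp_all
  fix v assume v: "v \<in> car (M\<lparr>car := W\<rparr>)"
  then have vc: "v \<in> car M" and orb: "(\<lambda>g. act M g v) ` SL2 \<subseteq> car (M\<lparr>car := W\<rparr>)" using W by auto
  show "\<exists>B c. finite B \<and> B \<subseteq> car (M\<lparr>car := W\<rparr>) \<and> \<not> module.dependent (scl (M\<lparr>car := W\<rparr>)) B \<and>
        v \<in> module.span (scl (M\<lparr>car := W\<rparr>)) B \<and>
        (\<forall>b\<in>B. \<forall>b'\<in>B. polynomial_fun (c b' b)) \<and>
        (\<forall>g\<in>SL2. \<forall>b\<in>B. act (M\<lparr>car := W\<rparr>) g b = (\<Sum>b'\<in>B. scl (M\<lparr>car := W\<rparr>) (c b' b g) b'))"
    using orbit_basis[OF vc regular_orbit[OF vc]] orb unfolding eqs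
    by (elim exE conjE) (intro exI conjI, assumption, erule subset_trans, assumption+)
qed

end

section \<open>Divided powers and weights\<close>

text \<open>The coefficient of \<open>t ^ n\<close> in \<open>act M (\<gamma> t) v\<close>, with the
  whole coefficient sequence chosen at once. For \<open>upper\<close> and \<open>lower\<close> these
  are the divided powers of the root vectors, which make sense although n! may vanish in the
  field.\<close>

definition div_pow :: "('k::field, 'v::ab_group_add) gmod \<Rightarrow> ('k \<Rightarrow> 'k ^ 2 ^ 2) \<Rightarrow> nat \<Rightarrow> 'v \<Rightarrow> 'v" where
  "div_pow M \<gamma> n v = (SOME w. (\<forall>n. w n \<in> car M) \<and> (\<exists>N. (\<forall>n>N. w n = 0) \<and>
     (\<forall>t. act M (\<gamma> t) v = (\<Sum>n\<le>N. scl M (t ^ n) (w n))))) n"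

text \<open>The projection to the weight space, read off from the Laurent expansion along the torus;
  that it lands there is \<open>wt_part_weight_space\<close>.\<close>

definition wt_part :: "('k::field, 'v::ab_group_add) gmod \<Rightarrow> int \<Rightarrow> 'v \<Rightarrow> 'v" where
  "wt_part M n v = (SOME w. (\<forall>n. w n \<in> car M) \<and> (\<exists>A. finite A \<and> (\<forall>n. n \<notin> A \<longrightarrow> w n = 0) \<and>
     (\<forall>t. t \<noteq> 0 \<longrightarrow> act M (torus t) v = (\<Sum>n\<in>A. scl M (t powi n) (w n))))) n"

lemma weight_space_car: "v \<in> weight_space M n \<Longrightarrow> v \<in> car M"
  and weight_spaceD: "v \<in> weight_space M n \<Longrightarrow> t \<noteq> 0 \<Longrightarrow> act M (torus t) v = scl M (t powi n) v"
  by (auto simp: weight_space_def)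

context rmodule
begin

lemmas inf = infinite_UNIV_alg_closed[where 'k = 'k]

lemma div_pow_ex:
  assumes "v \<in> car M" "polynomial_curve \<gamma>"
  shows "(\<forall>n. div_pow M \<gamma> n v \<in> car M) \<and> (\<exists>N. (\<forall>n>N. div_pow M \<gamma> n v = 0) \<and>
     (\<forall>t. act M (\<gamma> t) v = (\<Sum>n\<le>N. scl M (t ^ n) (div_pow M \<gamma> n v))))"
proof -
  have "\<exists>w. (\<forall>n. w n \<in> car M) \<and> (\<exists>N. (\<forall>n>N. w n = 0) \<and>
     (\<forall>t. act M (\<gamma> t) v = (\<Sum>n\<le>N. scl M (t ^ n) (w n))))"
    using regular_curve[OF regular_orbit[OF assms(1)] assms(2)]
    by (elim exE conjE) (intro exI conjI, assumption+)
  from someI_ex[OF this] show ?thesis unfolding div_pow_def .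
qed

lemma div_pow_car [simp, intro]: "v \<in> car M \<Longrightarrow> polynomial_curve \<gamma> \<Longrightarrow> div_pow M \<gamma> n v \<in> car M"
  using div_pow_ex by blast

lemma div_pow_bound:
  assumes "v \<in> car M" "polynomial_curve \<gamma>"
  obtains N where "\<And>n. n > N \<Longrightarrow> div_pow M \<gamma> n v = 0"
    "\<And>K t. K \<ge> N \<Longrightarrow> act M (\<gamma> t) v = (\<Sum>n\<le>K. scl M (t ^ n) (div_pow M \<gamma> n v))"
proof -
  obtain N where N: "\<And>n. n > N \<Longrightarrow> div_pow M \<gamma> n v = 0"
    "\<And>t. act M (\<gamma> t) v = (\<Sum>n\<le>N. scl M (t ^ n) (div_pow M \<gamma> n v))"
    using div_pow_ex[OF assms] by blast
  have "act M (\<gamma> t) v = (\<Sum>n\<le>K. scl M (t ^ n) (div_pow M \<gamma> n v))" if "K \<ge> N" for K t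
    unfolding N(2) by (rule sum.mono_neutral_left) (use that N in auto)
  then show ?thesis using that N by blast
qed

lemma div_pow_expand:
  assumes "v \<in> car M" "polynomial_curve \<gamma>"
  obtains N where "\<And>n. n > N \<Longrightarrow> div_pow M \<gamma> n v = 0"
    "\<And>t. act M (\<gamma> t) v = (\<Sum>n\<le>N. scl M (t ^ n) (div_pow M \<gamma> n v))"
  by (rule div_pow_bound[OF assms]) (rule that, auto)

lemma div_pow_eqI:
  assumes "v \<in> car M" "polynomial_curve \<gamma>" "\<And>n. n > N \<Longrightarrow> w n = 0"
    and "\<And>t. t \<noteq> 0 \<Longrightarrow> act M (\<gamma> t) v = (\<Sum>n\<le>N. scl M (t ^ n) (w n))"
  shows "div_pow M \<gamma> n v = w n"
proof -
  obtain K where K: "\<And>n. n > K \<Longrightarrow> div_pow M \<gamma> n v = 0"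
    "\<And>t. act M (\<gamma> t) v = (\<Sum>n\<le>K. scl M (t ^ n) (div_pow M \<gamma> n v))"
    by (rule div_pow_expand[OF assms(1,2)]) (rule that; simp)
  have "(\<lambda>n. div_pow M \<gamma> n v) = w"
    by (rule nat_coeffs_unique[OF inf, of K _ N]) (use K assms in auto)
  then show ?thesis by metis
qed

lemma div_pow_add:
  assumes "v \<in> car M" "w \<in> car M" and \<gamma>: "polynomial_curve \<gamma>"
  shows "div_pow M \<gamma> n (v + w) = div_pow M \<gamma> n v + div_pow M \<gamma> n w"
proof -
  obtain N where N: "\<And>n. n > N \<Longrightarrow> div_pow M \<gamma> n v = 0"
    "\<And>K t. K \<ge> N \<Longrightarrow> act M (\<gamma> t) v = (\<Sum>n\<le>K. scl M (t ^ n) (div_pow M \<gamma> n v))"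
    by (rule div_pow_bound[OF assms(1) \<gamma>]) (rule that; blast)
  obtain N' where N': "\<And>n. n > N' \<Longrightarrow> div_pow M \<gamma> n w = 0"
    "\<And>K t. K \<ge> N' \<Longrightarrow> act M (\<gamma> t) w = (\<Sum>n\<le>K. scl M (t ^ n) (div_pow M \<gamma> n w))"
    by (rule div_pow_bound[OF assms(2) \<gamma>]) (rule that; blast)
  have [simp]: "\<gamma> t \<in> SL2" for t using \<gamma> by (simp add: polynomial_curve_def)
  show ?thesis
    by (rule div_pow_eqI[where N = "max N N'"])
      (use assms N(1) N'(1) N(2)[OF max.cobounded1] N'(2)[OF max.cobounded2]
        in \<open>auto simp: act_add scale_right_distrib sum.distrib\<close>)
qed

lemma div_pow_scale:
  assumes "v \<in> car M" and \<gamma>: "polynomial_curve \<gamma>"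
  shows "div_pow M \<gamma> n (scl M a v) = scl M a (div_pow M \<gamma> n v)"
proof -
  obtain N where N: "\<And>n. n > N \<Longrightarrow> div_pow M \<gamma> n v = 0"
    "\<And>K t. K \<ge> N \<Longrightarrow> act M (\<gamma> t) v = (\<Sum>n\<le>K. scl M (t ^ n) (div_pow M \<gamma> n v))"
    by (rule div_pow_bound[OF assms(1) \<gamma>]) (rule that; blast)
  have [simp]: "\<gamma> t \<in> SL2" for t using \<gamma> by (simp add: polynomial_curve_def)
  show ?thesis
    by (rule div_pow_eqI[where N = N])
      (use assms N(1) N(2)[OF order_refl] in \<open>auto simp: act_scale scale_sum_right mult.commute\<close>)
qed

lemma div_pow_zero: "polynomial_curve \<gamma> \<Longrightarrow> div_pow M \<gamma> n 0 = 0"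
  using div_pow_scale[of 0 \<gamma> n 0] by simp

lemma div_pow_sum: "polynomial_curve \<gamma> \<Longrightarrow> (\<And>i. i \<in> A \<Longrightarrow> f i \<in> car M) \<Longrightarrow>
    div_pow M \<gamma> n (\<Sum>i\<in>A. f i) = (\<Sum>i\<in>A. div_pow M \<gamma> n (f i))"
  by (induction A rule: infinite_finite_induct) (simp_all add: div_pow_zero div_pow_add car_sum)

lemma div_pow_0:
  assumes "v \<in> car M" and \<gamma>: "polynomial_curve \<gamma>" "\<gamma> 0 = mat 1"
  shows "div_pow M \<gamma> 0 v = v"
proof -
  obtain N where N: "\<And>t. act M (\<gamma> t) v = (\<Sum>n\<le>N. scl M (t ^ n) (div_pow M \<gamma> n v))"
    by (rule div_pow_expand[OF assms(1,2)]) (rule that)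
  have "v = (\<Sum>n\<le>N. scl M (0 ^ n) (div_pow M \<gamma> n v))"
    using N[of 0] assms by (simp add: act_one)
  also have "\<dots> = (\<Sum>n\<le>N. if n = 0 then div_pow M \<gamma> 0 v else 0)"
    by (rule sum.cong) auto
  finally show ?thesis by simp
qed

text \<open>Expand the action of \<open>\<gamma> (t + \<tau>)\<close> by the binomial theorem and
  compare the coefficients in both parameters.\<close>

lemma div_pow_div_pow:
  assumes v: "v \<in> car M" and \<gamma>: "polynomial_curve \<gamma>" "\<And>s t. \<gamma> (s + t) = \<gamma> s ** \<gamma> t"
  shows "div_pow M \<gamma> s (div_pow M \<gamma> r v) = scl M (of_nat ((s + r) choose r)) (div_pow M \<gamma> (s + r) v)"
proof -
  let ?e = "\<lambda>n. div_pow M \<gamma> n v"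
  obtain N where N: "\<And>n. n > N \<Longrightarrow> ?e n = 0" "\<And>t. act M (\<gamma> t) v = (\<Sum>n\<le>N. scl M (t ^ n) (?e n))"
    by (rule div_pow_expand[OF v \<gamma>(1)]) (rule that; simp)
  have S [simp]: "\<gamma> t \<in> SL2" for t using \<gamma> by (simp add: polynomial_curve_def)
  have e [simp]: "?e n \<in> car M" for n using v \<gamma>(1) by simp
  \<comment> \<open>First compare powers of \<open>\<tau>\<close> with \<open>t\<close> fixed; the
    powers of \<open>t\<close> are compared afterwards by \<open>div_pow_eqI\<close>.\<close>
  have *: "(\<lambda>r. act M (\<gamma> t) (?e r)) = (\<lambda>r. \<Sum>n\<le>N. scl M (of_nat (n choose r) * t ^ (n - r)) (?e n))" for t
  proof (rule nat_coeffs_unique[OF inf, of N _ N])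
    show "act M (\<gamma> t) (?e r) = 0" if "r > N" for r using N(1)[OF that] by (simp add: act_zero)
    show "(\<Sum>n\<le>N. scl M (of_nat (n choose r) * t ^ (n - r)) (?e n)) = 0" if "r > N" for r
      by (rule sum.neutral) (use that in \<open>auto simp: binomial_eq_0\<close>)
    fix \<tau> :: 'k
    have "(\<Sum>r\<le>N. scl M (\<tau> ^ r) (act M (\<gamma> t) (?e r))) = act M (\<gamma> t) (act M (\<gamma> \<tau>) v)"
      unfolding N(2)[of \<tau>] by (subst act_sum) (auto simp: act_scale)
    also have "\<dots> = act M (\<gamma> (t + \<tau>)) v" using v by (simp add: \<gamma>(2) act_mult)
    also have "\<dots> = (\<Sum>n\<le>N. \<Sum>r\<le>N. scl M (\<tau> ^ r * (of_nat (n choose r) * t ^ (n - r))) (?e n))"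
      unfolding N(2)
    proof (rule sum.cong)
      fix n assume n: "n \<in> {..N}"
      have "(\<tau> + t) ^ n = (\<Sum>r\<le>n. of_nat (n choose r) * \<tau> ^ r * t ^ (n - r))"
        by (rule binomial_ring)
      also have "\<dots> = (\<Sum>r\<le>N. of_nat (n choose r) * \<tau> ^ r * t ^ (n - r))"
        by (rule sum.mono_neutral_left) (use n in \<open>auto simp: binomial_eq_0\<close>)
      finally show "scl M ((t + \<tau>) ^ n) (?e n) =
          (\<Sum>r\<le>N. scl M (\<tau> ^ r * (of_nat (n choose r) * t ^ (n - r))) (?e n))"
        by (simp add: scale_sum_left[symmetric] add.commute mult_ac)
    qed simp
    also have "\<dots> = (\<Sum>r\<le>N. scl M (\<tau> ^ r) (\<Sum>n\<le>N. scl M (of_nat (n choose r) * t ^ (n - r)) (?e n)))"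
      by (subst sum.swap) (simp add: scale_sum_right)
    finally show "(\<Sum>r\<le>N. scl M (\<tau> ^ r) (act M (\<gamma> t) (?e r))) =
        (\<Sum>r\<le>N. scl M (\<tau> ^ r) (\<Sum>n\<le>N. scl M (of_nat (n choose r) * t ^ (n - r)) (?e n)))" .
  qed
  show ?thesis
  proof (rule div_pow_eqI[where N = N])
    show "scl M (of_nat ((n + r) choose r)) (?e (n + r)) = 0" if "n > N" for n
      using N(1) that by simp
    fix t :: 'k
    have "act M (\<gamma> t) (?e r) = (\<Sum>n\<le>N. scl M (of_nat (n choose r) * t ^ (n - r)) (?e n))"
      using fun_cong[OF *] .
    also have "\<dots> = (\<Sum>n\<in>{r..r+N}. scl M (of_nat (n choose r) * t ^ (n - r)) (?e n))"
      by (rule sum.mono_neutral_cong) (use N(1) in \<open>auto simp: binomial_eq_0\<close>)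
    also have "\<dots> = (\<Sum>n\<le>N. scl M (t ^ n) (scl M (of_nat ((n + r) choose r)) (?e (n + r))))"
      by (rule sum.reindex_bij_witness[of _ "\<lambda>n. n + r" "\<lambda>n. n - r"]) (auto simp: mult.commute)
    finally show "act M (\<gamma> t) (?e r) =
        (\<Sum>n\<le>N. scl M (t ^ n) (scl M (of_nat ((n + r) choose r)) (?e (n + r))))" .
  qed (use \<gamma>(1) in auto)
qed

section \<open>Weight spaces and weight projections\<close>

lemma weight_subspace: "subspace (weight_space M n)"
  unfolding weight_space_def
  by (rule subspaceI) (auto simp: act_zero act_add act_scale scale_right_distrib mult.commute)

text \<open>Compare the coefficients of powers of \<open>x\<close> in the commutation rule
  \<open>tor\<close>: every factor \<open>x\<close> carries a factor
  \<open>t powi m\<close>.\<close>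

lemma div_pow_weight:
  assumes v: "v \<in> weight_space M n" and \<gamma>: "polynomial_curve \<gamma>"
    and tor: "\<And>t x. t \<noteq> 0 \<Longrightarrow> torus t ** \<gamma> x = \<gamma> (t powi m * x) ** torus t"
  shows "div_pow M \<gamma> k v \<in> weight_space M (n + m * int k)"
proof -
  have vc: "v \<in> car M" using v weight_space_car by blast
  let ?e = "\<lambda>n. div_pow M \<gamma> n v"
  obtain N where N: "\<And>n. n > N \<Longrightarrow> ?e n = 0" "\<And>t. act M (\<gamma> t) v = (\<Sum>n\<le>N. scl M (t ^ n) (?e n))"
    by (rule div_pow_expand[OF vc \<gamma>(1)]) (rule that; simp)
  have S [simp]: "\<gamma> t \<in> SL2" for t using \<gamma> by (simp add: polynomial_curve_def)
  have e [simp]: "?e n \<in> car M" for n using vc \<gamma>(1) by simp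
  have "act M (torus t) (?e k) = scl M (t powi (n + m * int k)) (?e k)" if t: "t \<noteq> 0" for t
  proof -
    have "(\<lambda>k. act M (torus t) (?e k)) = (\<lambda>k. scl M (t powi n * (t powi m) ^ k) (?e k))"
    proof (rule nat_coeffs_unique[OF inf, of N _ N])
      fix x :: 'k
      have "(\<Sum>r\<le>N. scl M (x ^ r) (act M (torus t) (?e r))) = act M (torus t) (act M (\<gamma> x) v)"
        unfolding N(2)[of x] using t by (subst act_sum) (auto simp: act_scale)
      also have "\<dots> = act M (torus t ** \<gamma> x) v" using vc t by (simp add: act_mult)
      also have "\<dots> = act M (\<gamma> (t powi m * x)) (act M (torus t) v)"
        using vc t by (simp add: act_mult tor)
      also have "\<dots> = scl M (t powi n) (act M (\<gamma> (t powi m * x)) v)"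
        using vc v t by (simp add: weight_spaceD act_scale)
      finally show "(\<Sum>r\<le>N. scl M (x ^ r) (act M (torus t) (?e r))) =
          (\<Sum>r\<le>N. scl M (x ^ r) (scl M (t powi n * (t powi m) ^ r) (?e r)))"
        unfolding N(2) by (simp add: scale_sum_right power_mult_distrib mult_ac)
    qed (use N(1) t in \<open>auto simp: act_zero\<close>)
    from fun_cong[OF this, of k] show ?thesis
      using t by (simp add: power_int_add power_int_mult)
  qed
  then show ?thesis by (simp add: weight_space_def)
qed

lemma upper_weight: "v \<in> weight_space M n \<Longrightarrow> div_pow M upper k v \<in> weight_space M (n + 2 * int k)"
  by (rule div_pow_weight)
    (auto simp: polynomial_curve_upper torus_mat2 upper_def mat2_mult mat2_eq_iff power2_eq_square)

lemma lower_weight: "v \<in> weight_space M n \<Longrightarrow> div_pow M lower k v \<in> weight_space M (n - 2 * int k)"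
  using div_pow_weight[of v n lower "-2" k]
  by (auto simp: polynomial_curve_lower torus_mat2 lower_def mat2_mult mat2_eq_iff
      power_int_minus power2_eq_square)

lemma upper_add: "upper (s + t) = upper s ** (upper t :: 'k ^ 2 ^ 2)"
  by (simp add: upper_def mat2_mult add.commute)

lemmas upper_upper = div_pow_div_pow[OF _ polynomial_curve_upper upper_add]

lemma upper_0 [simp]: "v \<in> car M \<Longrightarrow> div_pow M upper 0 v = v"
  by (rule div_pow_0) (auto simp: polynomial_curve_upper upper_def mat2_one)

lemma lower_0 [simp]: "v \<in> car M \<Longrightarrow> div_pow M lower 0 v = v"
  by (rule div_pow_0) (auto simp: polynomial_curve_lower lower_def mat2_one)

lemma wt_part_ex:
  assumes "v \<in> car M"
  shows "(\<forall>n. wt_part M n v \<in> car M) \<and> (\<exists>A. finite A \<and> (\<forall>n. n \<notin> A \<longrightarrow> wt_part M n v = 0) \<and>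
     (\<forall>t. t \<noteq> 0 \<longrightarrow> act M (torus t) v = (\<Sum>n\<in>A. scl M (t powi n) (wt_part M n v))))"
proof -
  have "\<exists>w. (\<forall>n. w n \<in> car M) \<and> (\<exists>A. finite A \<and> (\<forall>n. n \<notin> A \<longrightarrow> w n = 0) \<and>
     (\<forall>t. t \<noteq> 0 \<longrightarrow> act M (torus t) v = (\<Sum>n\<in>A. scl M (t powi n) (w n))))"
    using regular_torus[OF regular_orbit[OF assms]]
    by (elim exE conjE) (intro exI conjI, assumption+)
  from someI_ex[OF this] show ?thesis unfolding wt_part_def .
qed

lemma wt_part_car [simp, intro]: "v \<in> car M \<Longrightarrow> wt_part M n v \<in> car M"
  using wt_part_ex by simp

lemma wt_part_expand:
  assumes "v \<in> car M"
  obtains A where "finite A" "\<And>n. n \<notin> A \<Longrightarrow> wt_part M n v = 0"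
    "\<And>t. t \<noteq> 0 \<Longrightarrow> act M (torus t) v = (\<Sum>n\<in>A. scl M (t powi n) (wt_part M n v))"
  using conjunct2[OF wt_part_ex[OF assms]] by (elim exE conjE) (rule that, auto)

lemma wt_part_eqI:
  assumes v: "v \<in> car M" and A: "finite A" "\<And>n. n \<notin> A \<Longrightarrow> w n = 0"
    and w: "\<And>t. t \<noteq> 0 \<Longrightarrow> act M (torus t) v = (\<Sum>n\<in>A. scl M (t powi n) (w n))"
  shows "wt_part M n v = w n"
proof -
  obtain B where B: "finite B" "\<And>n. n \<notin> B \<Longrightarrow> wt_part M n v = 0"
    "\<And>t. t \<noteq> 0 \<Longrightarrow> act M (torus t) v = (\<Sum>n\<in>B. scl M (t powi n) (wt_part M n v))"
    by (rule wt_part_expand[OF v]) (rule that; simp)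
  have "(\<lambda>n. wt_part M n v) = w"
    by (rule int_coeffs_unique[OF inf, of B A]) (use B A w in auto)
  then show ?thesis by metis
qed

text \<open>Expand the action of a product of two torus elements in two ways and compare
  coefficients in one parameter.\<close>

lemma wt_part_weight_space:
  assumes v: "v \<in> car M" shows "wt_part M n v \<in> weight_space M n"
proof -
  obtain A where A: "finite A" "\<And>n. n \<notin> A \<Longrightarrow> wt_part M n v = 0"
    "\<And>t. t \<noteq> 0 \<Longrightarrow> act M (torus t) v = (\<Sum>n\<in>A. scl M (t powi n) (wt_part M n v))"
    by (rule wt_part_expand[OF v]) (rule that; simp)
  have c [simp]: "wt_part M n v \<in> car M" for n using v by simp
  have "act M (torus s) (wt_part M n v) = scl M (s powi n) (wt_part M n v)" if s: "s \<noteq> 0" for s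
  proof -
    have "(\<lambda>n. act M (torus s) (wt_part M n v)) = (\<lambda>n. scl M (s powi n) (wt_part M n v))"
    proof (rule int_coeffs_unique[OF inf A(1) A(1)])
      fix t :: 'k assume t: "t \<noteq> 0"
      have "(\<Sum>n\<in>A. scl M (t powi n) (act M (torus s) (wt_part M n v))) = act M (torus s) (act M (torus t) v)"
        unfolding A(3)[OF t] using s by (subst act_sum) (auto simp: act_scale)
      also have "\<dots> = act M (torus (s * t)) v"
        using v s t by (simp add: act_mult[symmetric] torus_mat2 mat2_mult mult.commute)
      also have "\<dots> = (\<Sum>n\<in>A. scl M (t powi n) (scl M (s powi n) (wt_part M n v)))"
        using s t by (simp add: A(3) power_int_mult_distrib mult.commute)
      finally show "(\<Sum>n\<in>A. scl M (t powi n) (act M (torus s) (wt_part M n v))) =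
          (\<Sum>n\<in>A. scl M (t powi n) (scl M (s powi n) (wt_part M n v)))" .
    qed (use A s in \<open>auto simp: act_zero\<close>)
    then show ?thesis by metis
  qed
  then show ?thesis by (simp add: weight_space_def)
qed

lemma wt_part_decomp:
  assumes v: "v \<in> car M"
  obtains A where "finite A" "\<And>n. n \<notin> A \<Longrightarrow> wt_part M n v = 0" "v = (\<Sum>n\<in>A. wt_part M n v)"
proof -
  obtain A where A: "finite A" "\<And>n. n \<notin> A \<Longrightarrow> wt_part M n v = 0"
    "\<And>t. t \<noteq> 0 \<Longrightarrow> act M (torus t) v = (\<Sum>n\<in>A. scl M (t powi n) (wt_part M n v))"
    by (rule wt_part_expand[OF v]) (rule that; simp)
  have "torus (1::'k) = mat 1" by (simp add: torus_mat2 mat2_one)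
  then have "v = (\<Sum>n\<in>A. wt_part M n v)" using A(3)[of 1] v by (simp add: act_one)
  then show ?thesis using that A by simp
qed

lemma wt_part_of_weight:
  assumes v: "v \<in> weight_space M m" shows "wt_part M n v = (if n = m then v else 0)"
  by (rule wt_part_eqI[where A = "{m}"]) (use v in \<open>auto simp: weight_space_def\<close>)

lemma wt_part_add:
  assumes v: "v \<in> car M" and v': "v' \<in> car M"
  shows "wt_part M n (v + v') = wt_part M n v + wt_part M n v'"
proof -
  obtain A where A: "finite A" "\<And>n. n \<notin> A \<Longrightarrow> wt_part M n v = 0"
    "\<And>t. t \<noteq> 0 \<Longrightarrow> act M (torus t) v = (\<Sum>n\<in>A. scl M (t powi n) (wt_part M n v))"
    by (rule wt_part_expand[OF v]) (rule that; simp)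
  obtain B where B: "finite B" "\<And>n. n \<notin> B \<Longrightarrow> wt_part M n v' = 0"
    "\<And>t. t \<noteq> 0 \<Longrightarrow> act M (torus t) v' = (\<Sum>n\<in>B. scl M (t powi n) (wt_part M n v'))"
    by (rule wt_part_expand[OF v']) (rule that; simp)
  show ?thesis
  proof (rule wt_part_eqI[where A = "A \<union> B"])
    fix t :: 'k assume t: "t \<noteq> 0"
    have "(\<Sum>n\<in>A. scl M (t powi n) (wt_part M n v)) = (\<Sum>n\<in>A \<union> B. scl M (t powi n) (wt_part M n v))"
      by (rule sum.mono_neutral_left) (use A B in auto)
    moreover have "(\<Sum>n\<in>B. scl M (t powi n) (wt_part M n v')) = (\<Sum>n\<in>A \<union> B. scl M (t powi n) (wt_part M n v'))"
      by (rule sum.mono_neutral_left) (use A B in auto)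
    ultimately show "act M (torus t) (v + v') = (\<Sum>n\<in>A \<union> B. scl M (t powi n) (wt_part M n v + wt_part M n v'))"
      using v v' t by (simp add: act_add A(3) B(3) scale_right_distrib sum.distrib)
  qed (use v v' A B in auto)
qed

lemma wt_part_scale:
  assumes v: "v \<in> car M" shows "wt_part M n (scl M a v) = scl M a (wt_part M n v)"
proof -
  obtain A where A: "finite A" "\<And>n. n \<notin> A \<Longrightarrow> wt_part M n v = 0"
    "\<And>t. t \<noteq> 0 \<Longrightarrow> act M (torus t) v = (\<Sum>n\<in>A. scl M (t powi n) (wt_part M n v))"
    by (rule wt_part_expand[OF v]) (rule that; simp)
  show ?thesis
    by (rule wt_part_eqI[OF _ A(1)]) (use v A in \<open>auto simp: act_scale scale_sum_right mult.commute\<close>)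
qed

lemma wt_part_zero: "wt_part M n 0 = 0"
  using wt_part_scale[of 0 n 0] by simp

lemma wt_part_sum: "(\<And>i. i \<in> A \<Longrightarrow> f i \<in> car M) \<Longrightarrow>
    wt_part M n (\<Sum>i\<in>A. f i) = (\<Sum>i\<in>A. wt_part M n (f i))"
  by (induction A rule: infinite_finite_induct) (simp_all add: wt_part_zero wt_part_add car_sum)

section \<open>Expansion of the action on the big cell\<close>

lemma bicoeff_bound:
  assumes v: "v \<in> car M"
  obtains N where "\<And>r s. r > N \<or> s > N \<Longrightarrow> div_pow M lower r (div_pow M upper s v) = 0"
    "\<And>t. act M (upper t) v = (\<Sum>s\<le>N. scl M (t ^ s) (div_pow M upper s v))"
    "\<And>s t. act M (lower t) (div_pow M upper s v) =
       (\<Sum>r\<le>N. scl M (t ^ r) (div_pow M lower r (div_pow M upper s v)))"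
proof -
  note [simp] = polynomial_curve_upper polynomial_curve_lower
  obtain N where N: "\<And>n. n > N \<Longrightarrow> div_pow M upper n v = 0"
    "\<And>K t. K \<ge> N \<Longrightarrow> act M (upper t) v = (\<Sum>n\<le>K. scl M (t ^ n) (div_pow M upper n v))"
    by (rule div_pow_bound[OF v polynomial_curve_upper]) (rule that; blast)
  have "\<exists>R. \<forall>s. (\<forall>r>R s. div_pow M lower r (div_pow M upper s v) = 0) \<and>
      (\<forall>K\<ge>R s. \<forall>t. act M (lower t) (div_pow M upper s v) =
       (\<Sum>r\<le>K. scl M (t ^ r) (div_pow M lower r (div_pow M upper s v))))"
    (is "\<exists>R. \<forall>s. ?P s (R s)")
  proof (rule choice, rule allI)
    fix s
    have ec: "div_pow M upper s v \<in> car M" using v by simp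
    obtain R where
      "\<And>n. n > R \<Longrightarrow> div_pow M lower n (div_pow M upper s v) = 0"
      "\<And>K t. K \<ge> R \<Longrightarrow> act M (lower t) (div_pow M upper s v) =
        (\<Sum>n\<le>K. scl M (t ^ n) (div_pow M lower n (div_pow M upper s v)))"
      by (rule div_pow_bound[OF ec polynomial_curve_lower]) (rule that; blast)
    then show "\<exists>R. ?P s R" by (intro exI[of _ R]) simp
  qed
  then obtain R where "\<forall>s. ?P s (R s)" by (elim exE)
  then have R: "\<And>s r. r > R s \<Longrightarrow> div_pow M lower r (div_pow M upper s v) = 0"
    "\<And>s K t. K \<ge> R s \<Longrightarrow> act M (lower t) (div_pow M upper s v) =
       (\<Sum>r\<le>K. scl M (t ^ r) (div_pow M lower r (div_pow M upper s v)))" by simp_all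
  define K where "K = Max (insert N (R ` {..N}))"
  have KN: "N \<le> K" and KR: "\<And>s. s \<le> N \<Longrightarrow> R s \<le> K"
    unfolding K_def by (rule Max_ge; simp)+
  have z: "div_pow M lower r (div_pow M upper s v) = 0" if "r > K \<or> s > K" for r s
  proof (cases "s \<le> N")
    case True then show ?thesis using that KN KR[OF True] R(1)[of s r] by auto
  next
    case False then show ?thesis using N(1)[of s] by (simp add: div_pow_zero)
  qed
  moreover have "act M (lower t) (div_pow M upper s v) =
      (\<Sum>r\<le>K. scl M (t ^ r) (div_pow M lower r (div_pow M upper s v)))" for s t
  proof (cases "s \<le> N")
    case True then show ?thesis using KR R(2) by simp
  next
    case False then show ?thesis using N(1)[of s] by (simp add: div_pow_zero act_zero)
  qed
  ultimately show ?thesis by (intro that[of K]) (use N(2)[OF KN] in auto)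
qed

text \<open>After \<open>s\<close> upper divided powers the torus acts with exponent
  \<open>w + 2 * int s\<close>; dividing the off-diagonal entries by the upper left one costs
  \<open>s + r\<close>, which leaves \<open>w + int s - int r\<close>.\<close>

lemma big_cell_expansion:
  assumes v: "v \<in> weight_space M w"
  obtains N where "\<And>r s. r > N \<or> s > N \<Longrightarrow> div_pow M lower r (div_pow M upper s v) = 0"
    "\<And>g. g \<in> SL2 \<Longrightarrow> g $ 1 $ 1 \<noteq> 0 \<Longrightarrow> act M g v = (\<Sum>s\<le>N. \<Sum>r\<le>N.
       scl M (g $ 1 $ 1 powi (w + int s - int r) * (g $ 1 $ 2) ^ s * (g $ 2 $ 1) ^ r)
         (div_pow M lower r (div_pow M upper s v)))"
proof -
  note [simp] = polynomial_curve_upper polynomial_curve_lower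
  have vc: "v \<in> car M" using v weight_space_car by blast
  let ?e = "\<lambda>s. div_pow M upper s v"
  let ?f = "\<lambda>r s. div_pow M lower r (?e s)"
  obtain N where N: "\<And>r s. r > N \<or> s > N \<Longrightarrow> ?f r s = 0"
    "\<And>t. act M (upper t) v = (\<Sum>s\<le>N. scl M (t ^ s) (?e s))"
    "\<And>s t. act M (lower t) (?e s) = (\<Sum>r\<le>N. scl M (t ^ r) (?f r s))"
    by (rule bicoeff_bound[OF vc]) (rule that; simp)
  have e [simp]: "?e s \<in> car M" for s using vc by simp
  have "act M g v = (\<Sum>s\<le>N. \<Sum>r\<le>N.
       scl M (g $ 1 $ 1 powi (w + int s - int r) * (g $ 1 $ 2) ^ s * (g $ 2 $ 1) ^ r) (?f r s))"
    if g: "g \<in> SL2" "g $ 1 $ 1 \<noteq> 0" for g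
  proof -
    define a b c where "a = g $ 1 $ 1" and "b = g $ 1 $ 2" and "c = g $ 2 $ 1"
    have a: "a \<noteq> 0" using g by (simp add: a_def)
    have "act M g v = act M (lower (c / a)) (act M (torus a) (act M (upper (b / a)) v))"
      unfolding a_def b_def c_def
      by (subst (1) big_cell[OF g], subst act_mult, simp, simp add: g(2), rule vc, subst act_mult)
        (use g vc in auto)
    also have "act M (torus a) (act M (upper (b / a)) v) =
        (\<Sum>s\<le>N. scl M ((b / a) ^ s * a powi (w + 2 * int s)) (?e s))"
      unfolding N(2) using a by (subst act_sum) (auto simp: act_scale weight_spaceD[OF upper_weight[OF v] a])
    also have "act M (lower (c / a)) \<dots> = (\<Sum>s\<le>N. \<Sum>r\<le>N.
        scl M ((b / a) ^ s * a powi (w + 2 * int s) * (c / a) ^ r) (?f r s))"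
      by (subst act_sum) (auto simp: act_scale N(3) scale_sum_right)
    also have "\<dots> = (\<Sum>s\<le>N. \<Sum>r\<le>N. scl M (a powi (w + int s - int r) * b ^ s * c ^ r) (?f r s))"
    proof (intro sum.cong refl arg_cong2[where f = "scl M"])
      fix s r
      have "a powi (w + 2 * int s) = a powi (w + int s - int r) * a ^ s * a ^ r"
        using a power_int_add[of a "w + int s - int r + int s" "int r"]
          power_int_add[of a "w + int s - int r" "int s"] by (simp add: algebra_simps)
      then show "(b / a) ^ s * a powi (w + 2 * int s) * (c / a) ^ r = a powi (w + int s - int r) * b ^ s * c ^ r"
        using a by (simp add: power_divide field_simps)
    qed
    finally show ?thesis by (simp add: a_def b_def c_def)
  qed
  then show ?thesis by (intro that[of N]) (use N(1) in auto)
qed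

lemma swap_weight:
  assumes "v \<in> weight_space M n" shows "act M swap v \<in> weight_space M (- n)"
proof -
  have vc: "v \<in> car M" using assms weight_space_car by blast
  have "act M (torus t) (act M swap v) = scl M (t powi - n) (act M swap v)" if t: "t \<noteq> 0" for t
  proof -
    have "torus t ** swap = swap ** torus (inverse t)"
      using t by (simp add: torus_mat2 swap_def mat2_mult)
    then have "act M (torus t) (act M swap v) = act M swap (act M (torus (inverse t)) v)"
      using t vc by (simp flip: act_mult)
    also have "\<dots> = scl M (inverse t powi n) (act M swap v)"
      using assms t vc by (simp add: weight_spaceD act_scale)
    finally show ?thesis by (simp add: power_int_minus power_int_inverse)
  qed
  then show ?thesis using vc by (simp add: weight_space_def)
qed

text \<open>The change of chart on the projective line: on a vector of weight 0 fixed by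
  \<open>upper\<close>, the element \<open>lower x\<close> acts like \<open>upper (1 / x)\<close> on
  the swapped vector.\<close>

lemma lower_factor: "x \<noteq> 0 \<Longrightarrow> lower x = upper (1 / x) ** (torus (- 1 / x) ** (swap ** upper (1 / x :: 'k)))"
  by (simp add: lower_def upper_def torus_mat2 swap_def mat2_mult mat2_eq_iff)

text \<open>
  A weight vector of weight 0 fixed by the upper unipotent group gives a regular map from
  the projective line to the module, which must be constant: expand it in both charts.
\<close>

lemma invariant_of_upper_invariant:
  assumes v: "v \<in> weight_space M 0" and e: "\<And>s. s > 0 \<Longrightarrow> div_pow M upper s v = 0" and g: "g \<in> SL2"
  shows "act M g v = v"
proof -
  note [simp] = polynomial_curve_upper polynomial_curve_lower
  have vc [simp]: "v \<in> car M" using v weight_space_car by blast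
  have up: "act M (upper t) v = v" for t
  proof -
    obtain N where "act M (upper t) v = (\<Sum>s\<le>N. scl M (t ^ s) (div_pow M upper s v))"
      by (rule div_pow_expand[OF vc polynomial_curve_upper]) (rule that; simp)
    also have "\<dots> = (\<Sum>s\<le>N. if s = 0 then v else 0)" by (rule sum.cong) (auto simp: e)
    finally show ?thesis by simp
  qed
  have tor: "act M (torus t) v = v" if "t \<noteq> 0" for t using weight_spaceD[OF v that] by simp
  define v' where "v' = act M swap v"
  have v': "v' \<in> weight_space M 0" using swap_weight[OF v] by (simp add: v'_def)
  have v'c [simp]: "v' \<in> car M" by (simp add: v'_def)
  have tor': "act M (torus t) v' = v'" if "t \<noteq> 0" for t using weight_spaceD[OF v' that] by simp
  have lo: "act M (lower x) v = act M (upper (1 / x)) v'" if x: "x \<noteq> 0" for x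
  proof -
    have "act M (lower x) v = act M (upper (1 / x)) (act M (torus (- 1 / x)) (act M swap (act M (upper (1 / x)) v)))"
      unfolding lower_factor[OF x] using x by (simp add: act_mult)
    then show ?thesis using x by (simp add: up tor' flip: v'_def)
  qed
  obtain N where N: "\<And>n. n > N \<Longrightarrow> div_pow M lower n v = 0"
    "\<And>t. act M (lower t) v = (\<Sum>n\<le>N. scl M (t ^ n) (div_pow M lower n v))"
    by (rule div_pow_expand[OF vc polynomial_curve_lower]) (rule that; simp)
  obtain K where K: "\<And>n. n > K \<Longrightarrow> div_pow M upper n v' = 0"
    "\<And>t. act M (upper t) v' = (\<Sum>n\<le>K. scl M (t ^ n) (div_pow M upper n v'))"
    by (rule div_pow_expand[OF v'c polynomial_curve_upper]) (rule that; simp)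
  \<comment> \<open>As Laurent polynomials in one parameter, one chart has only nonnegative
    exponents and the other only nonpositive ones. Hence only the exponent 0 survives.\<close>
  have *: "(\<lambda>n. if 0 \<le> n then div_pow M lower (nat n) v else 0) =
      (\<lambda>n. if n \<le> 0 then div_pow M upper (nat (- n)) v' else 0)" (is "?l = ?u")
  proof (rule int_coeffs_unique[OF inf, of "{0..int N}" "{- int K..0}"])
    fix t :: 'k assume t: "t \<noteq> 0"
    have "(\<Sum>n\<in>{0..int N}. scl M (t powi n) (?l n)) = (\<Sum>n\<le>N. scl M (t ^ n) (div_pow M lower n v))"
      by (rule sum.reindex_bij_witness[of _ int nat]) (auto simp flip: power_int_of_nat)
    moreover have "(\<Sum>n\<in>{- int K..0}. scl M (t powi n) (?u n)) =
        (\<Sum>n\<le>K. scl M ((1 / t) ^ n) (div_pow M upper n v'))"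
      by (rule sum.reindex_bij_witness[of _ "\<lambda>n. - int n" "\<lambda>n. nat (- n)"])
        (auto simp: power_int_minus power_divide power_int_def field_simps)
    ultimately show "(\<Sum>n\<in>{0..int N}. scl M (t powi n) (?l n)) = (\<Sum>n\<in>{- int K..0}. scl M (t powi n) (?u n))"
      using lo[OF t] by (simp add: N(2) K(2))
  qed (use N K in auto)
  have "div_pow M lower n v = 0" if "n > 0" for n
    using fun_cong[OF *, of "int n"] that by simp
  then have low: "act M (lower t) v = v" for t
  proof -
    have "act M (lower t) v = (\<Sum>s\<le>N. if s = 0 then v else 0)"
      unfolding N(2) by (rule sum.cong) (auto simp: \<open>\<And>n. n > 0 \<Longrightarrow> div_pow M lower n v = 0\<close>)
    then show ?thesis by simp
  qed
  have main: "act M g v = v" if g: "g \<in> SL2" "g $ 1 $ 1 \<noteq> 0" for g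
    by (subst big_cell[OF g], subst act_mult, simp, simp add: g(2), rule vc, subst act_mult)
      (use g in \<open>auto simp: up tor low\<close>)
  show ?thesis
  proof (cases "g $ 1 $ 1 = 0")
    case True
    then have "g $ 2 $ 1 \<noteq> 0" using g by (auto simp: SL2_iff)
    \<comment> \<open>Adding the second row to the first moves \<open>g\<close> into the big cell,
      and \<open>upper 1\<close> fixes \<open>v\<close>.\<close>
    then have "act M (upper 1 ** g) v = v" using g True
      by (intro main) (auto simp: mult_nth2 upper_def)
    then have "act M (upper 1) (act M g v) = act M (upper 1) v" using g by (simp add: act_mult up)
    then show ?thesis using act_inj[of "upper 1" "act M g v" v] g by simp
  qed (use main g in simp)
qed

end

section \<open>The cochain complex\<close>

lemma even_choose_double_odd: "even ((2 * n) choose (2 * k + 1))"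
proof (induction n arbitrary: k)
  case (Suc n)
  show ?case
  proof (cases k)
    case 0 then show ?thesis by simp
  next
    case (Suc j)
    have "((2 * n + 2) choose (2 * k + 1)) =
        ((2 * n) choose (2 * k + 1)) + 2 * ((2 * n) choose (2 * k)) + ((2 * n) choose (2 * j + 1))"
      using Suc by (simp add: numeral_2_eq_2)
    then show ?thesis using Suc.IH by simp
  qed
qed simp

lemma odd_choose_double: "odd ((2 * n) choose (2 * k)) \<longleftrightarrow> odd (n choose k)"
proof (induction n arbitrary: k)
  case (Suc n)
  show ?case
  proof (cases k)
    case 0 then show ?thesis by simp
  next
    case (Suc j)
    have "((2 * n + 2) choose (2 * k)) =
        ((2 * n) choose (2 * k)) + 2 * ((2 * n) choose (2 * j + 1)) + ((2 * n) choose (2 * j))"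
      using Suc by (simp add: numeral_2_eq_2)
    then show ?thesis using Suc.IH[of k] Suc.IH[of j] Suc even_choose_double_odd[of n j] by simp
  qed
next
  case 0 then show ?case by (cases k) auto
qed

lemma odd_choose_double_Suc: "odd ((2 * n + 1) choose (2 * k)) \<longleftrightarrow> odd (n choose k)"
proof (cases k)
  case 0 then show ?thesis by simp
next
  case (Suc j)
  have "((2 * n + 1) choose (2 * k)) = ((2 * n) choose (2 * k)) + ((2 * n) choose (2 * j + 1))"
    using Suc by simp
  then show ?thesis using even_choose_double_odd[of n j] odd_choose_double[of n k] by simp
qed

text \<open>Lucas' congruence for the prime 2 and a single binary digit, by peeling off the lowest
  digit of \<open>n\<close>.\<close>

lemma odd_choose_power2: "odd (n choose 2 ^ i) \<longleftrightarrow> bit n i"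
proof (induction i arbitrary: n)
  case 0 then show ?case by (simp add: bit_0)
next
  case (Suc i)
  show ?case
  proof (cases "even n")
    case True
    then show ?thesis using odd_choose_double[of "n div 2" "2 ^ i"] Suc[of "n div 2"]
      by (simp add: bit_Suc)
  next
    case False
    then show ?thesis using odd_choose_double_Suc[of "n div 2" "2 ^ i"] Suc[of "n div 2"]
      by (simp add: bit_Suc)
  qed
qed

lemma bit_add_power2_same: "bit (n + 2 ^ i :: nat) i \<longleftrightarrow> \<not> bit n i"
  by (simp add: bit_iff_odd)

lemma of_nat_char2:
  assumes "CHAR('k::semiring_1) = 2" shows "(of_nat n :: 'k) = of_bool (odd n)"
proof -
  have "(of_nat 2 :: 'k) = 0" using of_nat_CHAR[where 'a = 'k] assms by simp
  then have "(2 :: 'k) = 0" by simp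
  then show ?thesis by (cases "even n") (auto elim!: evenE oddE)
qed

section \<open>Equivariant maps\<close>

lemma Hom_GD:
  assumes "f \<in> Hom_G M N"
  shows "x \<in> car M \<Longrightarrow> f x \<in> car N" "x \<notin> car M \<Longrightarrow> f x = 0"
    "x \<in> car M \<Longrightarrow> y \<in> car M \<Longrightarrow> f (x + y) = f x + f y"
    "x \<in> car M \<Longrightarrow> f (scl M a x) = scl N a (f x)"
    "g \<in> SL2 \<Longrightarrow> x \<in> car M \<Longrightarrow> f (act M g x) = act N g (f x)"
  using assms by (auto simp: Hom_G_def)

locale ghom = A: rmodule A + B: rmodule B
  for A :: "('k::alg_closed_field, 'v::ab_group_add) gmod"
    and B :: "('k, 'w::ab_group_add) gmod" +
  fixes f assumes hom: "f \<in> Hom_G A B"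
begin

lemmas f_car [simp, intro] = Hom_GD(1)[OF hom] and f_outside = Hom_GD(2)[OF hom]
  and f_add = Hom_GD(3)[OF hom] and f_scale = Hom_GD(4)[OF hom] and f_act = Hom_GD(5)[OF hom]

lemma f_zero [simp]: "f 0 = 0"
  using f_add[of 0 0] by simp

lemma f_sum: "(\<And>i. i \<in> I \<Longrightarrow> h i \<in> car A) \<Longrightarrow> f (sum h I) = (\<Sum>i\<in>I. f (h i))"
  by (induction I rule: infinite_finite_induct) (simp_all add: f_add A.car_sum)

lemma f_diff: "x \<in> car A \<Longrightarrow> y \<in> car A \<Longrightarrow> f (x - y) = f x - f y"
  using f_add[of "x - y" y] by (simp add: A.car_diff)

lemma f_div_pow:
  assumes v: "v \<in> car A" and \<gamma>: "polynomial_curve \<gamma>"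
  shows "f (div_pow A \<gamma> n v) = div_pow B \<gamma> n (f v)"
proof -
  obtain N where N: "\<And>n. n > N \<Longrightarrow> div_pow A \<gamma> n v = 0"
    "\<And>t. act A (\<gamma> t) v = (\<Sum>n\<le>N. scl A (t ^ n) (div_pow A \<gamma> n v))"
    by (rule A.div_pow_expand[OF v \<gamma>]) (rule that; simp)
  have S: "\<gamma> t \<in> SL2" for t using \<gamma> by (simp add: polynomial_curve_def)
  have "div_pow B \<gamma> n (f v) = f (div_pow A \<gamma> n v)"
  proof (rule B.div_pow_eqI[where N = N])
    fix t :: 'k
    have "act B (\<gamma> t) (f v) = f (act A (\<gamma> t) v)" using v S by (simp add: f_act)
    also have "\<dots> = (\<Sum>n\<le>N. scl B (t ^ n) (f (div_pow A \<gamma> n v)))"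
      unfolding N(2) using v \<gamma> by (subst f_sum) (auto simp: f_scale)
    finally show "act B (\<gamma> t) (f v) = (\<Sum>n\<le>N. scl B (t ^ n) (f (div_pow A \<gamma> n v)))" .
  qed (use v \<gamma> N(1) in auto)
  then show ?thesis by simp
qed

lemma f_wt_part:
  assumes v: "v \<in> car A"
  shows "f (wt_part A n v) = wt_part B n (f v)"
proof -
  obtain S where S: "finite S" "\<And>n. n \<notin> S \<Longrightarrow> wt_part A n v = 0"
    "\<And>t. t \<noteq> 0 \<Longrightarrow> act A (torus t) v = (\<Sum>n\<in>S. scl A (t powi n) (wt_part A n v))"
    by (rule A.wt_part_expand[OF v]) (rule that; simp)
  have "wt_part B n (f v) = f (wt_part A n v)"
  proof (rule B.wt_part_eqI[where A = S])
    fix t :: 'k assume t: "t \<noteq> 0"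
    have "act B (torus t) (f v) = f (act A (torus t) v)" using v t by (simp add: f_act)
    also have "\<dots> = (\<Sum>n\<in>S. scl B (t powi n) (f (wt_part A n v)))"
      unfolding S(3)[OF t] using v by (subst f_sum) (auto simp: f_scale)
    finally show "act B (torus t) (f v) = (\<Sum>n\<in>S. scl B (t powi n) (f (wt_part A n v)))" .
  qed (use v S in auto)
  then show ?thesis by simp
qed

lemma f_weight: "v \<in> weight_space A n \<Longrightarrow> f v \<in> weight_space B n"
  unfolding weight_space_def by (auto simp: f_scale simp flip: f_act)

end

text \<open>
  Cochains of degree \<open>q\<close>: the multiset with elements \<open>i\<^sub>1, \<dots>, i\<^sub>q\<close> stands for the monomial
  \<open>\<lambda>\<^bsub>i\<^sub>1\<^esub> \<cdots> \<lambda>\<^bsub>i\<^sub>q\<^esub>\<close> in the cohomology ring of the additive group, where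
  \<open>\<lambda>\<^sub>i\<close> has torus weight \<open>- 2\<^sup>i\<^sup>+\<^sup>1\<close>; the total weight of a cochain is 0.
\<close>

definition mweight :: "nat multiset \<Rightarrow> int" where
  "mweight \<mu> = (\<Sum>i\<in>#\<mu>. 2 ^ (i + 1))"

lemma mweight_simps [simp]: "mweight {#} = 0" "mweight (add_mset i \<mu>) = 2 ^ (i + 1) + mweight \<mu>"
  by (simp_all add: mweight_def)

lemma mweight_nonneg: "mweight \<mu> \<ge> 0"
  by (induction \<mu>) auto

lemma mweight_remove: "i \<in># \<nu> \<Longrightarrow> mweight (\<nu> - {#i#}) + 2 ^ (i + 1) = mweight \<nu>"
  by (metis mweight_simps(2) insert_DiffM add.commute)

definition cochains :: "('k::field, 'v::ab_group_add) gmod \<Rightarrow> nat \<Rightarrow> (nat multiset \<Rightarrow> 'v) set" where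
  "cochains M q = {c. finite {\<mu>. c \<mu> \<noteq> 0} \<and> (\<forall>\<mu>. c \<mu> \<in> weight_space M (mweight \<mu>)) \<and>
     (\<forall>\<mu>. size \<mu> \<noteq> q \<longrightarrow> c \<mu> = 0)}"

text \<open>\<open>i\<close> runs over the distinct elements, without multiplicity: the i-th
  generator times the monomial of \<open>\<nu> - {#i#}\<close> is the monomial of
  \<open>\<nu>\<close> with coefficient 1.\<close>

definition cobd :: "('k::field, 'v::ab_group_add) gmod \<Rightarrow> (nat multiset \<Rightarrow> 'v) \<Rightarrow> nat multiset \<Rightarrow> 'v" where
  "cobd M c \<nu> = (\<Sum>i\<in>set_mset \<nu>. div_pow M upper (2 ^ i) (c (\<nu> - {#i#})))"

locale rmodule2 = rmodule M for M :: "('k::alg_closed_field, 'v::ab_group_add) gmod" +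
  assumes char2: "CHAR('k) = 2"
begin

lemma double_zero: "v + v = (0 :: 'v)"
proof -
  have "scl M (1 + 1) v = 0"
    using of_nat_char2[OF char2, of 2] by simp
  then show ?thesis by (simp only: scale_left_distrib scale_one)
qed

text \<open>The binomial coefficient \<open>(s + 2 ^ i) choose (2 ^ i)\<close> is odd exactly when
  digit \<open>i\<close> of \<open>s\<close> is clear.\<close>

lemma upper_upper_power2:
  assumes "v \<in> car M"
  shows "div_pow M upper s (div_pow M upper (2 ^ i) v) = (if bit s i then 0 else div_pow M upper (s + 2 ^ i) v)"
  by (simp add: upper_upper[OF assms] of_nat_char2[OF char2] odd_choose_power2 bit_add_power2_same)

lemma upper_power2_commute:
  "v \<in> car M \<Longrightarrow> div_pow M upper (2 ^ i) (div_pow M upper (2 ^ j) v) =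
     div_pow M upper (2 ^ j) (div_pow M upper (2 ^ i) v)"
  by (simp add: upper_upper_power2 bit_exp_iff add.commute)

lemma upper_power2_twice: "v \<in> car M \<Longrightarrow> div_pow M upper (2 ^ i) (div_pow M upper (2 ^ i) v) = 0"
  by (simp add: upper_upper_power2 bit_exp_iff)

text \<open>The divided powers of index \<open>2 ^ i\<close> generate all others: split off a binary
  digit of \<open>s\<close>, which by \<open>upper_upper_power2\<close> costs no
  coefficient.\<close>

lemma upper_zero_of_power2:
  assumes v: "v \<in> car M" and e: "\<And>i. div_pow M upper (2 ^ i) v = 0" and s: "s > 0"
  shows "div_pow M upper s v = 0"
proof -
  obtain i where i: "bit s i" using s bit_eq_iff[of s 0] by auto
  then have "2 ^ i \<le> s" by (metis bit_iff_odd div_less dvd_0_right not_less)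
  then obtain r where r: "s = r + 2 ^ i" by (metis le_add_diff_inverse2)
  then have "\<not> bit r i" using i by (simp add: bit_add_power2_same)
  then have "div_pow M upper s v = div_pow M upper r (div_pow M upper (2 ^ i) v)"
    using v r by (simp add: upper_upper_power2)
  then show ?thesis by (simp add: e div_pow_zero polynomial_curve_upper)
qed

lemma invariant_of_power2:
  assumes "v \<in> weight_space M 0" "\<And>i. div_pow M upper (2 ^ i) v = 0" "g \<in> SL2"
  shows "act M g v = v"
  using assms invariant_of_upper_invariant upper_zero_of_power2 weight_space_car by metis

lemma weight_space_zero [simp]: "0 \<in> weight_space M n"
  using subspace_0[OF weight_subspace] .

lemma cochain_car: "c \<in> cochains M q \<Longrightarrow> c \<mu> \<in> car M"
  by (auto simp: cochains_def intro: weight_space_car)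

lemma cochain_weight: "c \<in> cochains M q \<Longrightarrow> c \<mu> \<in> weight_space M (mweight \<mu>)"
  by (simp add: cochains_def)

lemma cochains_scale: "c \<in> cochains M q \<Longrightarrow> (\<lambda>\<mu>. scl M a (c \<mu>)) \<in> cochains M q"
  unfolding cochains_def
  by (auto intro: subspace_scale[OF weight_subspace] elim!: finite_subset[rotated])

lemma cochains_add: "c \<in> cochains M q \<Longrightarrow> c' \<in> cochains M q \<Longrightarrow> (\<lambda>\<mu>. c \<mu> + c' \<mu>) \<in> cochains M q"
  unfolding cochains_def
proof (clarsimp, intro conjI)
  assume "finite {\<mu>. c \<mu> \<noteq> 0}" "finite {\<mu>. c' \<mu> \<noteq> 0}"
  then have "finite ({\<mu>. c \<mu> \<noteq> 0} \<union> {\<mu>. c' \<mu> \<noteq> 0})" by simp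
  then show "finite {\<mu>. c \<mu> + c' \<mu> \<noteq> 0}" by (rule finite_subset[rotated]) auto
qed (auto intro: subspace_add[OF weight_subspace])

lemma cochains_diff: "c \<in> cochains M q \<Longrightarrow> c' \<in> cochains M q \<Longrightarrow> (\<lambda>\<mu>. c \<mu> - c' \<mu>) \<in> cochains M q"
  using cochains_add[of c q "\<lambda>\<mu>. scl M (-1) (c' \<mu>)"] cochains_scale[of c' q "-1"] by simp

lemma cochains_zero: "(\<lambda>\<mu>. 0) \<in> cochains M q"
  by (simp add: cochains_def)

lemma cochains_sum: "(\<And>x. x \<in> X \<Longrightarrow> z x \<in> cochains M q) \<Longrightarrow> (\<lambda>\<mu>. \<Sum>x\<in>X. z x \<mu>) \<in> cochains M q"
  by (induction X rule: infinite_finite_induct) (simp_all add: cochains_zero cochains_add)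

lemma finite_power2_support:
  assumes "v \<in> car M" shows "finite {i. div_pow M upper (2 ^ i) v \<noteq> 0}"
proof -
  obtain N where N: "\<And>n. n > N \<Longrightarrow> div_pow M upper n v = 0"
    by (rule div_pow_expand[OF assms polynomial_curve_upper]) blast
  have "i \<le> N" if "div_pow M upper (2 ^ i) v \<noteq> 0" for i
    using N[of "2 ^ i"] that less_exp[of i] by (meson leI less_trans)
  then have "{i. div_pow M upper (2 ^ i) v \<noteq> 0} \<subseteq> {..N}" by auto
  then show ?thesis by (rule finite_subset) simp
qed

lemma cobd_cochains:
  assumes c: "c \<in> cochains M q" shows "cobd M c \<in> cochains M (Suc q)"
proof -
  note cc = cochain_car[OF c]
  have "{\<nu>. cobd M c \<nu> \<noteq> 0} \<subseteq>
      (\<Union>\<mu>\<in>{\<mu>. c \<mu> \<noteq> 0}. (\<lambda>i. add_mset i \<mu>) ` {i. div_pow M upper (2 ^ i) (c \<mu>) \<noteq> 0})"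
  proof (clarify)
    fix \<nu> assume "cobd M c \<nu> \<noteq> 0"
    then obtain i where i: "i \<in># \<nu>" "div_pow M upper (2 ^ i) (c (\<nu> - {#i#})) \<noteq> 0"
      unfolding cobd_def by (meson sum.not_neutral_contains_not_neutral)
    then have "c (\<nu> - {#i#}) \<noteq> 0" by (auto simp: div_pow_zero polynomial_curve_upper)
    then show "\<nu> \<in> (\<Union>\<mu>\<in>{\<mu>. c \<mu> \<noteq> 0}. (\<lambda>i. add_mset i \<mu>) ` {i. div_pow M upper (2 ^ i) (c \<mu>) \<noteq> 0})"
      using i by (intro UN_I[of "\<nu> - {#i#}"]) (auto intro!: image_eqI[of _ _ i])
  qed
  moreover have "finite (\<Union>\<mu>\<in>{\<mu>. c \<mu> \<noteq> 0}. (\<lambda>i. add_mset i \<mu>) ` {i. div_pow M upper (2 ^ i) (c \<mu>) \<noteq> 0})"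
    using c finite_power2_support[OF cc] by (auto simp: cochains_def)
  ultimately have fin: "finite {\<nu>. cobd M c \<nu> \<noteq> 0}" by (rule finite_subset)
  have wt: "cobd M c \<nu> \<in> weight_space M (mweight \<nu>)" for \<nu>
    unfolding cobd_def
  proof (rule subspace_sum[OF weight_subspace])
    fix i assume i: "i \<in># \<nu>"
    have "div_pow M upper (2 ^ i) (c (\<nu> - {#i#})) \<in> weight_space M (mweight (\<nu> - {#i#}) + 2 * int (2 ^ i))"
      by (rule upper_weight[OF cochain_weight[OF c]])
    then show "div_pow M upper (2 ^ i) (c (\<nu> - {#i#})) \<in> weight_space M (mweight \<nu>)"
      using mweight_remove[OF i] by simp
  qed
  have "cobd M c \<nu> = 0" if "size \<nu> \<noteq> Suc q" for \<nu>
    unfolding cobd_def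
  proof (rule sum.neutral, rule ballI)
    fix i assume i: "i \<in># \<nu>"
    then have "size (\<nu> - {#i#}) \<noteq> q" using that by (metis size_Suc_Diff1)
    then have "c (\<nu> - {#i#}) = 0" using c by (simp add: cochains_def)
    then show "div_pow M upper (2 ^ i) (c (\<nu> - {#i#})) = 0"
      by (simp add: div_pow_zero polynomial_curve_upper)
  qed
  with fin wt show ?thesis by (simp add: cochains_def)
qed

lemma cobd_scale: "c \<in> cochains M q \<Longrightarrow> cobd M (\<lambda>\<mu>. scl M a (c \<mu>)) \<nu> = scl M a (cobd M c \<nu>)"
  by (simp add: cobd_def div_pow_scale cochain_car polynomial_curve_upper scale_sum_right)

lemma cobd_add: "c \<in> cochains M q \<Longrightarrow> c' \<in> cochains M q \<Longrightarrow>
    cobd M (\<lambda>\<mu>. c \<mu> + c' \<mu>) \<nu> = cobd M c \<nu> + cobd M c' \<nu>"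
  by (simp add: cobd_def div_pow_add cochain_car polynomial_curve_upper sum.distrib)

lemma cobd_diff: "c \<in> cochains M q \<Longrightarrow> c' \<in> cochains M q \<Longrightarrow>
    cobd M (\<lambda>\<mu>. c \<mu> - c' \<mu>) \<nu> = cobd M c \<nu> - cobd M c' \<nu>"
  using cobd_add[of "\<lambda>\<mu>. c \<mu> - c' \<mu>" q c' \<nu>] by (simp add: cochains_diff)

lemma cobd_zero: "cobd M (\<lambda>\<mu>. 0) \<nu> = 0"
  by (simp add: cobd_def div_pow_zero polynomial_curve_upper)

lemma cobd_sum: "(\<And>x. x \<in> X \<Longrightarrow> z x \<in> cochains M q) \<Longrightarrow>
    cobd M (\<lambda>\<mu>. \<Sum>x\<in>X. z x \<mu>) \<nu> = (\<Sum>x\<in>X. cobd M (z x) \<nu>)"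
proof (induction X rule: infinite_finite_induct)
  case (insert x F)
  have "cobd M (\<lambda>\<mu>. z x \<mu> + (\<Sum>x\<in>F. z x \<mu>)) \<nu> = cobd M (z x) \<nu> + cobd M (\<lambda>\<mu>. \<Sum>x\<in>F. z x \<mu>) \<nu>"
    using insert by (intro cobd_add[of _ q] cochains_sum) auto
  then show ?case using insert by simp
qed (simp_all add: cobd_zero)

text \<open>Each pair of distinct indices is counted in both orders, and the two equal terms cancel
  in characteristic 2; the diagonal terms vanish by \<open>upper_power2_twice\<close>.\<close>

lemma cobd_cobd:
  assumes c: "c \<in> cochains M q" shows "cobd M (cobd M c) \<nu> = 0"
proof -
  note cc [simp] = cochain_car[OF c] and [simp] = polynomial_curve_upper
  define E where "E i = div_pow M upper (2 ^ i)" for i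
  \<comment> \<open>Ordered pairs of elements removed one after the other; a diagonal pair occurs
    when the multiplicity is at least 2.\<close>
  define P where "P = Sigma (set_mset \<nu>) (\<lambda>i. set_mset (\<nu> - {#i#}))"
  define T where "T = (\<lambda>(i, j). E i (E j (c (\<nu> - {#i#} - {#j#}))))"
  have P: "(i, j) \<in> P \<longleftrightarrow> (j, i) \<in> P" if "i \<noteq> j" for i j
    using that by (auto simp: P_def in_diff_count)
  have sym: "T (i, j) = T (j, i)" for i j
    by (simp add: T_def E_def upper_power2_commute diff_right_commute[of \<nu>] add_mset_commute)
  have "cobd M (cobd M c) \<nu> = (\<Sum>i\<in>set_mset \<nu>. \<Sum>j\<in>set_mset (\<nu> - {#i#}). T (i, j))"
    unfolding cobd_def T_def E_def by (simp add: div_pow_sum)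
  also have "\<dots> = sum T P" unfolding P_def by (subst sum.Sigma) auto
  also have "\<dots> = sum T {p \<in> P. fst p \<noteq> snd p}"
    by (rule sum.mono_neutral_right)
      (auto simp: P_def T_def E_def upper_power2_twice)
  also have "{p \<in> P. fst p \<noteq> snd p} = {p \<in> P. fst p < snd p} \<union> {p \<in> P. snd p < fst p}" by auto
  also have "sum T \<dots> = sum T {p \<in> P. fst p < snd p} + sum T {p \<in> P. snd p < fst p}"
    by (rule sum.union_disjoint) (auto simp: P_def)
  also have "sum T {p \<in> P. snd p < fst p} = sum T {p \<in> P. fst p < snd p}"
    by (rule sum.reindex_bij_witness[of _ prod.swap prod.swap]) (auto simp: P sym)
  also have "sum T {p \<in> P. fst p < snd p} + \<dots> = 0" by (rule double_zero)
  finally show ?thesis .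
qed

end

context ghom
begin

lemma f_cochains:
  assumes "c \<in> cochains A q" shows "f \<circ> c \<in> cochains B q"
proof -
  have "finite {\<mu>. (f \<circ> c) \<mu> \<noteq> 0}"
    using assms by (auto simp: cochains_def elim!: finite_subset[rotated])
  then show ?thesis using assms f_weight by (auto simp: cochains_def)
qed

lemma f_cobd:
  assumes "c \<in> cochains A q" shows "cobd B (f \<circ> c) \<nu> = f (cobd A c \<nu>)"
proof -
  have "c \<mu> \<in> car A" for \<mu> using assms by (auto simp: cochains_def intro: weight_space_car)
  then show ?thesis by (simp add: cobd_def f_sum f_div_pow polynomial_curve_upper)
qed

text \<open>Taking weight spaces is exact: the weight part of any preimage of a weight vector is
  again a preimage. The zero preimage is chosen for the value zero, which keeps the support
  finite.\<close>

lemma lift_cochain: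
  assumes onto: "\<And>y. y \<in> car B \<Longrightarrow> \<exists>x\<in>car A. f x = y" and c: "c \<in> cochains B q"
  obtains c' where "c' \<in> cochains A q" "f \<circ> c' = c"
proof -
  have "\<forall>\<mu>. \<exists>x. x \<in> weight_space A (mweight \<mu>) \<and> f x = c \<mu> \<and> (c \<mu> = 0 \<longrightarrow> x = 0)"
  proof
    fix \<mu>
    show "\<exists>x. x \<in> weight_space A (mweight \<mu>) \<and> f x = c \<mu> \<and> (c \<mu> = 0 \<longrightarrow> x = 0)"
    proof (cases "c \<mu> = 0")
      case True
      then show ?thesis using A.subspace_0[OF A.weight_subspace] by (intro exI[of _ 0]) simp
    next
      case False
      have cw: "c \<mu> \<in> weight_space B (mweight \<mu>)" using c by (simp add: cochains_def)
      then obtain x where x: "x \<in> car A" "f x = c \<mu>" using onto weight_space_car by blast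
      then have "f (wt_part A (mweight \<mu>) x) = c \<mu>"
        using cw by (simp add: f_wt_part B.wt_part_of_weight)
      then show ?thesis using False x A.wt_part_weight_space by blast
    qed
  qed
  then obtain c' where c': "\<And>\<mu>. c' \<mu> \<in> weight_space A (mweight \<mu>)" "\<And>\<mu>. f (c' \<mu>) = c \<mu>"
    "\<And>\<mu>. c \<mu> = 0 \<Longrightarrow> c' \<mu> = 0" by metis
  have "finite {\<mu>. c' \<mu> \<noteq> 0}"
    by (rule finite_subset[of _ "{\<mu>. c \<mu> \<noteq> 0}"]) (use c c'(3) in \<open>auto simp: cochains_def\<close>)
  then have "c' \<in> cochains A q" using c c' by (auto simp: cochains_def)
  moreover have "f \<circ> c' = c" using c'(2) by auto
  ultimately show ?thesis using that by blast
qed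

text \<open>Since preimages are unique here, the preimage of a weight vector equals its own weight
  part.\<close>

lemma pull_cochain:
  assumes inj: "inj_on f (car A)" and c: "c \<in> cochains B q" and im: "\<And>\<mu>. c \<mu> \<in> f ` car A"
  obtains c' where "c' \<in> cochains A q" "f \<circ> c' = c"
proof -
  have "\<forall>\<mu>. \<exists>x. x \<in> car A \<and> f x = c \<mu>"
  proof
    fix \<mu> show "\<exists>x. x \<in> car A \<and> f x = c \<mu>" using im[of \<mu>] by auto
  qed
  from choice[OF this] obtain c' where c': "\<And>\<mu>. c' \<mu> \<in> car A" "\<And>\<mu>. f (c' \<mu>) = c \<mu>" by auto
  have z: "c' \<mu> = 0" if "c \<mu> = 0" for \<mu>
    using inj_onD[OF inj, of "c' \<mu>" 0] c' that by simp
  have "c' \<mu> \<in> weight_space A (mweight \<mu>)" for \<mu>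
  proof -
    have cw: "c \<mu> \<in> weight_space B (mweight \<mu>)" using c by (simp add: cochains_def)
    have "f (wt_part A (mweight \<mu>) (c' \<mu>)) = f (c' \<mu>)"
      using cw c' by (simp add: f_wt_part B.wt_part_of_weight)
    then have "wt_part A (mweight \<mu>) (c' \<mu>) = c' \<mu>"
      using inj_onD[OF inj] c' by auto
    then show ?thesis using A.wt_part_weight_space c' by metis
  qed
  moreover have "finite {\<mu>. c' \<mu> \<noteq> 0}"
    by (rule finite_subset[of _ "{\<mu>. c \<mu> \<noteq> 0}"]) (use c z in \<open>auto simp: cochains_def\<close>)
  ultimately have "c' \<in> cochains A q" using c z by (auto simp: cochains_def)
  moreover have "f \<circ> c' = c" using c'(2) by auto
  ultimately show ?thesis using that by blast
qed

end

section \<open>Dimension shifting along a short exact sequence\<close>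

definition acyclic_at :: "('k::field, 'v::ab_group_add) gmod \<Rightarrow> nat \<Rightarrow> bool" where
  "acyclic_at M q \<longleftrightarrow> (\<forall>c\<in>cochains M (Suc q). (\<forall>\<nu>. cobd M c \<nu> = 0) \<longrightarrow>
     (\<exists>y\<in>cochains M q. cobd M y = c))"

text \<open>Mind the offset: the classes have degree \<open>Suc q\<close> and are independent modulo
  coboundaries of cochains of degree \<open>q\<close>. A family is used instead of a set so that one
  index set \<open>X\<close> serves through all shifts.\<close>

definition indep_cocycles :: "('k::field, 'v::ab_group_add) gmod \<Rightarrow> nat \<Rightarrow> 'x set \<Rightarrow>
    ('x \<Rightarrow> nat multiset \<Rightarrow> 'v) \<Rightarrow> bool" where
  "indep_cocycles M q X z \<longleftrightarrow> (\<forall>x\<in>X. z x \<in> cochains M (Suc q) \<and> (\<forall>\<nu>. cobd M (z x) \<nu> = 0)) \<and>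
     (\<forall>a. \<forall>w\<in>cochains M q. (\<forall>\<mu>. (\<Sum>x\<in>X. scl M (a x) (z x \<mu>)) = cobd M w \<mu>) \<longrightarrow> (\<forall>x\<in>X. a x = 0))"

locale short_exact = i: ghom A B i + p: ghom B C p
  for A :: "('k::alg_closed_field, 'v::ab_group_add) gmod"
    and B :: "('k, 'w::ab_group_add) gmod" and C :: "('k, 'u::ab_group_add) gmod" and i p +
  assumes char2: "CHAR('k) = 2" and inj: "inj_on i (car A)"
    and onto: "\<And>y. y \<in> car C \<Longrightarrow> \<exists>x\<in>car B. p x = y"
    and exact: "\<And>x. x \<in> car B \<Longrightarrow> p x = 0 \<longleftrightarrow> x \<in> i ` car A"
begin

sublocale A2: rmodule2 A by unfold_locales (rule char2)
sublocale B2: rmodule2 B by unfold_locales (rule char2)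
sublocale C2: rmodule2 C by unfold_locales (rule char2)

text \<open>The snake: push \<open>z\<close> into \<open>B\<close>, where it bounds some
  \<open>y\<close>, and pass to \<open>p \<circ> y\<close>. A relation among these modulo the image
  of a cocycle \<open>w\<close> of \<open>B\<close> comes back to a relation among the
  \<open>z\<close> modulo coboundaries of \<open>A\<close>. Allowing every cocycle \<open>w\<close>
  covers positive degrees and degree 0 together.\<close>

lemma connecting:
  assumes z: "indep_cocycles A q X z" and acyc: "acyclic_at B q"
  shows "\<exists>y. (\<forall>x\<in>X. y x \<in> cochains B q) \<and> (\<forall>x\<in>X. \<forall>\<nu>. cobd C (p \<circ> y x) \<nu> = 0) \<and>
    (\<forall>a. \<forall>w\<in>cochains B q. (\<forall>\<nu>. cobd B w \<nu> = 0) \<longrightarrow>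
      (\<forall>\<mu>. (\<Sum>x\<in>X. scl C (a x) (p (y x \<mu>))) = p (w \<mu>)) \<longrightarrow> (\<forall>x\<in>X. a x = 0))"
proof -
  have zc: "\<And>x. x \<in> X \<Longrightarrow> z x \<in> cochains A (Suc q)" and zd: "\<And>x \<nu>. x \<in> X \<Longrightarrow> cobd A (z x) \<nu> = 0"
    using z by (auto simp: indep_cocycles_def)
  have "\<forall>x\<in>X. \<exists>y\<in>cochains B q. cobd B y = i \<circ> z x"
  proof
    fix x assume x: "x \<in> X"
    have "\<forall>\<nu>. cobd B (i \<circ> z x) \<nu> = 0" using i.f_cobd[OF zc[OF x]] zd[OF x] by simp
    then show "\<exists>y\<in>cochains B q. cobd B y = i \<circ> z x"
      using acyc i.f_cochains[OF zc[OF x]] unfolding acyclic_at_def by blast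
  qed
  then obtain y where y: "\<And>x. x \<in> X \<Longrightarrow> y x \<in> cochains B q" "\<And>x. x \<in> X \<Longrightarrow> cobd B (y x) = i \<circ> z x"
    by metis
  have pi0: "p (i v) = 0" if "v \<in> car A" for v using exact[of "i v"] that by auto
  have "cobd C (p \<circ> y x) \<nu> = 0" if x: "x \<in> X" for x \<nu>
    using p.f_cobd[OF y(1)[OF x]] y(2)[OF x] pi0 A2.cochain_car[OF zc[OF x]] by simp
  moreover have "\<forall>x\<in>X. a x = 0" if w: "w \<in> cochains B q" "\<And>\<nu>. cobd B w \<nu> = 0"
    and eq: "\<And>\<mu>. (\<Sum>x\<in>X. scl C (a x) (p (y x \<mu>))) = p (w \<mu>)" for a w
  proof -
    \<comment> \<open>This combination dies in \<open>C\<close>, so it comes from \<open>A\<close>;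
      its coboundary is the corresponding combination of the \<open>z\<close>, because
      \<open>w\<close> is a cocycle.\<close>
    define u where "u \<mu> = (\<Sum>x\<in>X. scl B (a x) (y x \<mu>)) - w \<mu>" for \<mu>
    have ac: "(\<lambda>\<mu>. scl B (a x) (y x \<mu>)) \<in> cochains B q" if "x \<in> X" for x
      using y(1)[OF that] B2.cochains_scale by simp
    have sc: "(\<lambda>\<mu>. \<Sum>x\<in>X. scl B (a x) (y x \<mu>)) \<in> cochains B q"
      by (rule B2.cochains_sum) (rule ac)
    have uc: "u \<in> cochains B q"
      unfolding u_def[abs_def] using B2.cochains_diff[OF sc w(1)] .
    have yc: "x \<in> X \<Longrightarrow> y x \<mu> \<in> car B" for x \<mu> using y(1) B2.cochain_car by blast
    have "p (u \<mu>) = 0" for \<mu>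
    proof -
      have "p (u \<mu>) = p (\<Sum>x\<in>X. scl B (a x) (y x \<mu>)) - p (w \<mu>)"
        unfolding u_def
        using B2.cochain_car[OF sc, of \<mu>] B2.cochain_car[OF w(1)] by (subst p.f_diff) auto
      also have "p (\<Sum>x\<in>X. scl B (a x) (y x \<mu>)) = (\<Sum>x\<in>X. scl C (a x) (p (y x \<mu>)))"
        using yc by (subst p.f_sum) (auto simp: p.f_scale intro: i.B.car_scale)
      finally show ?thesis using eq by simp
    qed
    then have im: "u \<mu> \<in> i ` car A" for \<mu>
      using exact[of "u \<mu>"] B2.cochain_car[OF uc] by simp
    obtain u' where u': "u' \<in> cochains A q" "i \<circ> u' = u"
      by (rule i.pull_cochain[OF inj uc im]) (rule that)
    have "(\<Sum>x\<in>X. scl A (a x) (z x \<mu>)) = cobd A u' \<mu>" for \<mu>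
    proof -
      have "i (cobd A u' \<mu>) = cobd B u \<mu>" using i.f_cobd[OF u'(1)] u'(2) by simp
      also have "\<dots> = cobd B (\<lambda>\<mu>. \<Sum>x\<in>X. scl B (a x) (y x \<mu>)) \<mu>"
        unfolding u_def[abs_def] using B2.cobd_diff[OF sc w(1)] w(2) by simp
      also have "\<dots> = (\<Sum>x\<in>X. scl B (a x) (i (z x \<mu>)))"
        by (subst B2.cobd_sum[OF ac]) (auto simp: B2.cobd_scale[OF y(1)] y(2))
      also have "\<dots> = i (\<Sum>x\<in>X. scl A (a x) (z x \<mu>))"
        using A2.cochain_car[OF zc] by (subst i.f_sum) (auto simp: i.f_scale intro: i.A.car_scale)
      finally have "i (cobd A u' \<mu>) = i (\<Sum>x\<in>X. scl A (a x) (z x \<mu>))" .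
      moreover have "cobd A u' \<mu> \<in> car A"
        using A2.cochain_car[OF A2.cobd_cochains[OF u'(1)]] .
      moreover have "(\<Sum>x\<in>X. scl A (a x) (z x \<mu>)) \<in> car A"
        using A2.cochain_car[OF zc] by (auto intro!: i.A.car_sum i.A.car_scale)
      ultimately show ?thesis using inj_onD[OF inj] by metis
    qed
    then show ?thesis using z u'(1) unfolding indep_cocycles_def by blast
  qed
  ultimately show ?thesis by (intro exI[of _ y]) (simp add: y(1))
qed

lemma connecting_cocycles:
  assumes z: "indep_cocycles A (Suc q) X z" and acyc: "acyclic_at B (Suc q)"
  obtains z' where "indep_cocycles C q X z'"
proof -
  obtain y where y': "\<forall>x\<in>X. y x \<in> cochains B (Suc q)" "\<forall>x\<in>X. \<forall>\<nu>. cobd C (p \<circ> y x) \<nu> = 0"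
    "\<forall>a. \<forall>w\<in>cochains B (Suc q). (\<forall>\<nu>. cobd B w \<nu> = 0) \<longrightarrow>
      (\<forall>\<mu>. (\<Sum>x\<in>X. scl C (a x) (p (y x \<mu>))) = p (w \<mu>)) \<longrightarrow> (\<forall>x\<in>X. a x = 0)"
    using connecting[OF z acyc] by (elim exE conjE) (rule that)
  note y = y'(1,2)[rule_format]
  have "indep_cocycles C q X (\<lambda>x. p \<circ> y x)"
    unfolding indep_cocycles_def
  proof (intro conjI ballI allI impI)
    fix x assume "x \<in> X"
    then show "p \<circ> y x \<in> cochains C (Suc q)" using p.f_cochains[OF y(1)] by simp
  next
    fix x \<nu> assume "x \<in> X"
    then show "cobd C (p \<circ> y x) \<nu> = 0" by (rule y(2))
  next
    fix a w x
    assume w: "w \<in> cochains C q" and eq: "\<forall>\<mu>. (\<Sum>x\<in>X. scl C (a x) ((p \<circ> y x) \<mu>)) = cobd C w \<mu>"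
      and x: "x \<in> X"
    obtain w' where w': "w' \<in> cochains B q" "p \<circ> w' = w"
      by (rule p.lift_cochain[OF onto w]) (simp, rule that)
    have "\<forall>x\<in>X. a x = 0"
    proof (rule y'(3)[THEN spec, THEN bspec, THEN mp, THEN mp])
      show "cobd B w' \<in> cochains B (Suc q)" by (rule B2.cobd_cochains[OF w'(1)])
      show "\<forall>\<nu>. cobd B (cobd B w') \<nu> = 0" using B2.cobd_cobd[OF w'(1)] by simp
      show "\<forall>\<mu>. (\<Sum>x\<in>X. scl C (a x) (p (y x \<mu>))) = p (cobd B w' \<mu>)"
        using eq p.f_cobd[OF w'(1)] w'(2) by simp
    qed
    then show "a x = 0" using x by blast
  qed
  then show ?thesis by (rule that)
qed

text \<open>A cocycle of degree 0 is its value at the empty multiset: a weight 0 vector killed by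
  the divided powers of index \<open>2 ^ i\<close>, hence invariant under the whole group by
  \<open>invariant_of_power2\<close>. Here the cohomology of the Borel subgroup and that of the
  group meet.\<close>

lemma connecting_invariants:
  assumes z: "indep_cocycles A 0 X z" and acyc: "acyclic_at B 0"
  obtains u where "\<And>x. x \<in> X \<Longrightarrow> u x \<in> car C" "\<And>x g. x \<in> X \<Longrightarrow> g \<in> SL2 \<Longrightarrow> act C g (u x) = u x"
    "\<And>a b. b \<in> car B \<Longrightarrow> (\<And>g. g \<in> SL2 \<Longrightarrow> act B g b = b) \<Longrightarrow>
      (\<Sum>x\<in>X. scl C (a x) (u x)) = p b \<Longrightarrow> \<forall>x\<in>X. a x = 0"
proof -
  obtain y where y': "\<forall>x\<in>X. y x \<in> cochains B 0" "\<forall>x\<in>X. \<forall>\<nu>. cobd C (p \<circ> y x) \<nu> = 0"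
    "\<forall>a. \<forall>w\<in>cochains B 0. (\<forall>\<nu>. cobd B w \<nu> = 0) \<longrightarrow>
      (\<forall>\<mu>. (\<Sum>x\<in>X. scl C (a x) (p (y x \<mu>))) = p (w \<mu>)) \<longrightarrow> (\<forall>x\<in>X. a x = 0)"
    using connecting[OF z acyc] by (elim exE conjE) (rule that)
  note y = y'(1,2)[rule_format]
  define u where "u x = p (y x {#})" for x
  have w0: "p (y x {#}) \<in> weight_space C 0" if "x \<in> X" for x
    using C2.cochain_weight[OF p.f_cochains[OF y(1)[OF that]], of "{#}"] by simp
  have e0: "div_pow C upper (2 ^ i) (p (y x {#})) = 0" if "x \<in> X" for x i
    using y(2)[OF that, of "{#i#}"] by (simp add: cobd_def)
  show ?thesis
  proof (rule that[of u])
    show "u x \<in> car C" if "x \<in> X" for x using w0[OF that] weight_space_car by (auto simp: u_def)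
    show "act C g (u x) = u x" if "x \<in> X" "g \<in> SL2" for x g
      unfolding u_def by (rule C2.invariant_of_power2[OF w0[OF that(1)] e0[OF that(1)] that(2)])
    fix a b assume b: "b \<in> car B" "\<And>g. g \<in> SL2 \<Longrightarrow> act B g b = b"
      and eq: "(\<Sum>x\<in>X. scl C (a x) (u x)) = p b"
    define w where "w \<mu> = (if \<mu> = {#} then b else 0)" for \<mu> :: "nat multiset"
    have bw: "b \<in> weight_space B 0" using b by (simp add: weight_space_def)
    have ez: "div_pow B upper n b = 0" if "n > 0" for n
    proof -
      have "div_pow B upper n b = (if n = 0 then b else 0)"
        by (rule i.B.div_pow_eqI[where N = 0]) (use b in \<open>auto simp: polynomial_curve_upper\<close>)
      then show ?thesis using that by simp
    qed
    show "\<forall>x\<in>X. a x = 0"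
    proof (rule y'(3)[THEN spec, THEN bspec, THEN mp, THEN mp, of w])
      show "w \<in> cochains B 0" using bw by (auto simp: cochains_def w_def)
      show "\<forall>\<nu>. cobd B w \<nu> = 0"
        unfolding cobd_def by (rule allI, rule sum.neutral) (auto simp: w_def ez i.B.div_pow_zero polynomial_curve_upper)
      show "\<forall>\<mu>. (\<Sum>x\<in>X. scl C (a x) (p (y x \<mu>))) = p (w \<mu>)"
      proof
        fix \<mu> show "(\<Sum>x\<in>X. scl C (a x) (p (y x \<mu>))) = p (w \<mu>)"
      proof (cases "\<mu> = {#}")
        case True then show ?thesis using eq by (simp add: w_def u_def)
      next
        case False
        then have "y x \<mu> = 0" if "x \<in> X" for x using y(1)[OF that] by (auto simp: cochains_def)
        then show ?thesis using False by (simp add: w_def)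
      qed
      qed
    qed
  qed
qed

end

section \<open>Coinduced modules\<close>

text \<open>k[G] \<otimes> M with right translation on the functions only, that is, the module
  coinduced from the trivial subgroup. Functions vanish off \<open>SL2\<close> so that each has a
  single representative.\<close>

definition coind :: "('k::field, 'v::ab_group_add) gmod \<Rightarrow> ('k, 'k ^ 2 ^ 2 \<Rightarrow> 'v) gmod" where
  "coind M = \<lparr>scl = (\<lambda>a f g. scl M a (f g)),
     car = {f. (\<forall>g. g \<notin> SL2 \<longrightarrow> f g = 0) \<and> regular M f},
     act = (\<lambda>g f h. if h \<in> SL2 then f (h ** g) else 0)\<rparr>"

lemma coind_simps [simp]:
  "scl (coind M) = (\<lambda>a f g. scl M a (f g))"
  "f \<in> car (coind M) \<longleftrightarrow> (\<forall>g. g \<notin> SL2 \<longrightarrow> f g = 0) \<and> regular M f"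
  "act (coind M) = (\<lambda>g f h. if h \<in> SL2 then f (h ** g) else 0)"
  by (simp_all add: coind_def)

definition on_SL2 :: "('k::field ^ 2 ^ 2 \<Rightarrow> 'v::zero) \<Rightarrow> 'k ^ 2 ^ 2 \<Rightarrow> 'v" where
  "on_SL2 f g = (if g \<in> SL2 then f g else 0)"

lemma on_SL2_zero [simp]: "on_SL2 (\<lambda>h. 0) = (0 :: 'k::field ^ 2 ^ 2 \<Rightarrow> 'v::zero)"
  by (auto simp: on_SL2_def)

lemma sum_fun_apply: "sum f A x = (\<Sum>a\<in>A. f a x)"
  by (induction A rule: infinite_finite_induct) auto

text \<open>The size condition that lets a module be carried by functions on an arbitrary infinite
  type; it is inherited by \<open>coind\<close> and by images.\<close>

definition countable_dim :: "('k::field, 'v::ab_group_add) gmod \<Rightarrow> bool" where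
  "countable_dim M \<longleftrightarrow> (\<exists>S. countable S \<and> S \<subseteq> car M \<and> car M \<subseteq> module.span (scl M) S)"

context gmodule
begin

lemma on_SL2_regular: "regular M f \<Longrightarrow> on_SL2 f \<in> car (coind M)"
  using regular_transfer[of f "on_SL2 f"] by (simp add: on_SL2_def)

lemma coind_eq: "f \<in> car (coind M) \<Longrightarrow> f = on_SL2 f"
  by (auto simp: on_SL2_def)

lemma vector_space_coind: "vector_space (scl (coind M))"
  by unfold_locales (auto simp: scale_right_distrib scale_left_distrib)

lemma group_module_coind: "group_module (coind M)"
proof -
  interpret V: vector_space "scl (coind M)" by (rule vector_space_coind)
  have "V.subspace (car (coind M))"
    by (rule V.subspaceI) (auto simp: regular_zero[unfolded zero_fun_def[symmetric]] zero_fun_def regular_zero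
        regular_scale plus_fun_def intro: regular_add)
  moreover have "act (coind M) g v \<in> car (coind M)" if "g \<in> SL2" "v \<in> car (coind M)" for g v
    using on_SL2_regular[OF regular_translate_right[of v g]] that by (simp add: on_SL2_def[abs_def])
  ultimately show ?thesis
    unfolding group_module_def using V.vector_space_axioms
    by (auto simp: fun_eq_iff matrix_mul_assoc)
qed

text \<open>By \<open>polynomial_fun_comult\<close> the translate of a function by \<open>g\<close>
  is a finite sum of fixed functions with coefficients regular in \<open>g\<close>.\<close>

lemma rational_coind: "rational_module (coind M)"
proof -
  interpret J: gmodule "coind M" by unfold_locales (rule group_module_coind)
  have "regular (coind M) (\<lambda>g. on_SL2 (\<lambda>h. f (h ** g)))" if "regular M f" for f
    using that
  proof (induction rule: regular_induct)
    case zero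
    show ?case using J.regular_zero by (simp add: zero_fun_def)
  next
    case (add c b f)
    obtain xs where xs: "set xs \<subseteq> Collect polynomial_fun \<times> Collect polynomial_fun"
      and c: "\<And>h g. c (h ** g) = (\<Sum>(P, Q)\<leftarrow>xs. P h * Q g)"
      using polynomial_fun_comult[OF add(1)] by auto
    have "regular (coind M) (\<lambda>g. on_SL2 (\<lambda>h. scl M (\<Sum>(P, Q)\<leftarrow>xs. P h * Q g) b))"
      using xs
    proof (induction xs)
      case Nil
      show ?case using J.regular_zero by (simp add: zero_fun_def)
    next
      case (Cons x xs)
      obtain P Q where x: "x = (P, Q)" by (cases x)
      have "on_SL2 (\<lambda>h. scl M (P h) b) \<in> car (coind M)"
        using Cons(2) x add(2) by (intro on_SL2_regular regular_tensor) auto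
      then have "regular (coind M) (\<lambda>g. scl (coind M) (Q g) (on_SL2 (\<lambda>h. scl M (P h) b)) +
          on_SL2 (\<lambda>h. scl M (\<Sum>(P, Q)\<leftarrow>xs. P h * Q g) b))"
        using Cons x by (intro J.regular_add J.regular_tensor) auto
      moreover have "scl (coind M) (Q g) (on_SL2 (\<lambda>h. scl M (P h) b)) +
          on_SL2 (\<lambda>h. scl M (\<Sum>(P, Q)\<leftarrow>xs. P h * Q g) b) =
          on_SL2 (\<lambda>h. scl M (\<Sum>(P, Q)\<leftarrow>x # xs. P h * Q g) b)" for g
        by (auto simp: on_SL2_def fun_eq_iff x scale_left_distrib mult.commute)
      ultimately show ?case by simp
    qed
    from J.regular_add[OF this add(3)]
    have "regular (coind M) (\<lambda>g. on_SL2 (\<lambda>h. scl M (c (h ** g)) b) + on_SL2 (\<lambda>h. f (h ** g)))"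
      unfolding c .
    moreover have "on_SL2 (\<lambda>h. scl M (c (h ** g)) b) + on_SL2 (\<lambda>h. f (h ** g)) =
        on_SL2 (\<lambda>h. scl M (c (h ** g)) b + f (h ** g))" for g
      by (auto simp: on_SL2_def fun_eq_iff)
    ultimately show ?case by simp
  next
    case (cong f f')
    show ?case
      by (rule J.regular_transfer[OF cong(2)]) (use cong(1) in \<open>auto simp: on_SL2_def fun_eq_iff\<close>)
  qed
  then show ?thesis
    by (intro J.rational_moduleI) (simp add: on_SL2_def[abs_def])
qed

lemma countable_dim_coind:
  assumes "countable_dim M" shows "countable_dim (coind M)"
proof -
  interpret J: gmodule "coind M" by unfold_locales (rule group_module_coind)
  obtain S where S: "countable S" "S \<subseteq> car M" "car M \<subseteq> span S"
    using assms by (auto simp: countable_dim_def)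
  define T where "T = (\<lambda>(l, s). on_SL2 (\<lambda>h. scl M (monomial_fun l h) s)) ` (UNIV \<times> S)"
  have T: "countable T" unfolding T_def using S(1) by (intro countable_image countable_SIGMA) auto
  have Tc: "T \<subseteq> car (coind M)"
    unfolding T_def using S(2) by (auto intro!: on_SL2_regular[unfolded coind_simps] regular_tensor polynomial_fun_monomial_fun)
  have z: "on_SL2 (\<lambda>h. 0) \<in> J.span T"
    unfolding on_SL2_zero by (rule J.span_zero)
  have mono: "on_SL2 (\<lambda>h. scl M (monomial_fun l h) b) \<in> J.span T" if b: "b \<in> span S" for l b
    using b
  proof (induction rule: span_induct_alt)
    case base
    show ?case unfolding scale_zero_right by (rule z)
  next
    case (step a s b)
    have "on_SL2 (\<lambda>h. scl M (monomial_fun l h) s) \<in> T" using step(1) by (auto simp: T_def)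
    then have m: "scl (coind M) a (on_SL2 (\<lambda>h. scl M (monomial_fun l h) s)) +
        on_SL2 (\<lambda>h. scl M (monomial_fun l h) b) \<in> J.span T"
      by (intro J.span_add J.span_scale J.span_base step(2))
    have eq: "on_SL2 (\<lambda>h. scl M (monomial_fun l h) (scl M a s + b)) =
        scl (coind M) a (on_SL2 (\<lambda>h. scl M (monomial_fun l h) s)) + on_SL2 (\<lambda>h. scl M (monomial_fun l h) b)"
      by (auto simp: on_SL2_def fun_eq_iff scale_right_distrib mult.commute)
    show ?case unfolding eq by (rule m)
  qed
  have "on_SL2 f \<in> J.span T" if "regular M f" for f
    using that
  proof (induction rule: regular_induct)
    case zero
    show ?case by (rule z)
  next
    case (add c b f)
    obtain xs where c: "\<And>g. c g = (\<Sum>(a, l)\<leftarrow>xs. a * monomial_fun l g)"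
      using polynomial_fun_sum_monomials[OF add(1)] by auto
    have bS: "b \<in> span S" using add(2) S(3) by auto
    have "on_SL2 (\<lambda>h. scl M (\<Sum>(a, l)\<leftarrow>xs. a * monomial_fun l h) b) \<in> J.span T"
    proof (induction xs)
      case Nil
      show ?case using z by (simp only: list.map sum_list.Nil scale_zero_left)
    next
      case (Cons x xs)
      obtain a l where x: "x = (a, l)" by (cases x)
      have eq: "on_SL2 (\<lambda>h. scl M (\<Sum>(a, l)\<leftarrow>x # xs. a * monomial_fun l h) b) =
        scl (coind M) a (on_SL2 (\<lambda>h. scl M (monomial_fun l h) b)) +
        on_SL2 (\<lambda>h. scl M (\<Sum>(a, l)\<leftarrow>xs. a * monomial_fun l h) b)"
        by (auto simp: on_SL2_def fun_eq_iff x scale_left_distrib)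
      show ?case unfolding eq by (rule J.span_add[OF J.span_scale[OF mono[OF bS]] Cons])
    qed
    then have "on_SL2 (\<lambda>h. scl M (c h) b) \<in> J.span T" unfolding c .
    note J.span_add[OF this add(3)]
    moreover have "on_SL2 (\<lambda>h. scl M (c h) b + f h) = on_SL2 (\<lambda>h. scl M (c h) b) + on_SL2 f"
      by (auto simp: on_SL2_def fun_eq_iff)
    ultimately show ?case by (simp only:)
  next
    case (cong f f')
    then have "on_SL2 f = on_SL2 f'" by (auto simp: on_SL2_def fun_eq_iff)
    then show ?case using cong(2) by (simp only:)
  qed
  then have "f \<in> J.span T" if "f \<in> car (coind M)" for f
    using coind_eq[OF that] that by (metis coind_simps(2))
  then have "car (coind M) \<subseteq> J.span T" by (rule subsetI)
  then show ?thesis unfolding countable_dim_def using T Tc by blast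
qed

end

context rmodule
begin

text \<open>The embedding that builds injective resolutions; its truncation \<open>pos_map\<close>
  serves to prove acyclicity.\<close>

definition orbit_map :: "'v \<Rightarrow> 'k ^ 2 ^ 2 \<Rightarrow> 'v" where
  "orbit_map v = (if v \<in> car M then on_SL2 (\<lambda>h. act M h v) else 0)"

lemma Hom_orbit_map: "orbit_map \<in> Hom_G M (coind M)"
proof -
  have "orbit_map v \<in> car (coind M)" if "v \<in> car M" for v
    using on_SL2_regular[OF regular_orbit[OF that]] that by (simp add: orbit_map_def)
  then show ?thesis
    unfolding Hom_G_def
    by (auto simp: orbit_map_def on_SL2_def fun_eq_iff act_add act_scale act_mult car_add car_scale)
qed

lemma inj_orbit_map: "inj_on orbit_map (car M)"
proof
  fix v w assume *: "v \<in> car M" "w \<in> car M" "orbit_map v = orbit_map w"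
  from *(3) have "orbit_map v (mat 1) = orbit_map w (mat 1)" by simp
  then show "v = w" using *(1,2)
    by (simp add: orbit_map_def on_SL2_def act_one)
qed

end

text \<open>By Frobenius reciprocity this is the extension of a linear map into \<open>V\<close> along \<open>f\<close>.\<close>

lemma coind_extend:
  fixes A :: "('k::alg_closed_field, 'a::ab_group_add) gmod" and B :: "('k, 'b::ab_group_add) gmod"
    and V :: "('k, 'v::ab_group_add) gmod"
  assumes "rmodule A" "rmodule B" "rmodule V"
    and f: "f \<in> Hom_G A B" and inj: "inj_on f (car A)" and h: "h \<in> Hom_G A (coind V)"
  shows "\<exists>h'\<in>Hom_G B (coind V). \<forall>x\<in>car A. h' (f x) = h x"
proof -
  interpret f: ghom A B f using assms by (simp add: ghom_def ghom_axioms_def)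
  interpret V: rmodule V by fact
  interpret JV: rmodule "coind V" by (rule rmoduleI[OF V.rational_coind])
  interpret h: ghom A "coind V" h using assms JV.rmodule_axioms by (simp add: ghom_def ghom_axioms_def)
  interpret vp: vector_space_pair "scl B" "scl V" by unfold_locales
  \<comment> \<open>An equivariant map into \<open>coind V\<close> is determined by its values at
    the identity, and these need only be extended linearly.\<close>
  define l where "l x = h x (mat 1)" for x
  have lc: "l x \<in> car V" if "x \<in> car A" for x
    using h.f_car[OF that] V.regular_car[of "h x" "mat 1"] by (simp add: l_def)
  have ladd: "l (x + y) = l x + l y" if "x \<in> car A" "y \<in> car A" for x y
    using that by (simp add: l_def h.f_add)
  have lscale: "l (scl A a x) = scl V a (l x)" if "x \<in> car A" for a x
    using that by (simp add: l_def h.f_scale)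
  have l0: "l 0 = 0" by (simp add: l_def)
  obtain S where S: "S \<subseteq> f ` car A" "f.B.independent S" "f ` car A \<subseteq> f.B.span S"
    using f.B.maximal_independent_subset by metis
  \<comment> \<open>The extension must take values in \<open>car V\<close>, not merely in the
    ambient type, so its range is prescribed as well.\<close>
  obtain \<psi> where \<psi>: "Vector_Spaces.linear (scl B) (scl V) \<psi>"
    "\<And>x. x \<in> S \<Longrightarrow> \<psi> x = l (inv_into (car A) f x)"
    "range \<psi> = V.span ((\<lambda>x. l (inv_into (car A) f x)) ` S)"
    using vp.linear_independent_extend_subspace[OF S(2), of "\<lambda>x. l (inv_into (car A) f x)"] by blast
  interpret \<psi>: Vector_Spaces.linear "scl B" "scl V" \<psi> by fact
  have "(\<lambda>x. l (inv_into (car A) f x)) ` S \<subseteq> car V"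
    using S(1) lc by (auto simp: inv_into_into subset_iff)
  then have "range \<psi> \<subseteq> car V" unfolding \<psi>(3) by (rule V.span_minimal[OF _ V.subspace_car])
  then have \<psi>c: "\<psi> y \<in> car V" for y by auto
  have "\<exists>x\<in>car A. f x = y \<and> \<psi> y = l x" if "y \<in> f.B.span S" for y
    using that
  proof (induction rule: f.B.span_induct_alt)
    case base then show ?case using l0 \<psi>.zero by (intro bexI[of _ 0]) auto
  next
    case (step a s y)
    then obtain x where x: "x \<in> car A" "f x = y" "\<psi> y = l x" by blast
    let ?s = "inv_into (car A) f s"
    have s: "?s \<in> car A" "f ?s = s" using step(1) S(1) by (auto simp: inv_into_into f_inv_into_f subset_iff)
    have "\<psi> (scl B a s + y) = l (scl A a ?s + x)"
      using x s step(1) by (simp add: \<psi>.add \<psi>.scale \<psi>(2) ladd lscale f.A.car_scale)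
    moreover have "f (scl A a ?s + x) = scl B a s + y"
      using x s by (simp add: f.f_add f.f_scale f.A.car_scale)
    moreover have "scl A a ?s + x \<in> car A" using x s by auto
    ultimately show ?case by blast
  qed
  then have \<psi>f: "\<psi> (f x) = l x" if "x \<in> car A" for x
    using S(3) that inj_onD[OF inj] by (metis image_subset_iff)
  define h' where "h' b = (if b \<in> car B then on_SL2 (\<lambda>g. \<psi> (act B g b)) else 0)" for b
  have "regular V (\<lambda>g. \<psi> (act B g b))" if "b \<in> car B" for b
    by (rule f.B.regular_linear[OF f.B.regular_orbit[OF that]])
      (use \<psi>c \<psi>.add \<psi>.scale \<psi>.zero V.gmodule_axioms in auto)
  then have h'c: "h' b \<in> car (coind V)" if "b \<in> car B" for b
    using V.on_SL2_regular that by (simp add: h'_def)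
  have "h' \<in> Hom_G B (coind V)"
    unfolding Hom_G_def using h'c
    by (auto simp: h'_def on_SL2_def fun_eq_iff f.B.act_add f.B.act_scale \<psi>.add \<psi>.scale f.B.act_mult
        f.B.car_add f.B.car_scale)
  moreover have "h' (f x) = h x" if x: "x \<in> car A" for x
  proof
    fix g
    show "h' (f x) g = h x g"
    proof (cases "g \<in> SL2")
      case True
      have "h' (f x) g = l (act A g x)"
        using x True by (simp add: h'_def on_SL2_def \<psi>f flip: f.f_act)
      also have "\<dots> = act (coind V) g (h x) (mat 1)" using x True by (simp add: l_def h.f_act del: coind_simps)
      also have "\<dots> = h x g" by simp
      finally show ?thesis .
    next
      case False
      then show ?thesis using h.f_car[OF x] x by (simp add: h'_def on_SL2_def)
    qed
  qed
  ultimately show ?thesis by blast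
qed

text \<open>A linear map with stable kernel carries the module structure to its image, where the
  action is defined through arbitrary preimages. Quotients and changes of the ambient type are both
  obtained in this way.\<close>

lemma image_module:
  fixes M :: "('k::alg_closed_field, 'v::ab_group_add) gmod" and p :: "'v \<Rightarrow> 'w::ab_group_add"
  assumes "rmodule M" and s: "vector_space s"
    and p0: "\<And>x. x \<notin> car M \<Longrightarrow> p x = 0"
    and padd: "\<And>x y. x \<in> car M \<Longrightarrow> y \<in> car M \<Longrightarrow> p (x + y) = p x + p y"
    and pscale: "\<And>a x. x \<in> car M \<Longrightarrow> p (scl M a x) = s a (p x)"
    and ker: "\<And>g x. g \<in> SL2 \<Longrightarrow> x \<in> car M \<Longrightarrow> p x = 0 \<Longrightarrow> p (act M g x) = 0"
  obtains N where "rational_module N" "scl N = s" "car N = p ` car M" "p \<in> Hom_G M N"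
    "countable_dim M \<Longrightarrow> countable_dim N"
proof -
  interpret M: rmodule M by fact
  interpret W: vector_space s by fact
  define N where "N = \<lparr>scl = s, car = p ` car M, act = (\<lambda>g y. p (act M g (SOME x. x \<in> car M \<and> p x = y)))\<rparr>"
  have N [simp]: "scl N = s" "car N = p ` car M" by (simp_all add: N_def)
  have pact: "act N g (p x) = p (act M g x)" if "g \<in> SL2" "x \<in> car M" for g x
  proof -
    define y where "y = (SOME y. y \<in> car M \<and> p y = p x)"
    have y: "y \<in> car M" "p y = p x"
      using someI[of "\<lambda>y. y \<in> car M \<and> p y = p x" x] that unfolding y_def by auto
    have "p (y - x) + p x = p y" using padd[of "y - x" x] y that by (simp add: M.car_diff)
    then have "p (y - x) = 0" using y by simp
    then have "p (act M g (y - x)) = 0" using ker y that by (simp add: M.car_diff)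
    moreover have "p (act M g y) = p (act M g (y - x)) + p (act M g x)"
      using padd[of "act M g (y - x)" "act M g x"] M.act_add[of g "y - x" x] y that by (simp add: M.car_diff)
    ultimately show ?thesis by (simp add: N_def y_def)
  qed
  have pz: "p 0 = 0" using padd[of 0 0] by simp
  have sub: "W.subspace (car N)"
  proof (rule W.subspaceI)
    show "0 \<in> car N" using pz by (auto intro: image_eqI[of _ _ 0])
    show "x + y \<in> car N" if "x \<in> car N" "y \<in> car N" for x y
      using that padd by (auto simp flip: padd intro!: imageI M.car_add)
    show "s a x \<in> car N" if "x \<in> car N" for a x
      using that by (auto simp flip: pscale intro!: imageI M.car_scale)
  qed
  have gm: "group_module N"
    unfolding group_module_def using sub
    by (auto simp: pact W.vector_space_axioms M.act_one M.act_mult M.act_add M.act_scale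
        M.car_add M.car_scale simp flip: padd pscale)
  interpret N: gmodule N by unfold_locales (rule gm)
  have "regular N (\<lambda>g. act N g y)" if y: "y \<in> car N" for y
  proof -
    obtain x where x: "x \<in> car M" "y = p x" using y by auto
    have "regular N (\<lambda>g. p (act M g x))"
      by (rule M.regular_linear[where h = p, OF M.regular_orbit[OF x(1)] pz N.gmodule_axioms])
        (auto simp: padd pscale)
    then show ?thesis by (rule N.regular_transfer) (simp add: x pact)
  qed
  then have rat: "rational_module N" by (rule N.rational_moduleI)
  have hom: "p \<in> Hom_G M N"
    unfolding Hom_G_def using p0 padd pscale pact by simp
  have "countable_dim N" if cdM: "countable_dim M"
  proof -
    obtain S where S: "countable S" "S \<subseteq> car M" "car M \<subseteq> M.span S"
      using cdM unfolding countable_dim_def by (elim exE conjE) (rule that)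
    have "x \<in> car M \<and> p x \<in> W.span (p ` S)" if "x \<in> M.span S" for x
      using that
    proof (induction rule: M.span_induct_alt)
      case base then show ?case by (simp add: pz W.span_zero)
    next
      case (step a t y)
      then have "t \<in> car M" using S(2) by auto
      moreover have "s a (p t) + p y \<in> W.span (p ` S)"
        using step by (intro W.span_add W.span_scale) (auto intro: W.span_base)
      ultimately show ?case using step by (simp add: padd pscale M.car_scale M.car_add)
    qed
    then have "car N \<subseteq> W.span (p ` S)" using S(3) by auto
    then show ?thesis unfolding countable_dim_def using S by (intro exI[of _ "p ` S"]) auto
  qed
  then show ?thesis using that rat hom by simp
qed

text \<open>Cosets would change the type. Instead a linear endomorphism of the ambient space with
  kernel \<open>W\<close>, obtained by extending a basis of \<open>W\<close>, realizes the quotient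
  on the type of \<open>M\<close>.\<close>

lemma quotient_module:
  fixes M :: "('k::alg_closed_field, 'v::ab_group_add) gmod"
  assumes "rmodule M" and W: "W \<subseteq> car M" "module.subspace (scl M) W"
    "\<And>g w. g \<in> SL2 \<Longrightarrow> w \<in> W \<Longrightarrow> act M g w \<in> W"
  obtains N :: "('k, 'v) gmod" and p where "rational_module N" "p \<in> Hom_G M N" "p ` car M = car N"
    "\<And>x. x \<in> car M \<Longrightarrow> p x = 0 \<longleftrightarrow> x \<in> W" "countable_dim M \<Longrightarrow> countable_dim N"
proof -
  interpret M: rmodule M by fact
  interpret vp: vector_space_pair "scl M" "scl M" by unfold_locales
  obtain B where B: "B \<subseteq> W" "M.independent B" "W \<subseteq> M.span B"
    using M.maximal_independent_subset by metis
  have WB: "M.span B = W" using B M.span_minimal[OF B(1) W(2)] by auto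
  define C where "C = M.extend_basis B"
  have C: "B \<subseteq> C" "M.independent C" "M.span C = UNIV"
    using M.extend_basis_superset[OF B(2)] M.independent_extend_basis[OF B(2)] M.span_extend_basis[OF B(2)]
    by (auto simp: C_def)
  obtain q where q: "Vector_Spaces.linear (scl M) (scl M) q" "\<And>x. x \<in> C \<Longrightarrow> q x = (if x \<in> B then 0 else x)"
    using vp.linear_independent_extend[OF C(2), of "\<lambda>x. if x \<in> B then 0 else x"] by blast
  interpret q: Vector_Spaces.linear "scl M" "scl M" q by fact
  have qW: "q x = 0" if "x \<in> W" for x
  proof -
    have "x \<in> M.span B" using that WB by simp
    then show ?thesis
      by (induction rule: M.span_induct_alt) (use C(1) q(2) in \<open>auto simp: q.zero q.add q.scale\<close>)
  qed
  have "x - q x \<in> M.span B" if "x \<in> M.span C" for x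
    using that
  proof (induction rule: M.span_induct_alt)
    case base then show ?case by (simp add: q.zero M.span_zero)
  next
    case (step a s y)
    have "s - q s \<in> M.span B" using q(2)[OF step(1)] by (auto simp: M.span_zero M.span_base)
    from M.span_add[OF M.span_scale[OF this, of a] step(2)]
    show ?case by (simp add: q.add q.scale M.scale_right_diff_distrib algebra_simps)
  qed
  then have qker: "x \<in> W" if "q x = 0" for x using that C(3) WB by (metis UNIV_I diff_zero)
  define p where "p x = (if x \<in> car M then q x else 0)" for x
  have ker: "p x = 0 \<longleftrightarrow> x \<in> W" if "x \<in> car M" for x using that qker qW by (auto simp: p_def)
  obtain N where N: "rational_module N" "scl N = scl M" "car N = p ` car M" "p \<in> Hom_G M N"
    "countable_dim M \<Longrightarrow> countable_dim N"
  proof (rule image_module[of M "scl M" p])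
    show "p (act M g x) = 0" if "g \<in> SL2" "x \<in> car M" "p x = 0" for g x
      using that ker W by (auto simp: ker)
  qed (auto simp: assms p_def q.add q.scale M.car_add M.car_scale M.vector_space_axioms)
  show ?thesis by (rule that[OF N(1) N(4) _ ker N(5)]) (auto simp: N(3))
qed

text \<open>Coordinates with respect to a countable basis, indexed through an injection into
  \<open>'i\<close>. This brings coinduced modules to the type on which injectivity is
  tested.\<close>

lemma transport_module:
  fixes M :: "('k::alg_closed_field, 'v::ab_group_add) gmod"
  assumes "rmodule M" and cd: "countable_dim M"
  obtains N :: "('k, 'i::infinite \<Rightarrow> 'k) gmod" and f where "rational_module N" "countable_dim N"
    "f \<in> Hom_G M N" "bij_betw f (car M) (car N)"
proof -
  interpret M: rmodule M by fact
  obtain S where S: "countable S" "S \<subseteq> car M" "car M \<subseteq> M.span S"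
    using cd by (auto simp: countable_dim_def)
  obtain B where B: "B \<subseteq> S" "M.independent B" "S \<subseteq> M.span B"
    using M.maximal_independent_subset by metis
  have cB: "countable B" using B(1) S(1) by (rule countable_subset)
  have MB: "x \<in> M.span B" if "x \<in> car M" for x
    using that S(3) B(3) M.span_minimal[OF B(3) M.subspace_span] by auto
  obtain e0 :: "nat \<Rightarrow> 'i" where e0: "inj e0"
    using infinite_countable_subset[OF infinite_UNIV] by blast
  define e where "e b = e0 (to_nat_on B b)" for b
  have e: "inj_on e B"
    using inj_on_to_nat_on[OF cB] e0 by (auto simp: e_def inj_on_def)
  define f where "f x = (if x \<in> car M then (\<lambda>i. if i \<in> e ` B then M.representation B x (inv_into B e i) else 0) else 0)" for x
  have vs: "vector_space (\<lambda>(a::'k) (y::'i \<Rightarrow> 'k) i. a * y i)"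
    by unfold_locales (auto simp: algebra_simps)
  have fe: "f x (e b) = M.representation B x b" if "x \<in> car M" "b \<in> B" for x b
    using that e by (simp add: f_def)
  have finj: "x = y" if "x \<in> car M" "y \<in> car M" "f x = f y" for x y
  proof -
    have eq: "M.representation B x = M.representation B y"
    proof
      fix b
      show "M.representation B x b = M.representation B y b"
      proof (cases "b \<in> B")
        case True
        then show ?thesis using fe[OF that(1) True] fe[OF that(2) True] that(3) by simp
      next
        case False
        then show ?thesis
          using M.representation_ne_zero[of B x b] M.representation_ne_zero[of B y b] by metis
      qed
    qed
    show ?thesis
      using M.sum_nonzero_representation_eq[OF B(2) MB[OF that(1)]]
      unfolding eq M.sum_nonzero_representation_eq[OF B(2) MB[OF that(2)]] by (rule sym)
  qed
  have fadd: "f (x + y) = f x + f y" if "x \<in> car M" "y \<in> car M" for x y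
    using that by (auto simp: f_def fun_eq_iff M.car_add M.representation_add[OF B(2)] MB)
  have fscale: "f (scl M a x) = (\<lambda>i. a * f x i)" if "x \<in> car M" for a x
    using that by (auto simp: f_def fun_eq_iff M.car_scale M.representation_scale[OF B(2)] MB)
  have f0: "f 0 = 0" using fadd[of 0 0] by simp
  obtain N where N: "rational_module N" "scl N = (\<lambda>(a::'k) (y::'i \<Rightarrow> 'k) i. a * y i)" "car N = f ` car M"
    "f \<in> Hom_G M N" "countable_dim M \<Longrightarrow> countable_dim N"
  proof (rule image_module[OF assms(1) vs, of f])
    show "f (act M g x) = 0" if "g \<in> SL2" "x \<in> car M" "f x = 0" for g x
      using finj[of x 0] that f0 by (simp add: M.act_zero)
  qed (use fadd fscale in \<open>auto simp: f_def\<close>)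
  show ?thesis
    by (rule that[OF N(1) N(5)[OF cd] N(4)]) (use finj N(3) in \<open>auto simp: bij_betw_def inj_on_def\<close>)
qed

lemma Hom_inverse:
  fixes M :: "('k::alg_closed_field, 'v::ab_group_add) gmod"
  assumes "rmodule M" "rmodule N" "f \<in> Hom_G M N" "bij_betw f (car M) (car N)"
  obtains f' where "f' \<in> Hom_G N M" "\<And>x. x \<in> car M \<Longrightarrow> f' (f x) = x" "\<And>y. y \<in> car N \<Longrightarrow> f (f' y) = y"
proof -
  interpret f: ghom M N f using assms by (simp add: ghom_def ghom_axioms_def)
  define f' where "f' y = (if y \<in> car N then inv_into (car M) f y else 0)" for y
  have im: "f ` car M = car N" and inj: "inj_on f (car M)" using assms(4) by (auto simp: bij_betw_def)
  have 1: "f' (f x) = x" if "x \<in> car M" for x using that inj by (simp add: f'_def)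
  have 2: "f' y \<in> car M" "f (f' y) = y" if "y \<in> car N" for y
    using that im by (auto simp: f'_def inv_into_into f_inv_into_f)
  have eq: "x = y" if "x \<in> car M" "y \<in> car M" "f x = f y" for x y using that inj by (auto dest: inj_onD)
  have "f' \<in> Hom_G N M"
    unfolding Hom_G_def
  proof (intro CollectI conjI ballI allI impI)
    show "f' y = 0" if "y \<notin> car N" for y using that by (simp add: f'_def)
  next
    fix x y assume "x \<in> car N" "y \<in> car N"
    then show "f' (x + y) = f' x + f' y"
      by (intro eq) (auto simp: 2 f.f_add f.B.car_add f.A.car_add)
  next
    fix a x assume "x \<in> car N"
    then show "f' (scl N a x) = scl M a (f' x)"
      by (intro eq) (auto simp: 2 f.f_scale f.B.car_scale f.A.car_scale)
  next
    fix g :: "'k ^ 2 ^ 2" and x assume "g \<in> SL2" "x \<in> car N"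
    then show "f' (act N g x) = act M g (f' x)"
      by (intro eq) (auto simp: 2 f.f_act)
  qed (rule 2)
  then show ?thesis using that 1 2 by blast
qed

section \<open>Contracting cocycles\<close>

lemma bit_add_power2:
  assumes "\<not> bit (s::nat) i" shows "bit (s + 2 ^ i) j \<longleftrightarrow> bit s j \<or> j = i"
proof -
  have "and s (2 ^ i) = 0"
    by (rule bit_eqI) (use assms in \<open>auto simp: bit_and_iff bit_exp_iff\<close>)
  then show ?thesis by (auto simp: disjunctive_add_eq_or bit_or_iff bit_exp_iff)
qed

lemma bit_obtain_add:
  assumes "bit (s::nat) i" obtains r where "s = r + 2 ^ i" "\<not> bit r i"
proof -
  have "2 ^ i \<le> s" using assms by (metis bit_iff_odd div_less dvd_0_right not_less)
  then obtain r where "s = r + 2 ^ i" by (metis le_add_diff_inverse2)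
  with assms show ?thesis by (intro that[of r]) (simp_all add: bit_add_power2_same)
qed

text \<open>
  The divided power algebra in one variable is a tensor product of exterior algebras, one for
  every binary digit, so that the complex computing the cohomology of the additive group is
  a tensor product of Koszul complexes. The contraction acts on the first nontrivial factor.
\<close>

definition low_index :: "nat \<Rightarrow> nat multiset \<Rightarrow> nat" where
  "low_index s \<nu> = (LEAST i. bit s i \<or> i \<in># \<nu>)"

definition contraction :: "(nat multiset \<Rightarrow> nat \<Rightarrow> 'v::zero) \<Rightarrow> nat multiset \<Rightarrow> nat \<Rightarrow> 'v" where
  "contraction \<kappa> \<nu> s = (let i = low_index s \<nu> in
     if bit s i then \<kappa> (add_mset i \<nu>) (s - 2 ^ i) else 0)"

text \<open>The sums are the differential in coordinates: by \<open>upper_cell_fun\<close> the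
  divided power of index \<open>2 ^ i\<close> moves the coefficient at \<open>s + 2 ^ i\<close> to
  \<open>s\<close> if digit \<open>i\<close> of \<open>s\<close> is clear, and gives 0 otherwise.
  Passing to \<open>\<nu> - {#j#}\<close> and \<open>s + 2 ^ j\<close> does not change
  \<open>low_index\<close>, so the identity splits into the two cases of a single Koszul
  factor.\<close>

lemma contraction_homotopy:
  fixes \<kappa> :: "nat multiset \<Rightarrow> nat \<Rightarrow> 'v::ab_group_add"
  assumes two: "\<And>v::'v. v + v = 0"
    and closed: "\<And>\<nu> s. (\<Sum>i\<in>{i \<in> set_mset \<nu>. \<not> bit s i}. \<kappa> (\<nu> - {#i#}) (s + 2 ^ i)) = 0"
    and \<nu>: "\<nu> \<noteq> {#}"
  shows "(\<Sum>i\<in>{i \<in> set_mset \<nu>. \<not> bit s i}. contraction \<kappa> (\<nu> - {#i#}) (s + 2 ^ i)) = \<kappa> \<nu> s"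
proof -
  define i where "i = low_index s \<nu>"
  define J where "J = {j \<in> set_mset \<nu>. \<not> bit s j}"
  have fJ: "finite J" by (simp add: J_def)
  have i: "bit s i \<or> i \<in># \<nu>"
    unfolding i_def low_index_def by (rule LeastI_ex) (use \<nu> in auto)
  have low: "low_index (s + 2 ^ j) (\<nu> - {#j#}) = i" if "j \<in> J" for j
  proof -
    have "bit (s + 2 ^ j) k \<or> k \<in># \<nu> - {#j#} \<longleftrightarrow> bit s k \<or> k \<in># \<nu>" for k
      using that by (auto simp: J_def bit_add_power2 in_diff_count dest: in_diffD)
    then show ?thesis by (simp add: low_index_def i_def)
  qed
  show ?thesis
  proof (cases "bit s i")
    case False
    then have iJ: "i \<in> J" using i by (simp add: J_def)
    \<comment> \<open>Digit \<open>i\<close> of \<open>s + 2 ^ j\<close> is set only for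
      \<open>j = i\<close>, and then the contraction undoes the shift.\<close>
    have "contraction \<kappa> (\<nu> - {#j#}) (s + 2 ^ j) = (if j = i then \<kappa> \<nu> s else 0)" if j: "j \<in> J" for j
    proof -
      have "\<not> bit s j" "j \<in># \<nu>" using j by (auto simp: J_def)
      then show ?thesis using False by (auto simp: contraction_def low[OF j] Let_def bit_add_power2)
    qed
    then have "(\<Sum>j\<in>J. contraction \<kappa> (\<nu> - {#j#}) (s + 2 ^ j)) = (\<Sum>j\<in>J. if j = i then \<kappa> \<nu> s else 0)"
      by simp
    also have "\<dots> = \<kappa> \<nu> s" using iJ fJ by simp
    finally show ?thesis by (simp add: J_def)
  next
    case True
    then obtain r where r: "s = r + 2 ^ i" "\<not> bit r i" by (rule bit_obtain_add)
    have bs: "bit s j \<longleftrightarrow> bit r j \<or> j = i" for j using r bit_add_power2 by metis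
    have "contraction \<kappa> (\<nu> - {#j#}) (s + 2 ^ j) = \<kappa> (add_mset i \<nu> - {#j#}) (r + 2 ^ j)" if j: "j \<in> J" for j
    proof -
      have nj: "\<not> bit s j" "j \<noteq> i" using j True by (auto simp: J_def)
      have "contraction \<kappa> (\<nu> - {#j#}) (s + 2 ^ j) = \<kappa> (add_mset i (\<nu> - {#j#})) (s + 2 ^ j - 2 ^ i)"
        using True nj by (simp add: contraction_def low[OF j] Let_def bit_add_power2)
      also have "s + 2 ^ j - 2 ^ i = r + 2 ^ j" using r(1) by simp
      also have "add_mset i (\<nu> - {#j#}) = add_mset i \<nu> - {#j#}" using nj by simp
      finally show ?thesis .
    qed
    then have "(\<Sum>j\<in>J. contraction \<kappa> (\<nu> - {#j#}) (s + 2 ^ j)) =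
        (\<Sum>j\<in>J. \<kappa> (add_mset i \<nu> - {#j#}) (r + 2 ^ j))" by (rule sum.cong[OF refl])
    moreover have J: "{j \<in> set_mset (add_mset i \<nu>). \<not> bit r j} = insert i J"
      using r(2) by (auto simp: J_def bs)
    \<comment> \<open>This is \<open>closed\<close> at \<open>add_mset i \<nu>\<close> and
      \<open>r\<close>: the term for \<open>i\<close> is \<open>\<kappa> \<nu> s\<close>, the others
      form the wanted sum, and signs do not matter by \<open>two\<close>.\<close>
    have "(\<Sum>j\<in>insert i J. \<kappa> (add_mset i \<nu> - {#j#}) (r + 2 ^ j)) = 0"
      unfolding J[symmetric] by (rule closed)
    moreover have "i \<notin> J" using True by (simp add: J_def)
    ultimately have eq: "\<kappa> \<nu> s + (\<Sum>j\<in>J. contraction \<kappa> (\<nu> - {#j#}) (s + 2 ^ j)) = 0"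
      using fJ r(1) by simp
    have "(\<Sum>j\<in>J. contraction \<kappa> (\<nu> - {#j#}) (s + 2 ^ j)) = - \<kappa> \<nu> s"
      using minus_unique[OF eq] by simp
    also have "\<dots> = \<kappa> \<nu> s" using minus_unique[OF two] .
    finally have "(\<Sum>j\<in>J. contraction \<kappa> (\<nu> - {#j#}) (s + 2 ^ j)) = \<kappa> \<nu> s" .
    then show ?thesis by (simp add: J_def)
  qed
qed

section \<open>Truncation to nonnegative weights and functions on the big cell\<close>

context rmodule
begin

text \<open>Density of the big cell: if the upper left entry of \<open>g\<close> is 0, the curve
  \<open>upper t ** g\<close> lies in the cell for all nonzero \<open>t\<close> and reaches
  \<open>g\<close> at 0.\<close>

lemma regular_vanish:
  assumes f: "regular M f" and z: "\<And>g. g \<in> SL2 \<Longrightarrow> g $ 1 $ 1 \<noteq> 0 \<Longrightarrow> f g = 0" and g: "g \<in> SL2"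
  shows "f g = 0"
proof (cases "g $ 1 $ 1 = 0")
  case True
  then have c: "g $ 2 $ 1 \<noteq> 0" using g by (auto simp: SL2_iff)
  let ?\<gamma> = "\<lambda>t. upper t ** g"
  obtain w N where w: "\<forall>n>N. w n = 0" "\<forall>t. f (?\<gamma> t) = (\<Sum>n\<le>N. scl M (t ^ n) (w n))"
    using regular_curve[OF f polynomial_curve_mult[OF polynomial_curve_upper g]]
    by (elim exE conjE) (rule that)
  have "f (?\<gamma> t) = 0" if "t \<noteq> 0" for t
    by (rule z) (use g c True that in \<open>auto simp: mult_nth2 upper_def\<close>)
  then have "(\<Sum>n\<le>N. scl M (t ^ n) (w n)) = 0" if "t \<noteq> 0" for t
    using w(2)[rule_format, of t] that by simp
  then have "w n = 0" if "n \<le> N" for n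
    using nat_coeffs_zero[OF inf, where N = N and v = w and n = n] that by simp
  then have "f (?\<gamma> 0) = 0" using w(2)[rule_format, of 0] by simp
  moreover have "?\<gamma> 0 = g" by (simp add: upper_def mat2_one[symmetric])
  ultimately show ?thesis by simp
qed (use z g in simp)

definition pos_part :: "'v \<Rightarrow> 'v" where
  "pos_part v = (\<Sum>n\<in>{n. 0 \<le> n \<and> wt_part M n v \<noteq> 0}. wt_part M n v)"

lemma pos_part_eq:
  assumes "finite A" "\<And>n. n \<notin> A \<Longrightarrow> wt_part M n v = 0"
  shows "pos_part v = (\<Sum>n\<in>{n \<in> A. 0 \<le> n}. wt_part M n v)"
  unfolding pos_part_def by (rule sum.mono_neutral_left) (use assms in auto)

lemma finite_wt_support:
  assumes "v \<in> car M" shows "finite {n. wt_part M n v \<noteq> 0}"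
proof -
  obtain A where "finite A" "\<And>n. n \<notin> A \<Longrightarrow> wt_part M n v = 0"
    by (rule wt_part_decomp[OF assms]) blast
  then show ?thesis by (auto intro: finite_subset[of _ A])
qed

lemma pos_part_add:
  assumes "v \<in> car M" "w \<in> car M" shows "pos_part (v + w) = pos_part v + pos_part w"
proof -
  let ?A = "{n. wt_part M n v \<noteq> 0} \<union> {n. wt_part M n w \<noteq> 0}"
  have A: "finite ?A" using assms finite_wt_support by simp
  have "pos_part v = (\<Sum>n\<in>{n \<in> ?A. 0 \<le> n}. wt_part M n v)"
    "pos_part w = (\<Sum>n\<in>{n \<in> ?A. 0 \<le> n}. wt_part M n w)"
    "pos_part (v + w) = (\<Sum>n\<in>{n \<in> ?A. 0 \<le> n}. wt_part M n (v + w))"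
    by (rule pos_part_eq[OF A]; use assms in \<open>auto simp: wt_part_add\<close>)+
  then show ?thesis using assms by (simp add: wt_part_add sum.distrib)
qed

lemma pos_part_scale:
  assumes "v \<in> car M" shows "pos_part (scl M a v) = scl M a (pos_part v)"
proof -
  let ?A = "{n. wt_part M n v \<noteq> 0}"
  have A: "finite ?A" using assms finite_wt_support by simp
  have "pos_part v = (\<Sum>n\<in>{n \<in> ?A. 0 \<le> n}. wt_part M n v)"
    "pos_part (scl M a v) = (\<Sum>n\<in>{n \<in> ?A. 0 \<le> n}. wt_part M n (scl M a v))"
    by (rule pos_part_eq[OF A]; use assms in \<open>auto simp: wt_part_scale\<close>)+
  then show ?thesis using assms by (simp add: wt_part_scale scale_sum_right)
qed

lemma pos_part_car [intro]: "v \<in> car M \<Longrightarrow> pos_part v \<in> car M"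
  unfolding pos_part_def by (intro car_sum) simp

lemma pos_part_zero [simp]: "pos_part 0 = 0"
  using pos_part_scale[of 0 0] by simp

lemma pos_part_sum: "(\<And>i. i \<in> I \<Longrightarrow> f i \<in> car M) \<Longrightarrow> pos_part (sum f I) = (\<Sum>i\<in>I. pos_part (f i))"
  by (induction I rule: infinite_finite_induct) (simp_all add: pos_part_add car_sum)

lemma pos_part_weight:
  assumes "v \<in> weight_space M n" shows "pos_part v = (if 0 \<le> n then v else 0)"
proof -
  have "pos_part v = (\<Sum>m\<in>{m \<in> {n}. 0 \<le> m}. wt_part M m v)"
    by (rule pos_part_eq) (use assms in \<open>auto simp: wt_part_of_weight\<close>)
  also have "{m \<in> {n}. 0 \<le> m} = (if 0 \<le> n then {n} else {})" by auto
  finally show ?thesis using assms by (simp add: wt_part_of_weight split: if_splits)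
qed

lemma wt_part_pos_part:
  assumes "v \<in> car M" "0 \<le> n" shows "wt_part M n (pos_part v) = wt_part M n v"
proof -
  let ?A = "{n. 0 \<le> n \<and> wt_part M n v \<noteq> 0}"
  have "finite ?A" using finite_wt_support[OF assms(1)] by (rule finite_subset[rotated]) auto
  have "wt_part M n (pos_part v) = (\<Sum>m\<in>?A. wt_part M n (wt_part M m v))"
    unfolding pos_part_def using assms by (subst wt_part_sum) auto
  also have "\<dots> = (\<Sum>m\<in>?A. if m = n then wt_part M m v else 0)"
    by (rule sum.cong) (use wt_part_of_weight[OF wt_part_weight_space[OF assms(1)]] in auto)
  also have "\<dots> = wt_part M n v" using \<open>finite ?A\<close> assms(2) by auto
  finally show ?thesis .
qed

lemma wt_part_swap:
  assumes v: "v \<in> car M" shows "wt_part M n (act M swap v) = act M swap (wt_part M (- n) v)"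
proof -
  obtain A where A: "finite A" "\<And>n. n \<notin> A \<Longrightarrow> wt_part M n v = 0" "v = (\<Sum>n\<in>A. wt_part M n v)"
    by (rule wt_part_decomp[OF v]) blast
  have "act M swap v = (\<Sum>m\<in>A. act M swap (wt_part M m v))"
    using v by (subst A(3), subst act_sum) auto
  then have "wt_part M n (act M swap v) = (\<Sum>m\<in>A. wt_part M n (act M swap (wt_part M m v)))"
    using v by (simp add: wt_part_sum)
  also have "\<dots> = (\<Sum>m\<in>A. if m = - n then act M swap (wt_part M (- n) v) else 0)"
    by (rule sum.cong) (use wt_part_of_weight[OF swap_weight[OF wt_part_weight_space[OF v]]] in auto)
  also have "\<dots> = act M swap (wt_part M (- n) v)" using A(1,2) by (auto simp: act_zero)
  finally show ?thesis .
qed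

text \<open>The equivariant map that Frobenius reciprocity attaches to the merely linear map
  \<open>pos_part\<close>.\<close>

definition pos_map :: "'v \<Rightarrow> 'k ^ 2 ^ 2 \<Rightarrow> 'v" where
  "pos_map v = (if v \<in> car M then on_SL2 (\<lambda>h. pos_part (act M h v)) else 0)"

lemma regular_pos_part: "v \<in> car M \<Longrightarrow> regular M (\<lambda>h. pos_part (act M h v))"
  by (rule regular_linear[where h = pos_part, OF regular_orbit])
    (auto simp: pos_part_add pos_part_scale gmodule_axioms)

lemma Hom_pos_map: "pos_map \<in> Hom_G M (coind M)"
proof -
  have "pos_map v \<in> car (coind M)" if "v \<in> car M" for v
    using on_SL2_regular[OF regular_pos_part[OF that]] that by (simp add: pos_map_def)
  then show ?thesis
    unfolding Hom_G_def
    by (auto simp: pos_map_def on_SL2_def fun_eq_iff act_add act_scale act_mult car_add car_scale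
        pos_part_add pos_part_scale)
qed

text \<open>The value at the identity determines the parts of nonnegative weight, and the value at
  \<open>swap\<close> those of nonpositive weight.\<close>

lemma inj_pos_map: "inj_on pos_map (car M)"
proof
  fix v w assume v: "v \<in> car M" and w: "w \<in> car M" and eq: "pos_map v = pos_map w"
  have h: "pos_part (act M h v) = pos_part (act M h w)" if "h \<in> SL2" for h
    using fun_cong[OF eq, of h] that v w by (simp add: pos_map_def on_SL2_def)
  have "wt_part M n v = wt_part M n w" for n
  proof (cases "0 \<le> n")
    case True
    have "pos_part v = pos_part w" using h[of "mat 1"] v w by (simp add: act_one)
    then show ?thesis using wt_part_pos_part[OF v True] wt_part_pos_part[OF w True] by simp
  next
    case False
    then have n: "0 \<le> - n" by simp
    have "wt_part M (- n) (act M swap v) = wt_part M (- n) (act M swap w)"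
      using wt_part_pos_part[OF _ n, of "act M swap v"] wt_part_pos_part[OF _ n, of "act M swap w"]
        h[of swap] v w by simp
    then have "act M swap (wt_part M n v) = act M swap (wt_part M n w)"
      using v w by (simp add: wt_part_swap)
    then show ?thesis using act_inj[of swap] v w by simp
  qed
  note wt = this
  obtain A where A: "finite A" "\<And>n. n \<notin> A \<Longrightarrow> wt_part M n v = 0" "v = (\<Sum>n\<in>A. wt_part M n v)"
    by (rule wt_part_decomp[OF v]) blast
  obtain B where B: "finite B" "\<And>n. n \<notin> B \<Longrightarrow> wt_part M n w = 0" "w = (\<Sum>n\<in>B. wt_part M n w)"
    by (rule wt_part_decomp[OF w]) blast
  have "v = (\<Sum>n\<in>A. wt_part M n v)" by (rule A(3))
  also have "\<dots> = (\<Sum>n\<in>A \<union> B. wt_part M n v)"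
    by (rule sum.mono_neutral_left) (use A(1,2) B(1) in auto)
  also have "\<dots> = (\<Sum>n\<in>A \<union> B. wt_part M n w)" by (simp only: wt)
  also have "\<dots> = (\<Sum>n\<in>B. wt_part M n w)"
    by (rule sum.mono_neutral_right) (use A(1) B(1,2) in auto)
  also have "\<dots> = w" by (rule B(3)[symmetric])
  finally show "v = w" .
qed

text \<open>
  Under \<open>cell_coeffs N w \<kappa>\<close> the exponent \<open>w + s - r\<close> is nonnegative whenever \<open>\<kappa> s r \<noteq> 0\<close>, so the
  truncation by \<open>nat\<close> is harmless and all terms have weight \<open>w\<close> for the right action of the torus.
\<close>

definition cell_fun :: "nat \<Rightarrow> int \<Rightarrow> (nat \<Rightarrow> nat \<Rightarrow> 'v) \<Rightarrow> 'k ^ 2 ^ 2 \<Rightarrow> 'v" where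
  "cell_fun N w \<kappa> = on_SL2 (\<lambda>h. \<Sum>s\<le>N. \<Sum>r\<le>N.
     scl M (h $ 1 $ 1 ^ nat (w + int s - int r) * h $ 1 $ 2 ^ s * h $ 2 $ 1 ^ r) (\<kappa> s r))"

definition cell_coeffs :: "nat \<Rightarrow> int \<Rightarrow> (nat \<Rightarrow> nat \<Rightarrow> 'v) \<Rightarrow> bool" where
  "cell_coeffs N w \<kappa> \<longleftrightarrow> (\<forall>s r. \<kappa> s r \<in> car M \<and> (s > N \<or> r > N \<longrightarrow> \<kappa> s r = 0) \<and>
     (\<kappa> s r \<noteq> 0 \<longrightarrow> int r \<le> w + int s))"

lemma cell_coeffsD: "cell_coeffs N w \<kappa> \<Longrightarrow> \<kappa> s r \<noteq> 0 \<Longrightarrow> int r \<le> w + int s"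
  by (auto simp: cell_coeffs_def)

lemma cell_fun_car:
  assumes "cell_coeffs N w \<kappa>" shows "cell_fun N w \<kappa> \<in> car (coind M)"
  unfolding cell_fun_def
proof (intro on_SL2_regular regular_sum regular_tensor)
  show "\<kappa> s r \<in> car M" for s r using assms by (simp add: cell_coeffs_def)
qed (intro polynomial_fun.mult polynomial_fun_power polynomial_fun.coord)+

text \<open>Right translation by the torus multiplies the first column by \<open>t\<close> and the
  second by its inverse, so each term gets the exponent (w + s - r) - s + r = w.\<close>

lemma cell_fun_weight:
  assumes \<kappa>: "cell_coeffs N w \<kappa>" shows "cell_fun N w \<kappa> \<in> weight_space (coind M) w"
proof -
  have "act (coind M) (torus t) (cell_fun N w \<kappa>) = scl (coind M) (t powi w) (cell_fun N w \<kappa>)"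
    if t: "t \<noteq> 0" for t
  proof
    fix h
    show "act (coind M) (torus t) (cell_fun N w \<kappa>) h = scl (coind M) (t powi w) (cell_fun N w \<kappa>) h"
    proof (cases "h \<in> SL2")
      case h: True
      have "scl M ((h $ 1 $ 1 * t) ^ nat (w + int s - int r) * (h $ 1 $ 2 * inverse t) ^ s * (h $ 2 $ 1 * t) ^ r) (\<kappa> s r) =
          scl M (t powi w) (scl M (h $ 1 $ 1 ^ nat (w + int s - int r) * h $ 1 $ 2 ^ s * h $ 2 $ 1 ^ r) (\<kappa> s r))" for s r
      proof (cases "\<kappa> s r = 0")
        case False
        then have "int r \<le> w + int s" using \<kappa> by (simp add: cell_coeffs_def)
        then obtain k where k: "w + int s = int k + int r" by (metis zle_iff_zadd add.commute)
        then have nk: "nat (w + int s - int r) = k" by simp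
        have "t powi w * t ^ s = t ^ k * t ^ r"
          using t k power_int_add[of t w "int s"] power_int_add[of t "int k" "int r"] by simp
        then have "t powi w = t ^ k * t ^ r * inverse t ^ s"
          using t by (simp add: field_simps)
        then show ?thesis unfolding nk by (simp add: power_mult_distrib mult_ac)
      qed simp
      then show ?thesis using h t
        by (simp add: cell_fun_def on_SL2_def mult_nth2 torus_mat2 scale_sum_right del: scale_scale)
    qed (simp add: cell_fun_def on_SL2_def)
  qed
  then show ?thesis using cell_fun_car[OF \<kappa>] by (simp add: weight_space_def del: coind_simps)
qed

text \<open>Right translation by \<open>upper t\<close> keeps the first column and replaces b by a t
  + b in the first row; the binomial theorem then gives the coefficient of \<open>t ^ k\<close>. The
  added factor a^k accounts for the new weight.\<close>

lemma upper_cell_fun: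
  assumes \<kappa>: "cell_coeffs N w \<kappa>"
  shows "div_pow (coind M) upper k (cell_fun N w \<kappa>) =
    cell_fun N (w + 2 * int k) (\<lambda>s r. scl M (of_nat ((s + k) choose k)) (\<kappa> (s + k) r))"
proof -
  interpret J: rmodule "coind M" by (rule rmoduleI[OF rational_coind])
  let ?w = "\<lambda>k. cell_fun N (w + 2 * int k) (\<lambda>s r. scl M (of_nat ((s + k) choose k)) (\<kappa> (s + k) r))"
  show ?thesis
  proof (rule J.div_pow_eqI[where N = N])
    show "?w n = 0" if "n > N" for n
      using \<kappa> that by (auto simp: cell_fun_def on_SL2_def cell_coeffs_def fun_eq_iff)
    fix t :: 'k
    show "act (coind M) (upper t) (cell_fun N w \<kappa>) = (\<Sum>n\<le>N. scl (coind M) (t ^ n) (?w n))"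
    proof
      fix h
      show "act (coind M) (upper t) (cell_fun N w \<kappa>) h = (\<Sum>n\<le>N. scl (coind M) (t ^ n) (?w n)) h"
      proof (cases "h \<in> SL2")
        case h: True
        define a b c where "a = h $ 1 $ 1" and "b = h $ 1 $ 2" and "c = h $ 2 $ 1"
        define e where "e s r = nat (w + int s - int r)" for s r
        define g where "g r k s = scl M (of_nat ((s + k) choose k) * t ^ k * a ^ (e (s + k) r + k) * b ^ s * c ^ r) (\<kappa> (s + k) r)" for r k s
        have "(\<Sum>s\<le>N. scl M (a ^ e s r * (a * t + b) ^ s * c ^ r) (\<kappa> s r)) = (\<Sum>k\<le>N. \<Sum>s\<le>N. g r k s)" for r
        proof -
          have "(\<Sum>s\<le>N. scl M (a ^ e s r * (a * t + b) ^ s * c ^ r) (\<kappa> s r)) =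
              (\<Sum>s\<le>N. \<Sum>k\<le>s. g r k (s - k))"
            by (rule sum.cong)
              (auto simp: g_def binomial_ring sum_distrib_left sum_distrib_right scale_sum_left power_mult_distrib
                power_add mult_ac intro!: sum.cong)
          also have "\<dots> = (\<Sum>(k, s)\<in>{(k, s). k + s \<le> N}. g r k s)"
            by (rule sum.triangle_reindex_eq[symmetric])
          also have "\<dots> = (\<Sum>(k, s)\<in>{..N} \<times> {..N}. g r k s)"
          \<comment> \<open>The triangle of index pairs may be enlarged to a square because the
            coefficients vanish beyond \<open>N\<close>.\<close>
          proof (rule sum.mono_neutral_left)
            show "\<forall>p\<in>{..N} \<times> {..N} - {(k, s). k + s \<le> N}. (case p of (k, s) \<Rightarrow> g r k s) = 0"
            proof
              fix p assume p: "p \<in> {..N} \<times> {..N} - {(k, s). k + s \<le> N}"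
              obtain k s where ks: "p = (k, s)" by (cases p)
              have "\<kappa> (s + k) r = 0" using \<kappa> p ks by (simp add: cell_coeffs_def)
              then show "(case p of (k, s) \<Rightarrow> g r k s) = 0" by (simp add: g_def ks)
            qed
          qed auto
          also have "\<dots> = (\<Sum>k\<le>N. \<Sum>s\<le>N. g r k s)" by (rule sum.cartesian_product[symmetric])
          finally show ?thesis .
        qed
        then have "act (coind M) (upper t) (cell_fun N w \<kappa>) h = (\<Sum>r\<le>N. \<Sum>k\<le>N. \<Sum>s\<le>N. g r k s)"
          using h by (simp add: cell_fun_def on_SL2_def mult_nth2 upper_def a_def b_def c_def e_def)
            (subst sum.swap, simp)
        also have "\<dots> = (\<Sum>k\<le>N. \<Sum>s\<le>N. \<Sum>r\<le>N. g r k s)"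
          by (subst sum.swap, rule sum.cong, simp, subst sum.swap, simp)
        also have "\<dots> = (\<Sum>n\<le>N. scl (coind M) (t ^ n) (?w n)) h"
          unfolding sum_fun_apply
        proof (rule sum.cong)
          fix k
          have eq: "g r k s = scl M (t ^ k) (scl M (a ^ nat (w + 2 * int k + int s - int r) * b ^ s * c ^ r)
            (scl M (of_nat ((s + k) choose k)) (\<kappa> (s + k) r)))" for r s
          proof (cases "\<kappa> (s + k) r = 0")
            case False
            then have "int r \<le> w + int (s + k)" by (rule cell_coeffsD[OF \<kappa>])
            then have "nat (w + 2 * int k + int s - int r) = e (s + k) r + k" by (simp add: e_def)
            then show ?thesis by (simp add: g_def mult_ac)
          qed (simp add: g_def)
          have wk: "?w k h = (\<Sum>s\<le>N. \<Sum>r\<le>N. scl M (a ^ nat (w + 2 * int k + int s - int r) * b ^ s * c ^ r)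
            (scl M (of_nat ((s + k) choose k)) (\<kappa> (s + k) r)))"
            using h by (simp only: cell_fun_def on_SL2_def a_def b_def c_def if_True)
          show "(\<Sum>s\<le>N. \<Sum>r\<le>N. g r k s) = scl (coind M) (t ^ k) (?w k) h"
            unfolding coind_simps wk scale_sum_right by (intro sum.cong refl) (rule eq)
        qed simp
        finally show ?thesis .
      next
        case False
        then show ?thesis
          by (simp only: sum_fun_apply coind_simps cell_fun_def on_SL2_def if_False scale_zero_right sum.neutral_const)
      qed
    qed
  qed (rule cell_fun_car[OF \<kappa>], rule polynomial_curve_upper)
qed

text \<open>The vector has weight \<open>w + 2 * int s - 2 * int r\<close>, so the condition is the
  truncation by \<open>pos_part\<close>.\<close>

definition cell_pos :: "int \<Rightarrow> 'v \<Rightarrow> nat \<Rightarrow> nat \<Rightarrow> 'v" where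
  "cell_pos w v s r = (if 0 \<le> w + 2 * int s - 2 * int r then div_pow M lower r (div_pow M upper s v) else 0)"

text \<open>Both sides agree on the big cell by \<open>big_cell_expansion\<close> and hence
  everywhere by \<open>regular_vanish\<close>. Every large bound is allowed, so that finitely many
  vectors can share one.\<close>

lemma pos_map_cell_fun:
  assumes v: "v \<in> weight_space M w" and w: "0 \<le> w"
  shows "\<exists>N. \<forall>K\<ge>N. cell_coeffs K w (cell_pos w v) \<and> pos_map v = cell_fun K w (cell_pos w v)"
proof -
  note [simp] = polynomial_curve_upper polynomial_curve_lower
  have vc [simp]: "v \<in> car M" using v weight_space_car by blast
  let ?f = "\<lambda>r s. div_pow M lower r (div_pow M upper s v)"
  obtain N where N: "\<And>r s. r > N \<or> s > N \<Longrightarrow> ?f r s = 0"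
    "\<And>g. g \<in> SL2 \<Longrightarrow> g $ 1 $ 1 \<noteq> 0 \<Longrightarrow> act M g v = (\<Sum>s\<le>N. \<Sum>r\<le>N.
       scl M (g $ 1 $ 1 powi (w + int s - int r) * (g $ 1 $ 2) ^ s * (g $ 2 $ 1) ^ r) (?f r s))"
    by (rule big_cell_expansion[OF v]) blast
  have fw: "?f r s \<in> weight_space M (w + 2 * int s - 2 * int r)" for r s
    by (intro lower_weight upper_weight v)
  have cc: "cell_coeffs K w (cell_pos w v)" if "K \<ge> N" for K
    using N(1) w that by (auto simp: cell_coeffs_def cell_pos_def)
  have eqN: "cell_fun K w (cell_pos w v) = cell_fun N w (cell_pos w v)" if K: "K \<ge> N" for K
  proof
    fix h :: "'k ^ 2 ^ 2"
    have *: "(\<Sum>s\<le>K. \<Sum>r\<le>K. F s r) = (\<Sum>s\<le>N. \<Sum>r\<le>N. F s r)"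
      if "\<And>s r. s > N \<or> r > N \<Longrightarrow> F s r = 0" for F :: "nat \<Rightarrow> nat \<Rightarrow> 'v"
    proof -
      have "(\<Sum>s\<le>N. \<Sum>r\<le>N. F s r) = (\<Sum>s\<le>N. \<Sum>r\<le>K. F s r)"
        by (intro sum.cong refl sum.mono_neutral_left) (use K that in auto)
      also have "\<dots> = (\<Sum>s\<le>K. \<Sum>r\<le>K. F s r)"
        by (intro sum.mono_neutral_left ballI sum.neutral) (use K that in auto)
      finally show ?thesis by simp
    qed
    define F where "F s r = scl M (h $ 1 $ 1 ^ nat (w + int s - int r) * h $ 1 $ 2 ^ s * h $ 2 $ 1 ^ r)
      (cell_pos w v s r)" for s r
    have "F s r = 0" if "s > N \<or> r > N" for s r
      using N(1)[of r s] that by (auto simp: F_def cell_pos_def)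
    from *[of F, OF this] show "cell_fun K w (cell_pos w v) h = cell_fun N w (cell_pos w v) h"
      by (simp add: cell_fun_def on_SL2_def F_def)
  qed
  have "pos_part (act M g v) - cell_fun N w (cell_pos w v) g = 0" if g: "g \<in> SL2" for g
  proof (rule regular_vanish[of "\<lambda>g. pos_part (act M g v) - cell_fun N w (cell_pos w v) g", OF _ _ g])
    have "regular M (cell_fun N w (cell_pos w v))" using cell_fun_car[OF cc] by simp
    from regular_add[OF regular_pos_part[OF vc] regular_scale[OF this, of "-1"]]
    show "regular M (\<lambda>g. pos_part (act M g v) - cell_fun N w (cell_pos w v) g)" by simp
    fix g :: "'k ^ 2 ^ 2" assume g: "g \<in> SL2" "g $ 1 $ 1 \<noteq> 0"
    have "pos_part (act M g v) = (\<Sum>s\<le>N. \<Sum>r\<le>N.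
       scl M (g $ 1 $ 1 powi (w + int s - int r) * (g $ 1 $ 2) ^ s * (g $ 2 $ 1) ^ r) (pos_part (?f r s)))"
      unfolding N(2)[OF g] by (simp add: pos_part_sum pos_part_scale car_sum car_scale)
    also have "\<dots> = (\<Sum>s\<le>N. \<Sum>r\<le>N.
       scl M (g $ 1 $ 1 ^ nat (w + int s - int r) * (g $ 1 $ 2) ^ s * (g $ 2 $ 1) ^ r) (cell_pos w v s r))"
    proof (intro sum.cong refl)
      fix s r
      show "scl M (g $ 1 $ 1 powi (w + int s - int r) * (g $ 1 $ 2) ^ s * (g $ 2 $ 1) ^ r) (pos_part (?f r s)) =
        scl M (g $ 1 $ 1 ^ nat (w + int s - int r) * (g $ 1 $ 2) ^ s * (g $ 2 $ 1) ^ r) (cell_pos w v s r)"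
      proof (cases "0 \<le> w + 2 * int s - 2 * int r")
        case True
        \<comment> \<open>Twice this exponent is \<open>w\<close> plus the weight of the coefficient
          vector, and both are nonnegative.\<close>
        then have "w + int s - int r = int (nat (w + int s - int r))" using w by simp
        then have "g $ 1 $ 1 powi (w + int s - int r) = g $ 1 $ 1 ^ nat (w + int s - int r)"
          by (metis power_int_of_nat)
        then show ?thesis using True by (simp add: pos_part_weight[OF fw] cell_pos_def)
      qed (simp add: pos_part_weight[OF fw] cell_pos_def)
    qed
    finally show "pos_part (act M g v) - cell_fun N w (cell_pos w v) g = 0"
      using g by (simp add: cell_fun_def on_SL2_def)
  qed
  then have on: "pos_part (act M g v) = cell_fun N w (cell_pos w v) g" if "g \<in> SL2" for g
    using that by simp
  have "pos_map v = cell_fun N w (cell_pos w v)"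
  proof
    fix h
    show "pos_map v h = cell_fun N w (cell_pos w v) h"
    proof (cases "h \<in> SL2")
      case True
      then show ?thesis using on[OF True] by (simp only: pos_map_def vc if_True on_SL2_def)
    next
      case False
      then show ?thesis by (simp only: pos_map_def vc if_True if_False on_SL2_def cell_fun_def)
    qed
  qed
  then have "pos_map v = cell_fun K w (cell_pos w v)" if "K \<ge> N" for K
    using eqN[OF that] by (rule trans[OF _ sym])
  then show ?thesis using cc by (intro exI[of _ N] allI impI conjI)
qed

lemma cell_fun_sum:
  "(\<Sum>i\<in>A. cell_fun N w (\<kappa> i)) = cell_fun N w (\<lambda>s r. \<Sum>i\<in>A. \<kappa> i s r)"
proof
  fix h
  show "(\<Sum>i\<in>A. cell_fun N w (\<kappa> i)) h = cell_fun N w (\<lambda>s r. \<Sum>i\<in>A. \<kappa> i s r) h"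
  proof (cases "h \<in> SL2")
    case True
    let ?m = "\<lambda>s r. h $ 1 $ 1 ^ nat (w + int s - int r) * h $ 1 $ 2 ^ s * h $ 2 $ 1 ^ r"
    have "(\<Sum>i\<in>A. cell_fun N w (\<kappa> i)) h = (\<Sum>i\<in>A. \<Sum>s\<le>N. \<Sum>r\<le>N. scl M (?m s r) (\<kappa> i s r))"
      using True by (simp only: sum_fun_apply cell_fun_def on_SL2_def if_True)
    also have "\<dots> = (\<Sum>s\<le>N. \<Sum>i\<in>A. \<Sum>r\<le>N. scl M (?m s r) (\<kappa> i s r))" by (rule sum.swap)
    also have "\<dots> = (\<Sum>s\<le>N. \<Sum>r\<le>N. \<Sum>i\<in>A. scl M (?m s r) (\<kappa> i s r))"
      by (rule sum.cong[OF refl]) (rule sum.swap)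
    also have "\<dots> = cell_fun N w (\<lambda>s r. \<Sum>i\<in>A. \<kappa> i s r) h"
      using True by (simp only: cell_fun_def on_SL2_def if_True scale_sum_right)
    finally show ?thesis .
  next
    case False
    then show ?thesis by (simp only: sum_fun_apply cell_fun_def on_SL2_def if_False sum.neutral_const)
  qed
qed

lemma cell_fun_zero: "cell_fun N w (\<lambda>s r. 0) = 0"
  by (simp add: cell_fun_def)

lemma pos_map_zero: "pos_map 0 = 0"
proof -
  interpret J: rmodule "coind M" by (rule rmoduleI[OF rational_coind])
  interpret p: ghom M "coind M" pos_map by unfold_locales (rule Hom_pos_map)
  show ?thesis by (rule p.f_zero)
qed

lemma finite_submodule:
  assumes "finite S" "S \<subseteq> car M"
  obtains B where "finite B" "B \<subseteq> car M" "S \<subseteq> span B" "\<And>g b. g \<in> SL2 \<Longrightarrow> b \<in> span B \<Longrightarrow> act M g b \<in> span B"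
proof -
  have "\<exists>B. finite B \<and> B \<subseteq> car M \<and> S \<subseteq> span B \<and> (\<forall>g\<in>SL2. \<forall>b\<in>span B. act M g b \<in> span B)"
    using assms
  proof (induction S rule: finite_induct)
    case empty
    show ?case by (rule exI[of _ "{}"]) (simp add: act_zero)
  next
    case (insert v S)
    then obtain B where B: "finite B" "B \<subseteq> car M" "S \<subseteq> span B" "\<forall>g\<in>SL2. \<forall>b\<in>span B. act M g b \<in> span B"
      by auto
    obtain C where C: "finite C" "C \<subseteq> car M" "v \<in> span C" "\<And>g b. g \<in> SL2 \<Longrightarrow> b \<in> span C \<Longrightarrow> act M g b \<in> span C"
      using finite_stable_span[of v] insert by blast
    have sp: "span B \<subseteq> span (B \<union> C)" "span C \<subseteq> span (B \<union> C)" by (auto intro: span_mono[THEN subsetD])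
    have "act M g b \<in> span (B \<union> C)" if g: "g \<in> SL2" and b: "b \<in> span (B \<union> C)" for g b
    proof -
      obtain x y where xy: "x \<in> span B" "y \<in> span C" "b = x + y" using b by (auto simp: span_Un)
      have "x \<in> car M" "y \<in> car M" using xy span_minimal[OF _ subspace_car] B(2) C(2) by blast+
      then have "act M g b = act M g x + act M g y" using g xy(3) by (simp add: act_add)
      moreover have "act M g x \<in> span B" using B(4) g xy(1) by blast
      moreover have "act M g y \<in> span C" using C(4) g xy(2) by blast
      ultimately show ?thesis using sp by (auto intro: span_add)
    qed
    then show ?case using B C sp by (intro exI[of _ "B \<union> C"]) auto
  qed
  then show ?thesis using that by blast
qed

end

context rmodule2
begin

text \<open>In coordinates on the big cell the coboundary of \<open>coind M\<close> acts on the
  index \<open>s\<close> alone, so the contraction is applied for each \<open>r\<close> separately.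
  The point to check is that its result again consists of regular functions.\<close>

lemma pos_map_cocycle_boundary:
  assumes z: "z \<in> cochains M (Suc q)" and closed: "\<And>\<nu>. cobd M z \<nu> = 0"
  shows "\<exists>y\<in>cochains (coind M) q. cobd (coind M) y = pos_map \<circ> z"
proof -
  note [simp] = polynomial_curve_upper polynomial_curve_lower
  interpret J: rmodule2 "coind M"
    by (intro rmodule2.intro rmoduleI rational_coind rmodule2_axioms.intro char2)
  define S where "S = {\<mu>. z \<mu> \<noteq> 0}"
  have S: "finite S" using z by (simp add: S_def cochains_def)
  have zc [simp]: "z \<mu> \<in> car M" for \<mu> using cochain_car[OF z] .
  define zk where "zk \<mu> = cell_pos (mweight \<mu>) (z \<mu>)" for \<mu>
  have zk0: "zk \<mu> s r = 0" if "\<mu> \<notin> S" for \<mu> s r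
    using that by (simp add: zk_def cell_pos_def S_def div_pow_zero)
  have "\<exists>N. \<forall>K\<ge>N. cell_coeffs K (mweight \<mu>) (zk \<mu>) \<and> pos_map (z \<mu>) = cell_fun K (mweight \<mu>) (zk \<mu>)" for \<mu>
    unfolding zk_def by (rule pos_map_cell_fun[OF cochain_weight[OF z] mweight_nonneg])
  then obtain Nf where Nf: "\<And>\<mu> K. K \<ge> Nf \<mu> \<Longrightarrow>
      cell_coeffs K (mweight \<mu>) (zk \<mu>) \<and> pos_map (z \<mu>) = cell_fun K (mweight \<mu>) (zk \<mu>)" by metis
  \<comment> \<open>\<open>N\<close> bounds the indices of all coefficients. The contraction raises
    \<open>s\<close> by some \<open>2 ^ i\<close>, which is at most \<open>W\<close> because
    \<open>i\<close> occurs in a monomial of the support.\<close>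
  define N W K where "N = (\<Sum>\<mu>\<in>S. Nf \<mu>)" and "W = (\<Sum>\<mu>\<in>S. nat (mweight \<mu>))" and "K = N + W"
  have NS: "Nf \<mu> \<le> N" if "\<mu> \<in> S" for \<mu> unfolding N_def using S that by (rule member_le_sum[rotated 2]) simp_all
  have WS: "nat (mweight \<mu>) \<le> W" if "\<mu> \<in> S" for \<mu> unfolding W_def using S that by (rule member_le_sum[rotated 2]) simp_all
  have zkc: "zk \<mu> s r \<in> car M" for \<mu> s r by (simp add: zk_def cell_pos_def)
  have zkN: "s \<le> N \<and> r \<le> N" if "zk \<mu> s r \<noteq> 0" for \<mu> s r
  proof -
    have "\<mu> \<in> S" using that zk0 by blast
    then have "cell_coeffs N (mweight \<mu>) (zk \<mu>)" using Nf NS by blast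
    then show ?thesis using that by (meson cell_coeffs_def not_le)
  qed
  have posK: "pos_map (z \<mu>) = cell_fun K (mweight \<mu>) (zk \<mu>)" for \<mu>
  proof (cases "\<mu> \<in> S")
    case True
    then have "Nf \<mu> \<le> K" using NS[OF True] by (simp add: K_def)
    then show ?thesis using Nf by blast
  next
    case False
    then have "zk \<mu> = (\<lambda>s r. 0)" using zk0 by (intro ext) simp
    then show ?thesis using False by (simp add: S_def pos_map_zero cell_fun_zero)
  qed
  define \<eta> where "\<eta> \<nu> s r = contraction (\<lambda>\<mu> s. zk \<mu> s r) \<nu> s" for \<nu> s r
  have \<eta>_nz: "\<exists>i. add_mset i \<nu> \<in> S \<and> 2 ^ i \<le> s \<and> zk (add_mset i \<nu>) (s - 2 ^ i) r \<noteq> 0" if "\<eta> \<nu> s r \<noteq> 0" for \<nu> s r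
  proof -
    define i where "i = low_index s \<nu>"
    have b: "bit s i" and nz: "zk (add_mset i \<nu>) (s - 2 ^ i) r \<noteq> 0"
      using that unfolding \<eta>_def contraction_def Let_def i_def by (auto split: if_splits)
    have "2 ^ i \<le> s" using b by (metis bit_iff_odd div_less dvd_0_right not_less)
    then show ?thesis using nz zk0 by (intro exI[of _ i]) blast
  qed
  have \<eta>c: "cell_coeffs K (mweight \<nu>) (\<eta> \<nu>)" for \<nu>
    unfolding cell_coeffs_def
  proof (intro allI conjI impI)
    fix s r
    show "\<eta> \<nu> s r \<in> car M" by (simp add: \<eta>_def contraction_def Let_def zkc)
  next
    fix s r assume *: "K < s \<or> K < r"
    show "\<eta> \<nu> s r = 0"
    proof (rule ccontr)
      assume "\<eta> \<nu> s r \<noteq> 0"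
      then obtain i where i: "add_mset i \<nu> \<in> S" "2 ^ i \<le> s" "zk (add_mset i \<nu>) (s - 2 ^ i) r \<noteq> 0"
        using \<eta>_nz by blast
      have "int (2 ^ i) \<le> mweight (add_mset i \<nu>)" using mweight_nonneg[of \<nu>] by simp
      from nat_mono[OF this] have "2 ^ i \<le> nat (mweight (add_mset i \<nu>))" by (simp only: nat_int)
      then have "2 ^ i \<le> W" using WS[OF i(1)] by (rule order_trans)
      then show False using zkN[OF i(3)] i(2) * by (auto simp: K_def)
    qed
  next
    fix s r assume "\<eta> \<nu> s r \<noteq> 0"
    then obtain i where i: "2 ^ i \<le> s" "zk (add_mset i \<nu>) (s - 2 ^ i) r \<noteq> 0"
      using \<eta>_nz by blast
    \<comment> \<open>The contraction keeps the weight of the coefficient vector, here rewritten as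
      \<open>mweight \<nu> + 2 * int s - 2 * int r\<close>; adding the nonnegative
      \<open>mweight \<nu>\<close> and halving gives the exponent.\<close>
    have "0 \<le> mweight (add_mset i \<nu>) + 2 * int (s - 2 ^ i) - 2 * int r"
      using i(2) by (auto simp: zk_def cell_pos_def split: if_splits)
    then show "int r \<le> mweight \<nu> + int s" using mweight_nonneg[of \<nu>] i(1) by simp
  qed
  define y where "y \<nu> = cell_fun K (mweight \<nu>) (\<eta> \<nu>)" for \<nu>
  have y_nz: "\<exists>i. add_mset i \<nu> \<in> S" if "y \<nu> \<noteq> 0" for \<nu>
  proof -
    have "\<eta> \<nu> \<noteq> (\<lambda>s r. 0)" using that cell_fun_zero by (auto simp: y_def)
    then obtain s r where "\<eta> \<nu> s r \<noteq> 0" by (auto simp: fun_eq_iff)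
    then show ?thesis using \<eta>_nz by blast
  qed
  have "y \<in> cochains (coind M) q"
    unfolding cochains_def
  proof (intro CollectI conjI allI impI)
    have "{\<nu>. y \<nu> \<noteq> 0} \<subseteq> (\<Union>\<mu>\<in>S. (\<lambda>i. \<mu> - {#i#}) ` set_mset \<mu>)"
    proof clarify
      fix \<nu> assume "y \<nu> \<noteq> 0"
      then obtain i where i: "add_mset i \<nu> \<in> S" using y_nz by blast
      then show "\<nu> \<in> (\<Union>\<mu>\<in>S. (\<lambda>i. \<mu> - {#i#}) ` set_mset \<mu>)"
        by (intro UN_I[OF i] image_eqI[of _ _ i]) simp_all
    qed
    moreover have "finite (\<Union>\<mu>\<in>S. (\<lambda>i. \<mu> - {#i#}) ` set_mset \<mu>)" using S by simp
    ultimately show "finite {\<nu>. y \<nu> \<noteq> 0}" by (rule finite_subset)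
    show "y \<nu> \<in> weight_space (coind M) (mweight \<nu>)" for \<nu>
      unfolding y_def by (rule cell_fun_weight[OF \<eta>c])
    show "y \<nu> = 0" if s: "size \<nu> \<noteq> q" for \<nu>
    proof (rule ccontr)
      assume "y \<nu> \<noteq> 0"
      then obtain i where "z (add_mset i \<nu>) \<noteq> 0" using y_nz by (auto simp: S_def)
      then have "size (add_mset i \<nu>) = Suc q" using z unfolding cochains_def by blast
      then show False using s by simp
    qed
  qed
  moreover have "cobd (coind M) y = pos_map \<circ> z"
  proof
    fix \<nu>
    show "cobd (coind M) y \<nu> = (pos_map \<circ> z) \<nu>"
    proof (cases "\<nu> = {#}")
      case True
      then have "z \<nu> = 0" using z by (simp add: cochains_def)
      then show ?thesis using True by (simp add: cobd_def pos_map_zero)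
    next
      case False
      have cl: "(\<Sum>i\<in>{i \<in> set_mset \<nu>. \<not> bit s i}. zk (\<nu> - {#i#}) (s + 2 ^ i) r) = 0" for \<nu> s r
      proof -
        \<comment> \<open>The truncation condition does not depend on which \<open>i\<close> is
          removed, so all terms of the sum are kept or dropped together.\<close>
        define c where "c \<longleftrightarrow> 0 \<le> mweight \<nu> + 2 * int s - 2 * int r"
        have zki: "zk (\<nu> - {#i#}) (s + 2 ^ i) r = (if c then div_pow M lower r (div_pow M upper (s + 2 ^ i) (z (\<nu> - {#i#}))) else 0)"
          if i: "i \<in># \<nu>" for i
        proof -
          have "mweight (\<nu> - {#i#}) + 2 * int (s + 2 ^ i) - 2 * int r = mweight \<nu> + 2 * int s - 2 * int r"
            using mweight_remove[OF i] by simp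
          then show ?thesis by (simp only: zk_def cell_pos_def c_def)
        qed
        show ?thesis
        proof (cases c)
          case c: True
          have "(\<Sum>i\<in>{i \<in> set_mset \<nu>. \<not> bit s i}. zk (\<nu> - {#i#}) (s + 2 ^ i) r) =
              (\<Sum>i\<in>{i \<in> set_mset \<nu>. \<not> bit s i}. div_pow M lower r (div_pow M upper s (div_pow M upper (2 ^ i) (z (\<nu> - {#i#})))))"
            by (rule sum.cong[OF refl]) (simp add: zki c upper_upper_power2)
          \<comment> \<open>The terms with digit \<open>i\<close> of \<open>s\<close> set vanish by
            \<open>upper_upper_power2\<close>, so the sum completes to the coboundary of
            \<open>z\<close>.\<close>
          also have "\<dots> = (\<Sum>i\<in>set_mset \<nu>. div_pow M lower r (div_pow M upper s (div_pow M upper (2 ^ i) (z (\<nu> - {#i#})))))"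
            by (rule sum.mono_neutral_left) (auto simp: upper_upper_power2 div_pow_zero)
          also have "\<dots> = div_pow M lower r (div_pow M upper s (cobd M z \<nu>))"
            by (simp add: cobd_def div_pow_sum)
          finally show ?thesis using closed by (simp add: div_pow_zero)
        next
          case False
          then show ?thesis by (intro sum.neutral ballI) (simp add: zki)
        qed
      qed
      have hom: "(\<Sum>i\<in>set_mset \<nu>. if bit s i then 0 else \<eta> (\<nu> - {#i#}) (s + 2 ^ i) r) = zk \<nu> s r" for s r
      proof -
        have "(\<Sum>i\<in>set_mset \<nu>. if bit s i then 0 else \<eta> (\<nu> - {#i#}) (s + 2 ^ i) r) =
            (\<Sum>i\<in>{i \<in> set_mset \<nu>. \<not> bit s i}. \<eta> (\<nu> - {#i#}) (s + 2 ^ i) r)"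
          by (rule sum.mono_neutral_cong_right) auto
        also have "\<dots> = zk \<nu> s r"
          unfolding \<eta>_def
          by (rule contraction_homotopy[of "\<lambda>\<mu> s. zk \<mu> s r", OF double_zero cl False])
        finally show ?thesis .
      qed
      have "cobd (coind M) y \<nu> = (\<Sum>i\<in>set_mset \<nu>. cell_fun K (mweight \<nu>)
          (\<lambda>s r. if bit s i then 0 else \<eta> (\<nu> - {#i#}) (s + 2 ^ i) r))"
        unfolding cobd_def
      proof (rule sum.cong[OF refl])
        fix i assume i: "i \<in># \<nu>"
        have "mweight (\<nu> - {#i#}) + 2 * int (2 ^ i) = mweight \<nu>" using mweight_remove[OF i] by simp
        moreover have "scl M (of_nat ((s + 2 ^ i) choose (2 ^ i))) x = (if bit s i then 0 else x)" for s x
          by (simp add: of_nat_char2[OF char2] odd_choose_power2 bit_add_power2_same)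
        ultimately show "div_pow (coind M) upper (2 ^ i) (y (\<nu> - {#i#})) =
            cell_fun K (mweight \<nu>) (\<lambda>s r. if bit s i then 0 else \<eta> (\<nu> - {#i#}) (s + 2 ^ i) r)"
          unfolding y_def upper_cell_fun[OF \<eta>c] by (simp only:)
      qed
      also have "\<dots> = cell_fun K (mweight \<nu>) (zk \<nu>)"
        unfolding cell_fun_sum hom ..
      also have "\<dots> = (pos_map \<circ> z) \<nu>" by (simp only: posK o_apply)
      finally show ?thesis .
    qed
  qed
  ultimately show ?thesis by blast
qed

end

section \<open>Injective resolutions\<close>

lemma rmodule2I: "rational_module (M :: ('k::alg_closed_field, 'v::ab_group_add) gmod) \<Longrightarrow> CHAR('k) = 2 \<Longrightarrow> rmodule2 M"
  by (intro rmodule2.intro rmoduleI rmodule2_axioms.intro)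

lemma ghomI: "rational_module A \<Longrightarrow> rational_module B \<Longrightarrow> f \<in> Hom_G A B \<Longrightarrow> ghom A B f"
  by (intro ghom.intro rmoduleI ghom_axioms.intro)

lemma Hom_comp:
  fixes A :: "('k::alg_closed_field, 'a::ab_group_add) gmod" and B :: "('k, 'b::ab_group_add) gmod"
    and C :: "('k, 'c::ab_group_add) gmod"
  assumes "f \<in> Hom_G A B" "h \<in> Hom_G B C" and B: "rational_module B" and C: "rational_module C"
  shows "h \<circ> f \<in> Hom_G A C"
proof -
  have "h 0 = 0" by (rule ghom.f_zero[OF ghomI[OF B C assms(2)]])
  then show ?thesis using assms(1,2) unfolding Hom_G_def by auto
qed

lemma (in rmodule) Hom_inclusion:
  assumes "W \<subseteq> car M" "subspace W" "\<And>g w. g \<in> SL2 \<Longrightarrow> w \<in> W \<Longrightarrow> act M g w \<in> W"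
  shows "(\<lambda>x. if x \<in> W then x else 0) \<in> Hom_G (M\<lparr>car := W\<rparr>) M"
  unfolding Hom_G_def using assms(1,3) subspace_add[OF assms(2)] subspace_scale[OF assms(2)]
  by auto

text \<open>To stay within the type of \<open>I\<close>, \<open>pos_map\<close> is applied to a
  submodule \<open>F\<close> of finite dimension that holds all values of the cocycle: then
  \<open>coind F\<close> has countable dimension and can be transported. Injectivity extends the
  inclusion of \<open>F\<close> along this embedding, and the extension carries the bounding cochain
  back to \<open>I\<close>.\<close>

lemma acyclic_injective:
  fixes I :: "('k::alg_closed_field, 'i::infinite \<Rightarrow> 'k) gmod"
  assumes I: "injective_module I" and char2: "CHAR('k) = 2"
  shows "acyclic_at I q"
  unfolding acyclic_at_def
proof (intro ballI impI)
  fix c assume c: "c \<in> cochains I (Suc q)" and closed: "\<forall>\<nu>. cobd I c \<nu> = 0"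
  have rI: "rational_module I" using I by (simp add: injective_module_def)
  interpret I: rmodule2 I by (rule rmodule2I[OF rI char2])
  have "finite (c ` {\<mu>. c \<mu> \<noteq> 0})" using c by (simp add: cochains_def)
  moreover have "c ` {\<mu>. c \<mu> \<noteq> 0} \<subseteq> car I" using I.cochain_car[OF c] by auto
  ultimately obtain B where B: "finite B" "B \<subseteq> car I" "c ` {\<mu>. c \<mu> \<noteq> 0} \<subseteq> I.span B"
    "\<And>g b. g \<in> SL2 \<Longrightarrow> b \<in> I.span B \<Longrightarrow> act I g b \<in> I.span B"
    using I.finite_submodule by blast
  define W where "W = I.span B"
  have W: "W \<subseteq> car I" "I.subspace W" "\<And>g w. g \<in> SL2 \<Longrightarrow> w \<in> W \<Longrightarrow> act I g w \<in> W"
    using B I.span_minimal[OF B(2) I.subspace_car] by (auto simp: W_def)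
  define F where "F = I\<lparr>car := W\<rparr>"
  have F [simp]: "scl F = scl I" "car F = W" "act F = act I" by (simp_all add: F_def)
  have rF: "rational_module F" unfolding F_def by (rule I.rational_submodule[OF W])
  interpret F: rmodule2 F by (rule rmodule2I[OF rF char2])
  have cW: "c \<mu> \<in> W" for \<mu>
    using B(3) I.span_zero by (cases "c \<mu> = 0") (auto simp: W_def)
  have cF: "c \<in> cochains F (Suc q)"
    using c cW by (simp add: cochains_def weight_space_def)
  define \<iota> where "\<iota> x = (if x \<in> W then x else 0)" for x
  have h\<iota>: "\<iota> \<in> Hom_G F I" unfolding F_def \<iota>_def[abs_def] by (rule I.Hom_inclusion[OF W])
  interpret \<iota>: ghom F I \<iota> by (rule ghomI[OF rF rI h\<iota>])
  have "\<iota> \<circ> c = c" using cW by (auto simp: \<iota>_def)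
  then have "\<iota> (cobd F c \<nu>) = 0" for \<nu> using \<iota>.f_cobd[OF cF, of \<nu>] closed by simp
  then have "cobd F c \<nu> = 0" for \<nu>
    using F.cochain_car[OF F.cobd_cochains[OF cF], of \<nu>] by (metis F(2) \<iota>_def)
  then obtain y where y: "y \<in> cochains (coind F) q" "cobd (coind F) y = F.pos_map \<circ> c"
    using F.pos_map_cocycle_boundary[OF cF] by blast
  have rJ: "rational_module (coind F)" by (rule F.rational_coind)
  have "countable_dim F" unfolding countable_dim_def
    by (rule exI[of _ B]) (use B I.span_superset in \<open>auto simp: W_def countable_finite\<close>)
  then obtain N :: "('k, 'i \<Rightarrow> 'k) gmod" and t where N: "rational_module N" "t \<in> Hom_G (coind F) N"
    "bij_betw t (car (coind F)) (car N)"
    using transport_module[OF rmoduleI[OF rJ] F.countable_dim_coind] by blast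
  interpret t: ghom "coind F" N t by (rule ghomI[OF rJ N(1,2)])
  interpret p: ghom F "coind F" F.pos_map by (rule ghomI[OF rF rJ F.Hom_pos_map])
  have f: "t \<circ> F.pos_map \<in> Hom_G F N" by (rule Hom_comp[OF F.Hom_pos_map N(2) rJ N(1)])
  have "inj_on (t \<circ> F.pos_map) (car F)"
  proof (rule comp_inj_on[OF F.inj_pos_map])
    show "inj_on t (F.pos_map ` car F)"
      by (rule inj_on_subset[OF bij_betw_imp_inj_on[OF N(3)]]) (rule image_subsetI, rule p.f_car)
  qed
  then obtain h' where h': "h' \<in> Hom_G N I" "\<And>x. x \<in> car F \<Longrightarrow> h' ((t \<circ> F.pos_map) x) = \<iota> x"
    using I rF N(1) f h\<iota> unfolding injective_module_def by blast
  interpret h': ghom N I h' by (rule ghomI[OF N(1) rI h'(1)])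
  have ty: "t \<circ> y \<in> cochains N q" by (rule t.f_cochains[OF y(1)])
  have "cobd I (h' \<circ> (t \<circ> y)) \<nu> = c \<nu>" for \<nu>
  proof -
    have "cobd I (h' \<circ> (t \<circ> y)) \<nu> = h' (t (cobd (coind F) y \<nu>))"
      by (simp only: h'.f_cobd[OF ty] t.f_cobd[OF y(1)])
    also have "\<dots> = \<iota> (c \<nu>)" using h'(2)[of "c \<nu>"] cW by (simp add: y(2))
    finally show ?thesis using cW by (simp add: \<iota>_def)
  qed
  then have "cobd I (h' \<circ> (t \<circ> y)) = c" by (rule ext)
  then show "\<exists>y\<in>cochains I q. cobd I y = c" using h'.f_cochains[OF ty] by blast
qed

text \<open>\<open>coind V\<close> has the extension property by \<open>coind_extend\<close>, and
  the transport with its inverse moves it to the required type. The cokernel is again rational and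
  of countable dimension, so the construction can be iterated.\<close>

lemma injective_embedding:
  fixes V :: "('k::alg_closed_field, 'i::infinite \<Rightarrow> 'k) gmod"
  assumes rV: "rational_module V" and cV: "countable_dim V"
  shows "\<exists>J N i p. injective_module (J :: ('k, 'i \<Rightarrow> 'k) gmod) \<and> i \<in> Hom_G V J \<and> inj_on i (car V) \<and> p \<in> Hom_G J N \<and>
    p ` car J = car N \<and> (\<forall>x\<in>car J. p x = 0 \<longleftrightarrow> x \<in> i ` car V) \<and>
    rational_module (N :: ('k, 'i \<Rightarrow> 'k) gmod) \<and> countable_dim N"
proof -
  interpret V: rmodule V by (rule rmoduleI[OF rV])
  have rC: "rational_module (coind V)" by (rule V.rational_coind)
  obtain J :: "('k, 'i \<Rightarrow> 'k) gmod" and t where J: "rational_module J" "countable_dim J"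
    "t \<in> Hom_G (coind V) J" "bij_betw t (car (coind V)) (car J)"
    by (rule transport_module[OF rmoduleI[OF rC] V.countable_dim_coind[OF cV]]) blast
  interpret t: ghom "coind V" J t by (rule ghomI[OF rC J(1,3)])
  obtain t' where t': "t' \<in> Hom_G J (coind V)" "\<And>x. x \<in> car (coind V) \<Longrightarrow> t' (t x) = x"
    "\<And>y. y \<in> car J \<Longrightarrow> t (t' y) = y"
    by (rule Hom_inverse[OF rmoduleI[OF rC] rmoduleI[OF J(1)] J(3,4)]) blast
  interpret t': ghom J "coind V" t' by (rule ghomI[OF J(1) rC t'(1)])
  have inj: "injective_module J"
    unfolding injective_module_def
  proof (intro conjI J(1) allI impI ballI)
    fix A B :: "('k, 'i \<Rightarrow> 'k) gmod" and f h
    assume A: "rational_module A" and B: "rational_module B" and f: "f \<in> Hom_G A B" "inj_on f (car A)"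
      and h: "h \<in> Hom_G A J"
    have "t' \<circ> h \<in> Hom_G A (coind V)" by (rule Hom_comp[OF h t'(1) J(1) rC])
    then obtain h' where h': "h' \<in> Hom_G B (coind V)" "\<forall>x\<in>car A. h' (f x) = (t' \<circ> h) x"
      using coind_extend[OF rmoduleI[OF A] rmoduleI[OF B] V.rmodule_axioms f] by blast
    have "t \<circ> h' \<in> Hom_G B J" by (rule Hom_comp[OF h'(1) J(3) rC J(1)])
    moreover have "(t \<circ> h') (f x) = h x" if "x \<in> car A" for x
      using h'(2) that t'(3) Hom_GD(1)[OF h that] by simp
    ultimately show "\<exists>h'\<in>Hom_G B J. \<forall>x\<in>car A. h' (f x) = h x" by blast
  qed
  interpret o: ghom V "coind V" V.orbit_map by (rule ghomI[OF rV rC V.Hom_orbit_map])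
  define i where "i = t \<circ> V.orbit_map"
  have i: "i \<in> Hom_G V J" unfolding i_def by (rule Hom_comp[OF V.Hom_orbit_map J(3) rC J(1)])
  interpret i: ghom V J i by (rule ghomI[OF rV J(1) i])
  have ii: "inj_on i (car V)" unfolding i_def
  proof (rule comp_inj_on[OF V.inj_orbit_map])
    show "inj_on t (V.orbit_map ` car V)"
      by (rule inj_on_subset[OF bij_betw_imp_inj_on[OF J(4)]]) (rule image_subsetI, rule o.f_car)
  qed
  have "t.B.subspace (i ` car V)"
  proof (rule t.B.subspaceI)
    show "0 \<in> i ` car V" by (rule image_eqI[of _ _ 0]) simp_all
    show "x + y \<in> i ` car V" if "x \<in> i ` car V" "y \<in> i ` car V" for x y
      using that by (auto simp flip: i.f_add intro!: imageI V.car_add)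
    show "scl J a x \<in> i ` car V" if "x \<in> i ` car V" for a x
      using that by (auto simp flip: i.f_scale intro!: imageI V.car_scale)
  qed
  moreover have "act J g w \<in> i ` car V" if "g \<in> SL2" "w \<in> i ` car V" for g w
    using that by (auto simp flip: i.f_act)
  moreover have "i ` car V \<subseteq> car J" by auto
  ultimately obtain N :: "('k, 'i \<Rightarrow> 'k) gmod" and p where N: "rational_module N" "p \<in> Hom_G J N"
    "p ` car J = car N" "\<And>x. x \<in> car J \<Longrightarrow> p x = 0 \<longleftrightarrow> x \<in> i ` car V" "countable_dim J \<Longrightarrow> countable_dim N"
    using quotient_module[OF rmoduleI[OF J(1)], of "i ` car V"] by blast
  show ?thesis
    by (rule exI[of _ J], rule exI[of _ N], rule exI[of _ i], rule exI[of _ p])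
      (intro conjI ballI inj i ii N(1-4) N(5)[OF J(2)])
qed

lemma injective_resolution_exists:
  fixes V :: "('k::alg_closed_field, 'i::infinite \<Rightarrow> 'k) gmod"
  assumes "rational_module V" "countable_dim V"
  shows "\<exists>I d e. injective_resolution V I d e"
proof -
  define good where "good V \<longleftrightarrow> rational_module V \<and> countable_dim V" for V :: "('k, 'i \<Rightarrow> 'k) gmod"
  define step where "step V J N i p \<longleftrightarrow> injective_module J \<and> i \<in> Hom_G V J \<and> inj_on i (car V) \<and>
    p \<in> Hom_G J N \<and> p ` car J = car N \<and> (\<forall>x\<in>car J. p x = 0 \<longleftrightarrow> x \<in> i ` car V) \<and> good N"
    for V J N :: "('k, 'i \<Rightarrow> 'k) gmod" and i p
  have "\<exists>w. step V (fst w) (fst (snd w)) (fst (snd (snd w))) (snd (snd (snd w)))" if V: "good V" for V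
  proof -
    have "\<exists>J N i p. step V J N i p"
      using injective_embedding[of V] V unfolding step_def good_def by simp
    then obtain J N i p where "step V J N i p" by (elim exE) (rule that)
    then show ?thesis by (intro exI[of _ "(J, N, i, p)"]) simp
  qed
  then obtain w where w: "\<And>V. good V \<Longrightarrow> step V (fst (w V)) (fst (snd (w V))) (fst (snd (snd (w V)))) (snd (snd (snd (w V))))"
    using choice_iff[of "\<lambda>V w. good V \<longrightarrow> step V (fst w) (fst (snd w)) (fst (snd (snd w))) (snd (snd (snd w)))"]
    by blast
  define J N i p where "J V = fst (w V)" and "N V = fst (snd (w V))" and "i V = fst (snd (snd (w V)))"
    and "p V = snd (snd (snd (w V)))" for V
  have *: "step V (J V) (N V) (i V) (p V)" if "good V" for V
    using w[OF that] by (simp only: J_def N_def i_def p_def)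
  define U where "U n = (N ^^ n) V" for n
  have U: "good (U n)" for n
  proof (induction n)
    case 0 then show ?case using assms by (simp add: U_def good_def)
  next
    case (Suc n)
    then show ?case using *[OF Suc] by (simp add: U_def step_def)
  qed
  have U0: "U 0 = V" and US: "U (Suc n) = N (U n)" for n by (simp_all add: U_def)
  define d where "d n = i (U (Suc n)) \<circ> p (U n)" for n
  have J: "injective_module (J (U n))" and i: "i (U n) \<in> Hom_G (U n) (J (U n))" "inj_on (i (U n)) (car (U n))"
    and p: "p (U n) \<in> Hom_G (J (U n)) (U (Suc n))" "p (U n) ` car (J (U n)) = car (U (Suc n))"
      "\<And>x. x \<in> car (J (U n)) \<Longrightarrow> p (U n) x = 0 \<longleftrightarrow> x \<in> i (U n) ` car (U n)" for n
    using *[OF U[of n]] by (simp_all add: US step_def)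
  have rJ: "rational_module (J (U n))" for n using J by (simp add: injective_module_def)
  have rU: "rational_module (U n)" for n using U by (simp add: good_def)
  have i0: "i (U n) 0 = 0" for n
    using ghom.f_zero[OF ghomI[OF rU rJ i(1)]] .
  have d0: "{x \<in> car (J (U n)). d n x = 0} = i (U n) ` car (U n)" for n
  proof -
    have "d n x = 0 \<longleftrightarrow> p (U n) x = 0" if "x \<in> car (J (U n))" for x
    proof
      assume "d n x = 0"
      then have "i (U (Suc n)) (p (U n) x) = i (U (Suc n)) 0" by (simp add: d_def i0)
      moreover have "0 \<in> car (U (Suc n))" using rmoduleI[OF rU] by (simp add: rmodule_def gmodule.car_zero)
      ultimately show "p (U n) x = 0" using inj_onD[OF i(2)] Hom_GD(1)[OF p(1) that] by blast
    qed (simp add: d_def i0)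
    then have "{x \<in> car (J (U n)). d n x = 0} = {x \<in> car (J (U n)). x \<in> i (U n) ` car (U n)}"
      using p(3) by blast
    also have "\<dots> = i (U n) ` car (U n)" using Hom_GD(1)[OF i(1)] by blast
    finally show ?thesis .
  qed
  have "injective_resolution V (\<lambda>n. J (U n)) d (i V)"
    unfolding injective_resolution_def
  proof (intro conjI allI)
    show "i V \<in> Hom_G V (J (U 0))" "inj_on (i V) (car V)" using i[of 0] by (simp_all add: U0)
    show "i V ` car V = {x \<in> car (J (U 0)). d 0 x = 0}" using d0[of 0] by (simp add: U0)
    show "d n \<in> Hom_G (J (U n)) (J (U (Suc n)))" for n
      unfolding d_def by (rule Hom_comp[OF p(1) i(1) rU rJ])
    show "d n ` car (J (U n)) = {x \<in> car (J (U (Suc n))). d (Suc n) x = 0}" for n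
      unfolding d0 unfolding d_def image_comp[symmetric] p(2) ..
  qed (rule J)
  then show ?thesis by blast
qed

text \<open>
  Dimension shifting along an arbitrary injective resolution: since \<open>I\<^sub>p\<close> is acyclic for the
  cochains, independent classes of degree \<open>q - p\<close> of the \<open>p\<close>-th syzygy go to independent
  classes of degree \<open>q - p - 1\<close> of the next one.
\<close>

lemma Ext_dim_ge:
  fixes V :: "('k::alg_closed_field, 'i::infinite \<Rightarrow> 'k) gmod"
  assumes rV: "rational_module V" and char2: "CHAR('k) = 2" and res: "injective_resolution V I d e"
    and X: "finite X" and z: "indep_cocycles V q X z"
  shows "quotient_dim (\<lambda>a f x. scl (I (Suc q)) a (f x)) (cocycles trivial_module I d (Suc q))
      (coboundaries trivial_module I d (Suc q)) \<ge> enat (card X)"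
proof -
  have inj: "injective_module (I n)" and e: "e \<in> Hom_G V (I 0)" "inj_on e (car V)"
    and d: "d n \<in> Hom_G (I n) (I (Suc n))" and e0: "e ` car V = {x \<in> car (I 0). d 0 x = 0}"
    and dd: "d n ` car (I n) = {x \<in> car (I (Suc n)). d (Suc n) x = 0}" for n
    using res by (simp_all add: injective_resolution_def)
  have rI: "rational_module (I n)" for n using inj by (simp add: injective_module_def)
  define Z where "Z n = {x \<in> car (I n). d n x = 0}" for n
  \<comment> \<open>The syzygies: the kernel of \<open>d n\<close> in \<open>I n\<close>, with
    \<open>V\<close> itself in place of its image for \<open>n = 0\<close>.\<close>
  define A where "A n = (case n of 0 \<Rightarrow> V | Suc k \<Rightarrow> (I n)\<lparr>car := Z n\<rparr>)" for n
  define i where "i n = (case n of 0 \<Rightarrow> e | Suc k \<Rightarrow> (\<lambda>x. if x \<in> Z n then x else 0))" for n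
  have dh: "ghom (I n) (I (Suc n)) (d n)" for n by (rule ghomI[OF rI rI d])
  have Z: "Z n \<subseteq> car (I n)" "module.subspace (scl (I n)) (Z n)"
    "\<And>g w. g \<in> SL2 \<Longrightarrow> w \<in> Z n \<Longrightarrow> act (I n) g w \<in> Z n" for n
  proof -
    interpret h: ghom "I n" "I (Suc n)" "d n" by (rule dh)
    show "Z n \<subseteq> car (I n)" by (auto simp: Z_def)
    show "h.A.subspace (Z n)"
      by (rule h.A.subspaceI) (auto simp: Z_def h.f_add h.f_scale h.A.car_add h.A.car_scale)
    show "act (I n) g w \<in> Z n" if "g \<in> SL2" "w \<in> Z n" for g w
      using that by (auto simp: Z_def h.f_act h.B.act_zero)
  qed
  have rZ: "rational_module ((I n)\<lparr>car := Z n\<rparr>)" for n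
    using rmodule.rational_submodule[OF rmoduleI[OF rI] Z] .
  have rA: "rational_module (A n)" for n by (cases n) (simp_all add: A_def rV rZ)
  have iA: "i n \<in> Hom_G (A n) (I n)" for n
    using e(1) rmodule.Hom_inclusion[OF rmoduleI[OF rI] Z] by (cases n) (simp_all add: A_def i_def)
  have iinj: "inj_on (i n) (car (A n))" for n
    using e(2) by (cases n) (simp_all add: A_def i_def inj_on_def)
  have iim: "i n ` car (A n) = Z n" for n
  proof (cases n)
    case 0 then show ?thesis using e0 by (simp add: A_def i_def Z_def)
  next
    case (Suc k) then show ?thesis by (auto simp: A_def i_def)
  qed
  have AS: "car (A (Suc n)) = d n ` car (I n)" "scl (A (Suc n)) = scl (I (Suc n))" "act (A (Suc n)) = act (I (Suc n))" for n
    using dd by (simp_all add: A_def Z_def)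
  have dA: "d n \<in> Hom_G (I n) (A (Suc n))" for n
    using d[of n] AS[of n] unfolding Hom_G_def by auto
  have se: "short_exact (A n) (I n) (A (Suc n)) (i n) (d n)" for n
  proof (intro short_exact.intro short_exact_axioms.intro)
    show "ghom (A n) (I n) (i n)" by (rule ghomI[OF rA rI iA])
    show "ghom (I n) (A (Suc n)) (d n)" by (rule ghomI[OF rI rA dA])
    show "CHAR('k) = 2" by (rule char2)
    show "inj_on (i n) (car (A n))" by (rule iinj)
    show "\<exists>x\<in>car (I n). d n x = y" if "y \<in> car (A (Suc n))" for y using that AS by auto
    show "d n x = 0 \<longleftrightarrow> x \<in> i n ` car (A n)" if "x \<in> car (I n)" for x
      using that unfolding iim by (simp add: Z_def)
  qed
  have shift: "\<exists>z'. indep_cocycles (A n) (q - n) X z'" if "n \<le> q" for n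
    using that
  proof (induction n)
    case 0 then show ?case using z by (auto simp: A_def)
  next
    case (Suc n)
    then obtain z' where z': "indep_cocycles (A n) (Suc (q - Suc n)) X z'" by (auto simp: Suc_diff_Suc)
    show ?case
      by (rule short_exact.connecting_cocycles[OF se z' acyclic_injective[OF inj char2]]) blast
  qed
  obtain z' where z': "indep_cocycles (A q) 0 X z'" using shift[of q] by auto
  obtain u where u: "\<And>x. x \<in> X \<Longrightarrow> u x \<in> car (A (Suc q))"
    "\<And>x g. x \<in> X \<Longrightarrow> g \<in> SL2 \<Longrightarrow> act (A (Suc q)) g (u x) = u x"
    "\<And>a b. b \<in> car (I q) \<Longrightarrow> (\<And>g. g \<in> SL2 \<Longrightarrow> act (I q) g b = b) \<Longrightarrow>
      (\<Sum>x\<in>X. scl (A (Suc q)) (a x) (u x)) = d q b \<Longrightarrow> \<forall>x\<in>X. a x = 0"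
    by (rule short_exact.connecting_invariants[OF se z' acyclic_injective[OF inj char2]]) blast
  interpret Iq: rmodule "I q" by (rule rmoduleI[OF rI])
  interpret I': rmodule "I (Suc q)" by (rule rmoduleI[OF rI])
  interpret dq: ghom "I q" "I (Suc q)" "d q" by (rule dh)
  interpret dq': ghom "I (Suc q)" "I (Suc (Suc q))" "d (Suc q)" by (rule dh)
  have uc: "u x \<in> car (I (Suc q))" "d (Suc q) (u x) = 0" "\<And>g. g \<in> SL2 \<Longrightarrow> act (I (Suc q)) g (u x) = u x"
    if "x \<in> X" for x
    using u(1,2)[OF that] dd[of q] AS[of q] by auto
  \<comment> \<open>An invariant vector is the same as an equivariant map from the trivial
    module.\<close>
  define \<phi> where "\<phi> x = (\<lambda>a. scl (I (Suc q)) a (u x))" for x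
  have \<phi>: "\<phi> x \<in> cocycles trivial_module I d (Suc q)" if "x \<in> X" for x
  proof -
    have "d (Suc q) \<circ> \<phi> x = 0"
      by (rule ext) (simp add: \<phi>_def dq'.f_scale uc[OF that])
    then show ?thesis
      using uc[OF that]
      by (auto simp: cocycles_def Hom_G_def trivial_module_def \<phi>_def I'.scale_left_distrib I'.act_scale
          I'.car_scale)
  qed
  have indep: "\<forall>x\<in>X. a x = 0"
    if cob: "(\<Sum>x\<in>X. (\<lambda>y. scl (I (Suc q)) (a x) (\<phi> x y))) \<in> coboundaries trivial_module I d (Suc q)" for a
  proof -
    obtain f where f: "f \<in> Hom_G trivial_module (I q)"
      "(\<Sum>x\<in>X. (\<lambda>y. scl (I (Suc q)) (a x) (\<phi> x y))) = d q \<circ> f"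
      using cob unfolding coboundaries.simps by blast
    have "(\<Sum>x\<in>X. scl (I (Suc q)) (a x) (u x)) = d q (f 1)"
      using fun_cong[OF f(2), of 1] by (simp add: sum_fun_apply \<phi>_def)
    moreover have "f 1 \<in> car (I q)" "\<And>g. g \<in> SL2 \<Longrightarrow> act (I q) g (f 1) = f 1"
      using f(1) by (auto simp: Hom_G_def trivial_module_def)
    ultimately show ?thesis using u(3)[of "f 1" a] by (simp add: AS)
  qed
  \<comment> \<open>\<open>quotient_dim\<close> counts a set, so members of the family must not
    coincide; equal ones would satisfy a relation with coefficients 1 and -1.\<close>
  have inj\<phi>: "inj_on \<phi> X"
  proof (rule inj_onI, rule ccontr)
    fix x y assume xy: "x \<in> X" "y \<in> X" "\<phi> x = \<phi> y" "x \<noteq> y"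
    define a where "a w = (if w = x then 1 else if w = y then -1 else 0 :: 'k)" for w
    have uxy: "u x = u y" using fun_cong[OF xy(3), of 1] by (simp add: \<phi>_def)
    have "(\<Sum>w\<in>X. scl (A (Suc q)) (a w) (u w)) = (\<Sum>w\<in>{x, y}. scl (I (Suc q)) (a w) (u w))"
      unfolding AS by (rule sum.mono_neutral_right) (use X xy in \<open>auto simp: a_def\<close>)
    also have "\<dots> = 0" using xy(4) uxy by (simp add: a_def)
    finally have "\<forall>x\<in>X. a x = 0" using u(3)[of 0 a] by (simp add: Iq.act_zero)
    from bspec[OF this xy(1)] show False by (simp add: a_def)
  qed
  have "\<forall>y\<in>\<phi> ` X. b y = 0"
    if "(\<Sum>y\<in>\<phi> ` X. (\<lambda>x. scl (I (Suc q)) (b y) (y x))) \<in> coboundaries trivial_module I d (Suc q)" for b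
  proof -
    have "(\<Sum>y\<in>\<phi> ` X. (\<lambda>x. scl (I (Suc q)) (b y) (y x))) =
        (\<Sum>w\<in>X. (\<lambda>x. scl (I (Suc q)) (b (\<phi> w)) (\<phi> w x)))"
      by (rule sum.reindex_cong[OF inj\<phi> refl refl])
    then have "(\<Sum>w\<in>X. (\<lambda>x. scl (I (Suc q)) (b (\<phi> w)) (\<phi> w x))) \<in> coboundaries trivial_module I d (Suc q)"
      using that by (simp only:)
    from indep[OF this] show ?thesis by blast
  qed
  then have "enat (card (\<phi> ` X)) \<in> {enat (card Y) | Y. finite Y \<and> Y \<subseteq> cocycles trivial_module I d (Suc q) \<and>
     (\<forall>a. (\<Sum>y\<in>Y. (\<lambda>x. scl (I (Suc q)) (a y) (y x))) \<in> coboundaries trivial_module I d (Suc q) \<longrightarrow> (\<forall>y\<in>Y. a y = 0))}"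
    using X \<phi> by (intro CollectI exI[of _ "\<phi> ` X"] conjI) auto
  then show ?thesis
    unfolding quotient_dim_def card_image[OF inj\<phi>] by (rule Sup_upper)
qed

text \<open>Since some resolution exists, the choice in \<open>Ext_dim\<close> yields one, and
  \<open>Ext_dim_ge\<close> holds for whichever is chosen.\<close>

lemma H_dim_ge:
  fixes V :: "('k::alg_closed_field, 'i::infinite \<Rightarrow> 'k) gmod"
  assumes V: "rational_module V" "countable_dim V" and char2: "CHAR('k) = 2"
    and X: "finite X" and z: "indep_cocycles V q X z"
  shows "H_dim (Suc q) V \<ge> enat (card X)"
proof -
  obtain I d where Id: "(SOME (I, d). \<exists>e. injective_resolution V I d e) = (I, d)" by fastforce
  have "\<exists>p. (case p of (I, d) \<Rightarrow> \<exists>e. injective_resolution V I d e)"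
    using injective_resolution_exists[OF V] by auto
  from someI_ex[OF this] have "\<exists>e. injective_resolution V I d e"
    unfolding Id prod.case .
  then obtain e where "injective_resolution V I d e" ..
  from Ext_dim_ge[OF V(1) char2 this X z] show ?thesis
    unfolding H_dim_def Ext_dim_def Id prod.case .
qed

section \<open>Simple modules of highest weight a power of 2\<close>

lemma add_power_char2:
  assumes "CHAR('k::comm_semiring_1) = 2" shows "((x::'k) + y) ^ (2 ^ n) = x ^ (2 ^ n) + y ^ (2 ^ n)"
proof (induction n)
  case (Suc n)
  have "(of_nat 2 :: 'k) = 0" using of_nat_CHAR[where 'a = 'k] assms by simp
  then have two: "(2 :: 'k) = 0" by simp
  have sq: "(a + b)\<^sup>2 = a\<^sup>2 + b\<^sup>2" for a b :: 'k
    by (simp add: power2_sum two)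
  have "(x + y) ^ (2 ^ Suc n) = ((x + y) ^ (2 ^ n))\<^sup>2" by (simp add: power_mult[symmetric] mult.commute)
  also have "\<dots> = (x ^ (2 ^ n))\<^sup>2 + (y ^ (2 ^ n))\<^sup>2" by (simp add: Suc sq)
  finally show ?case by (simp add: power_mult[symmetric] mult.commute)
qed simp

lemma scale_rearrange:
  fixes p q :: "'a::comm_ring"
  shows "c * (p * s + q * t) + (A * p + B * q) = (A + c * s) * p + (B + c * t) * q"
  by (simp add: algebra_simps)

context rmodule2
begin

lemma act_upper_highest:
  assumes v: "v \<in> car M" and e: "\<And>s. s > 0 \<Longrightarrow> div_pow M upper s v = 0"
  shows "act M (upper t) v = v"
proof -
  obtain N where "act M (upper t) v = (\<Sum>s\<le>N. scl M (t ^ s) (div_pow M upper s v))"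
    by (rule div_pow_expand[OF v polynomial_curve_upper]) blast
  also have "\<dots> = (\<Sum>s\<le>N. if s = 0 then v else 0)" by (rule sum.cong) (auto simp: e v)
  finally show ?thesis by simp
qed

text \<open>On the big cell the upper factor fixes \<open>v\<close>, the torus gives the power of
  the upper left entry, and lower divided powers of positive index leave the weight space. Density
  extends the formula to the whole group.\<close>

lemma wt_part_orbit_highest:
  assumes v: "v \<in> weight_space M (int r)" and e: "\<And>s. s > 0 \<Longrightarrow> div_pow M upper s v = 0"
    and g: "g \<in> SL2"
  shows "wt_part M (int r) (act M g v) = scl M (g $ 1 $ 1 ^ r) v"
proof -
  note [simp] = polynomial_curve_upper polynomial_curve_lower
  have vc [simp]: "v \<in> car M" using v weight_space_car by blast
  have lo: "wt_part M (int r) (act M (lower x) v) = v" for x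
  proof -
    obtain N where "act M (lower x) v = (\<Sum>s\<le>N. scl M (x ^ s) (div_pow M lower s v))"
      by (rule div_pow_expand[OF vc polynomial_curve_lower]) blast
    then have "wt_part M (int r) (act M (lower x) v) =
        (\<Sum>s\<le>N. scl M (x ^ s) (wt_part M (int r) (div_pow M lower s v)))"
      by (simp add: wt_part_sum wt_part_scale car_scale)
    also have "\<dots> = (\<Sum>s\<le>N. if s = 0 then v else 0)"
      by (rule sum.cong) (simp_all add: wt_part_of_weight[OF lower_weight[OF v]])
    finally show ?thesis by simp
  qed
  have "wt_part M (int r) (act M g v) - scl M (g $ 1 $ 1 ^ r) v = 0"
  proof (rule regular_vanish[of "\<lambda>g. wt_part M (int r) (act M g v) - scl M (g $ 1 $ 1 ^ r) v", OF _ _ g])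
    have "regular M (\<lambda>g. wt_part M (int r) (act M g v))"
      by (rule regular_linear[where h = "wt_part M (int r)", OF regular_orbit[OF vc]])
        (auto simp: wt_part_add wt_part_scale wt_part_zero gmodule_axioms)
    moreover have "regular M (\<lambda>g. scl M (g $ 1 $ 1 ^ r) v)"
      by (intro regular_tensor polynomial_fun_power polynomial_fun.coord vc)
    ultimately have "regular M (\<lambda>g. wt_part M (int r) (act M g v) + scl M (-1) (scl M (g $ 1 $ 1 ^ r) v))"
      by (intro regular_add regular_scale)
    then show "regular M (\<lambda>g. wt_part M (int r) (act M g v) - scl M (g $ 1 $ 1 ^ r) v)" by simp
    fix h :: "'k ^ 2 ^ 2" assume h: "h \<in> SL2" "h $ 1 $ 1 \<noteq> 0"
    have "act M h v = act M (lower (h$2$1 / h$1$1)) (act M (torus (h$1$1)) (act M (upper (h$1$2 / h$1$1)) v))"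
      by (subst (1) big_cell[OF h], subst act_mult, simp, simp add: h(2), rule vc, subst act_mult)
        (use h vc in auto)
    also have "\<dots> = scl M (h$1$1 ^ r) (act M (lower (h$2$1 / h$1$1)) v)"
      using weight_spaceD[OF v h(2)] by (simp add: act_upper_highest[OF vc e] act_scale)
    finally show "wt_part M (int r) (act M h v) - scl M (h $ 1 $ 1 ^ r) v = 0"
      by (simp add: wt_part_scale lo)
  qed
  then show ?thesis by simp
qed

text \<open>
  In a simple module with highest weight vector \<open>v\<close> of weight \<open>r\<close> the coefficient of \<open>v\<close> in
  \<open>g w\<close>, as a function of \<open>g\<close>, determines \<open>w\<close>. For \<open>w = h v\<close> it is the \<open>r\<close>-th power
  of the upper left entry of \<open>g h\<close>, which for a power \<open>r\<close> of 2 is a combination of the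
  \<open>r\<close>-th powers of the entries in the first row of \<open>g\<close>.
\<close>

lemma simple_weights:
  assumes simp: "simple_module M" and hw: "highest_weight M (2 ^ n)" and m: "m \<noteq> 2 ^ n" "m \<noteq> - (2 ^ n)"
    and x: "x \<in> weight_space M m"
  shows "x = 0"
proof -
  define r where "r = (2::nat) ^ n"
  have r0: "r > 0" and ri: "int r = 2 ^ n" by (simp_all add: r_def)
  have xc: "x \<in> car M" using x weight_space_car by blast
  have "weight_space M (int r) \<noteq> {0}" and top: "\<And>k. weight_space M k \<noteq> {0} \<Longrightarrow> k \<le> int r"
    using hw by (simp_all add: highest_weight_def r_def)
  moreover have "0 \<in> weight_space M (int r)" by simp
  ultimately obtain v where v: "v \<in> weight_space M (int r)" "v \<noteq> 0" by blast
  have vc [simp]: "v \<in> car M" using v weight_space_car by blast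
  have e: "div_pow M upper s v = 0" if "s > 0" for s
    using upper_weight[OF v(1), of s] top[of "int r + 2 * int s"] that by force
  have psi: "wt_part M (int r) (act M g v) = scl M (g $ 1 $ 1 ^ r) v" if "g \<in> SL2" for g
    by (rule wt_part_orbit_highest[OF v(1) _ that]) (rule e)
  have only: "W = {0} \<or> W = car M"
    if "W \<subseteq> car M" "subspace W" "\<And>g w. g \<in> SL2 \<Longrightarrow> w \<in> W \<Longrightarrow> act M g w \<in> W" for W
    using simp that unfolding simple_module_def by blast
  define Orb where "Orb = (\<lambda>g. act M g v) ` SL2"
  have Oc: "Orb \<subseteq> car M" by (auto simp: Orb_def)
  have sO: "span Orb \<subseteq> car M" by (rule span_minimal[OF Oc subspace_car])
  have "span Orb = {0} \<or> span Orb = car M"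
  proof (rule only[OF sO subspace_span])
    fix g :: "'k ^ 2 ^ 2" and w assume g: "g \<in> SL2" and w: "w \<in> span Orb"
    have "w \<in> car M \<and> act M g w \<in> span Orb" using w
    proof (induction rule: span_induct_alt)
      case base then show ?case using g by (simp add: act_zero span_zero)
    next
      case (step c y w)
      then obtain h where h: "h \<in> SL2" "y = act M h v" by (auto simp: Orb_def)
      then have "act M g y = act M (g ** h) v" using g by (simp add: act_mult)
      then have "act M g y \<in> span Orb" using g h by (auto simp: Orb_def intro!: span_base)
      moreover have yc: "y \<in> car M" using h by simp
      moreover have "act M g (scl M c y + w) = scl M c (act M g y) + act M g w"
        using g yc step(2) by (simp add: act_add act_scale car_scale)
      ultimately show ?case
        using step(2) by (auto intro: span_add span_scale)
    qed
    then show "act M g w \<in> span Orb" by blast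
  qed
  moreover have "v \<in> span Orb"
    using act_one[OF vc] one_SL2 unfolding Orb_def by (metis imageI span_base)
  ultimately have sp: "span Orb = car M" using v(2) by auto
  have "x \<in> span Orb" using sp xc by simp
  \<comment> \<open>The module is spanned by the vectors \<open>act M h v\<close>, each contributing
    the r-th powers of the first column of \<open>h\<close> to the pair \<open>A\<close>,
    \<open>B\<close>.\<close>
  then have "\<exists>A B. x \<in> car M \<and> (\<forall>g\<in>SL2. wt_part M (int r) (act M g x) = scl M (A * g $ 1 $ 1 ^ r + B * g $ 1 $ 2 ^ r) v)"
  proof (induction rule: span_induct_alt)
    case base then show ?case by (intro exI[of _ 0]) (simp add: act_zero wt_part_zero)
  next
    case (step c y w)
    then obtain h where h: "h \<in> SL2" "y = act M h v" by (auto simp: Orb_def)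
    obtain A B where AB: "w \<in> car M"
      "\<And>g. g \<in> SL2 \<Longrightarrow> wt_part M (int r) (act M g w) = scl M (A * g $ 1 $ 1 ^ r + B * g $ 1 $ 2 ^ r) v"
      using step by blast
    have yc: "y \<in> car M" using h by simp
    have eq: "wt_part M (int r) (act M g (scl M c y + w)) =
        scl M ((A + c * h $ 1 $ 1 ^ r) * g $ 1 $ 1 ^ r + (B + c * h $ 2 $ 1 ^ r) * g $ 1 $ 2 ^ r) v"
      if g: "g \<in> SL2" for g
    proof -
      have "wt_part M (int r) (act M g y) = scl M ((g ** h) $ 1 $ 1 ^ r) v"
        using psi[of "g ** h"] g h by (simp add: act_mult)
      also have "(g ** h) $ 1 $ 1 ^ r = g $ 1 $ 1 ^ r * h $ 1 $ 1 ^ r + g $ 1 $ 2 ^ r * h $ 2 $ 1 ^ r"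
        by (simp add: mult_nth2 r_def add_power_char2[OF char2] power_mult_distrib)
      finally have y: "wt_part M (int r) (act M g y) =
          scl M (g $ 1 $ 1 ^ r * h $ 1 $ 1 ^ r + g $ 1 $ 2 ^ r * h $ 2 $ 1 ^ r) v" .
      have "wt_part M (int r) (act M g (scl M c y + w)) =
          scl M c (wt_part M (int r) (act M g y)) + wt_part M (int r) (act M g w)"
        using g yc AB(1) by (simp add: act_add act_scale wt_part_add wt_part_scale car_scale)
      also have "\<dots> = scl M (c * (g $ 1 $ 1 ^ r * h $ 1 $ 1 ^ r + g $ 1 $ 2 ^ r * h $ 2 $ 1 ^ r) + (A * g $ 1 $ 1 ^ r + B * g $ 1 $ 2 ^ r)) v"
        unfolding y AB(2)[OF g] by (simp only: scale_scale flip: scale_left_distrib)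
      finally have e: "wt_part M (int r) (act M g (scl M c y + w)) = \<dots>" .
      have "c * (g $ 1 $ 1 ^ r * h $ 1 $ 1 ^ r + g $ 1 $ 2 ^ r * h $ 2 $ 1 ^ r) + (A * g $ 1 $ 1 ^ r + B * g $ 1 $ 2 ^ r) =
          (A + c * h $ 1 $ 1 ^ r) * g $ 1 $ 1 ^ r + (B + c * h $ 2 $ 1 ^ r) * g $ 1 $ 2 ^ r"
        by (rule scale_rearrange)
      then show ?thesis unfolding e by (rule arg_cong)
    qed
    show ?case
    proof (rule exI[of _ "A + c * h $ 1 $ 1 ^ r"], rule exI[of _ "B + c * h $ 2 $ 1 ^ r"], rule conjI)
      show "scl M c y + w \<in> car M" by (intro car_add car_scale yc AB(1))
      show "\<forall>g\<in>SL2. wt_part M (int r) (act M g (scl M c y + w)) =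
          scl M ((A + c * h $ 1 $ 1 ^ r) * g $ 1 $ 1 ^ r + (B + c * h $ 2 $ 1 ^ r) * g $ 1 $ 2 ^ r) v"
        by (rule ballI) (rule eq)
    qed
  qed
  then obtain A B where AB:
    "\<And>g. g \<in> SL2 \<Longrightarrow> wt_part M (int r) (act M g x) = scl M (A * g $ 1 $ 1 ^ r + B * g $ 1 $ 2 ^ r) v"
    by blast
  \<comment> \<open>The first rows of \<open>mat 1\<close> and \<open>swap\<close> are (1, 0) and
    (0, 1), so these two elements isolate \<open>A\<close> and \<open>B\<close>. Both vanish because
    neither \<open>m\<close> nor \<open>-m\<close> is the highest weight.\<close>
  have "A * (mat 1 :: 'k ^ 2 ^ 2) $ 1 $ 1 ^ r + B * (mat 1 :: 'k ^ 2 ^ 2) $ 1 $ 2 ^ r = A"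
    using r0 by (simp add: mat_def)
  then have "scl M A v = wt_part M (int r) x"
    using AB[OF one_SL2] by (simp only: act_one[OF xc])
  also have "wt_part M (int r) x = 0"
    by (simp only: wt_part_of_weight[OF x] ri m(1)[symmetric] if_False)
  finally have A: "A = 0" using v(2) by simp
  have "A * (swap :: 'k ^ 2 ^ 2) $ 1 $ 1 ^ r + B * (swap :: 'k ^ 2 ^ 2) $ 1 $ 2 ^ r = B"
    using r0 by (simp add: swap_def)
  then have "scl M B v = wt_part M (int r) (act M swap x)"
    using AB[OF swap_SL2] by (simp only:)
  also have "\<dots> = 0"
  proof -
    have "2 ^ n \<noteq> - m" using m(2) by linarith
    then show ?thesis by (simp only: wt_part_of_weight[OF swap_weight[OF x]] ri if_False)
  qed
  finally have B: "B = 0" using v(2) by simp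
  \<comment> \<open>The largest submodule in the kernel of the projection to the highest weight;
    simplicity makes it zero, as it misses \<open>v\<close>.\<close>
  define K where "K = {y \<in> car M. \<forall>g\<in>SL2. wt_part M (int r) (act M g y) = 0}"
  have "K = {0} \<or> K = car M"
  proof (rule only)
    show "K \<subseteq> car M" by (auto simp: K_def)
    show "subspace K"
      by (rule subspaceI)
        (auto simp: K_def act_zero wt_part_zero act_add wt_part_add act_scale wt_part_scale car_add car_scale)
    show "act M g w \<in> K" if "g \<in> SL2" "w \<in> K" for g w
      using that by (auto simp: K_def simp flip: act_mult)
  qed
  moreover have "v \<notin> K"
  proof
    assume "v \<in> K"
    then have "wt_part M (int r) (act M (mat 1) v) = 0" unfolding K_def using one_SL2 by blast
    moreover have "wt_part M (int r) (act M (mat 1) v) = v"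
      using psi[OF one_SL2] act_one[OF vc] by (simp add: mat_def)
    ultimately show False using v(2) by metis
  qed
  ultimately have "K = {0}" using vc by metis
  moreover have "x \<in> K" unfolding K_def using AB xc by (simp add: A B)
  ultimately show ?thesis by blast
qed

lemma simple_countable_dim:
  assumes "simple_module M" shows "countable_dim M"
proof -
  have "car M \<noteq> {0}" using assms by (simp add: simple_module_def)
  then obtain v where v: "v \<in> car M" "v \<noteq> 0" using car_zero by blast
  obtain B where B: "finite B" "B \<subseteq> car M" "v \<in> span B" "\<And>g b. g \<in> SL2 \<Longrightarrow> b \<in> span B \<Longrightarrow> act M g b \<in> span B"
    using finite_stable_span[OF v(1)] by blast
  have "span B \<subseteq> car M" by (rule span_minimal[OF B(2) subspace_car])
  then have "span B = {0} \<or> span B = car M"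
    using assms B(4) subspace_span unfolding simple_module_def by blast
  then have "span B = car M" using B(3) v(2) by blast
  then show ?thesis using B by (auto simp: countable_dim_def intro!: exI[of _ B] countable_finite)
qed

text \<open>The coboundary vanishes identically: monomials have nonnegative weight, so by
  \<open>simple_weights\<close> cochains take values in the highest weight space, which divided
  powers of positive index kill. Hence distinct monomials give independent classes.\<close>

lemma simple_indep_cocycles:
  assumes simp: "simple_module M" and hw: "highest_weight M (2 ^ n)" and X: "finite X"
    and wt: "\<And>\<mu>. \<mu> \<in> X \<Longrightarrow> size \<mu> = Suc q \<and> mweight \<mu> = 2 ^ n"
  shows "\<exists>z. indep_cocycles M q X z"
proof -
  have "weight_space M (2 ^ n) \<noteq> {0}" and top: "\<And>k. weight_space M k \<noteq> {0} \<Longrightarrow> k \<le> 2 ^ n"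
    using hw by (simp_all add: highest_weight_def)
  moreover have "0 \<in> weight_space M (2 ^ n)" by simp
  ultimately obtain v where v: "v \<in> weight_space M (2 ^ n)" "v \<noteq> 0" by blast
  have e: "div_pow M upper (2 ^ i) u = 0" if "u \<in> weight_space M (2 ^ n)" for u i
    using upper_weight[OF that, of "2 ^ i"] top[of "2 ^ n + 2 * int (2 ^ i)"] by force
  define z where "z \<mu> \<nu> = (if \<nu> = \<mu> then v else 0)" for \<mu> \<nu> :: "nat multiset"
  have cob0: "cobd M w \<nu> = 0" if w: "w \<in> cochains M k" for w k \<nu>
    unfolding cobd_def
  proof (rule sum.neutral, rule ballI)
    fix i assume "i \<in># \<nu>"
    have ww: "w (\<nu> - {#i#}) \<in> weight_space M (mweight (\<nu> - {#i#}))" by (rule cochain_weight[OF w])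
    show "div_pow M upper (2 ^ i) (w (\<nu> - {#i#})) = 0"
    proof (cases "mweight (\<nu> - {#i#}) = 2 ^ n")
      case True then show ?thesis using e ww by simp
    next
      case False
      have "mweight (\<nu> - {#i#}) \<noteq> - (2 ^ n)"
        using mweight_nonneg[of "\<nu> - {#i#}"] by (smt (verit) zero_less_power)
      then have "w (\<nu> - {#i#}) = 0" using simple_weights[OF simp hw False _ ww] by simp
      then show ?thesis by (simp add: div_pow_zero polynomial_curve_upper)
    qed
  qed
  have zc: "z \<mu> \<in> cochains M (Suc q)" if "\<mu> \<in> X" for \<mu>
    using wt[OF that] v(1) by (auto simp: cochains_def z_def)
  have "indep_cocycles M q X z"
    unfolding indep_cocycles_def
  proof (intro conjI ballI allI impI)
    fix \<mu> \<nu> assume "\<mu> \<in> X"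
    then show "z \<mu> \<in> cochains M (Suc q)" "cobd M (z \<mu>) \<nu> = 0" using zc cob0 by blast+
  next
    fix a w \<mu>
    assume w: "w \<in> cochains M q" and eq: "\<forall>\<mu>. (\<Sum>x\<in>X. scl M (a x) (z x \<mu>)) = cobd M w \<mu>" and \<mu>: "\<mu> \<in> X"
    have "(\<Sum>x\<in>X. scl M (a x) (z x \<mu>)) = (\<Sum>x\<in>X. if x = \<mu> then scl M (a \<mu>) v else 0)"
      by (rule sum.cong) (auto simp: z_def)
    also have "\<dots> = scl M (a \<mu>) v" using X \<mu> by simp
    finally have "scl M (a \<mu>) v = 0" using eq cob0[OF w] by simp
    then show "a \<mu> = 0" using v(2) by simp
  qed
  then show ?thesis by blast
qed

end

text \<open>For \<open>q = 2 ^ n\<close> this is the n-th Frobenius twist of the natural module, on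
  functions supported on two points. It provides the witness for the choice in
  \<open>L\<close>.\<close>

definition frobenius_module :: "'i \<Rightarrow> 'i \<Rightarrow> nat \<Rightarrow> ('k::field, 'i \<Rightarrow> 'k) gmod" where
  "frobenius_module i j q = \<lparr>scl = (\<lambda>a f l. a * f l), car = {f. \<forall>l. l \<noteq> i \<and> l \<noteq> j \<longrightarrow> f l = 0},
     act = (\<lambda>g f l. if l = i then g $ 1 $ 1 ^ q * f i + g $ 1 $ 2 ^ q * f j
                    else if l = j then g $ 2 $ 1 ^ q * f i + g $ 2 $ 2 ^ q * f j else 0)\<rparr>"

lemma frobenius_module_simple:
  assumes char2: "CHAR('k::alg_closed_field) = 2" and ij: "i \<noteq> j"
  shows "simple_module (frobenius_module i j (2 ^ n) :: ('k, 'i \<Rightarrow> 'k) gmod) \<and>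
    highest_weight (frobenius_module i j (2 ^ n) :: ('k, 'i \<Rightarrow> 'k) gmod) (2 ^ n)"
proof -
  define q where "q = (2::nat) ^ n"
  have q0: "q > 0" by (simp add: q_def)
  define M where "M = (frobenius_module i j q :: ('k, 'i \<Rightarrow> 'k) gmod)"
  have M [simp]: "scl M = (\<lambda>a f l. a * f l)" "car M = {f. \<forall>l. l \<noteq> i \<and> l \<noteq> j \<longrightarrow> f l = 0}"
    "act M = (\<lambda>g f l. if l = i then g $ 1 $ 1 ^ q * f i + g $ 1 $ 2 ^ q * f j
                    else if l = j then g $ 2 $ 1 ^ q * f i + g $ 2 $ 2 ^ q * f j else 0)"
    by (simp_all add: M_def frobenius_module_def)
  have vs: "vector_space (\<lambda>(a::'k) (f::'i \<Rightarrow> 'k) l. a * f l)"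
    by unfold_locales (auto simp: algebra_simps)
  interpret V: vector_space "\<lambda>(a::'k) (f::'i \<Rightarrow> 'k) l. a * f l" by (rule vs)
  have pw: "(x + y) ^ q = x ^ q + y ^ q" for x y :: 'k
    unfolding q_def by (rule add_power_char2[OF char2])
  have "V.subspace (car M)" by (rule V.subspaceI) auto
  then have gm: "group_module M"
    unfolding group_module_def
    using vs ij q0
    by (auto simp: fun_eq_iff mat2_one mult_nth2 pw power_mult_distrib algebra_simps)
  interpret M: gmodule M by unfold_locales (rule gm)
  define ei ej where "ei = (\<lambda>l. if l = i then 1 else 0 :: 'k)" and "ej = (\<lambda>l. if l = j then 1 else 0 :: 'k)"
  have ec [simp]: "ei \<in> car M" "ej \<in> car M" by (auto simp: ei_def ej_def)
  have "regular M (\<lambda>g. act M g f)" if "f \<in> car M" for f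
  proof -
    have "regular M (\<lambda>g. scl M (g $ 1 $ 1 ^ q) (scl M (f i) ei) + scl M (g $ 1 $ 2 ^ q) (scl M (f j) ei) +
        (scl M (g $ 2 $ 1 ^ q) (scl M (f i) ej) + scl M (g $ 2 $ 2 ^ q) (scl M (f j) ej)))"
      by (intro M.regular_add M.regular_tensor polynomial_fun_power polynomial_fun.coord M.car_scale ec)
    moreover have "scl M (g $ 1 $ 1 ^ q) (scl M (f i) ei) + scl M (g $ 1 $ 2 ^ q) (scl M (f j) ei) +
        (scl M (g $ 2 $ 1 ^ q) (scl M (f i) ej) + scl M (g $ 2 $ 2 ^ q) (scl M (f j) ej)) = act M g f" for g
      using ij by (auto simp: fun_eq_iff ei_def ej_def)
    ultimately show ?thesis by (simp only:)
  qed
  then have rat: "rational_module M" by (rule M.rational_moduleI)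
  interpret R: rmodule2 M by (rule rmodule2I[OF rat char2])
  have decomp: "f = scl M (f i) ei + scl M (f j) ej" if "f \<in> car M" for f
    using that ij by (auto simp: fun_eq_iff ei_def ej_def)
  have full: "W = {0} \<or> W = car M"
    if W: "W \<subseteq> car M" "M.subspace W" "\<forall>g\<in>SL2. \<forall>w\<in>W. act M g w \<in> W" for W
  proof (rule disjCI)
    assume "W \<noteq> car M"
    show "W = {0}"
    proof (rule ccontr)
      assume "W \<noteq> {0}"
      then obtain f where f: "f \<in> W" "f \<noteq> 0" using M.subspace_0[OF W(2)] by blast
      have unit: "u \<in> W" if "scl M c u \<in> W" "c \<noteq> 0" for c u
        using M.subspace_scale[OF W(2) that(1), of "inverse c"] that(2) by (simp add: mult.assoc[symmetric])
      have eiW: "ei \<in> W"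
      proof (cases "f j = 0")
        case True
        have "f \<in> car M" using f(1) W(1) by blast
        then have eq: "scl M (f i) ei = f" using True by (auto simp: fun_eq_iff ei_def)
        have "f i \<noteq> 0" using f(2) eq by (auto simp: fun_eq_iff)
        moreover have "scl M (f i) ei \<in> W" unfolding eq by (rule f(1))
        ultimately show ?thesis by (rule unit[rotated])
      next
        case False
        \<comment> \<open>The entries of \<open>upper 1\<close> are 0 and 1, which the q-th power
          fixes, so this element acts as on the untwisted natural module.\<close>
        have eq: "scl M (f j) ei = act M (upper 1) f - f"
          using f(1) W(1) ij q0 by (auto simp: fun_eq_iff upper_def ei_def)
        have "act M (upper 1) f \<in> W" using W(3)[rule_format, OF upper_SL2 f(1)] .
        then have "scl M (f j) ei \<in> W" unfolding eq by (rule M.subspace_diff[OF W(2) _ f(1)])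
        then show ?thesis using False by (rule unit)
      qed
      have "ej \<in> W"
      proof -
        have eq: "scl M ((-1) ^ q) ej = act M swap ei"
          using ij q0 by (auto simp: fun_eq_iff swap_def ei_def ej_def)
        have "scl M ((-1) ^ q) ej \<in> W"
          unfolding eq by (rule W(3)[rule_format, OF swap_SL2 eiW])
        then show ?thesis by (rule unit) simp
      qed
      then have "scl M a ei + scl M b ej \<in> W" for a b
        by (intro M.subspace_add[OF W(2)] M.subspace_scale[OF W(2)] eiW)
      then have "f \<in> W" if "f \<in> car M" for f
        by (subst decomp[OF that])
      then show False using W(1) \<open>W \<noteq> car M\<close> by blast
    qed
  qed
  have ei0: "ei \<noteq> 0" by (auto simp: ei_def fun_eq_iff)
  have simp: "simple_module M"
    unfolding simple_module_def using rat full ec(1) ei0 by blast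
  have wi: "ei \<in> weight_space M (int q)"
    using ij q0 by (auto simp: weight_space_def torus_mat2 ei_def fun_eq_iff)
  have wj: "ej \<in> weight_space M (- int q)"
    using ij q0 by (auto simp: weight_space_def torus_mat2 ej_def fun_eq_iff power_int_minus power_inverse)
  have "k \<le> int q" if "weight_space M k \<noteq> {0}" for k
  proof (rule ccontr)
    assume k: "\<not> k \<le> int q"
    have "f = 0" if f: "f \<in> weight_space M k" for f
    proof -
      have fc: "f \<in> car M" using f weight_space_car by blast
      have "f = wt_part M k f" using R.wt_part_of_weight[OF f] by simp
      also have "\<dots> = wt_part M k (scl M (f i) ei + scl M (f j) ej)" by (rule arg_cong[OF decomp[OF fc]])
      also have "\<dots> = scl M (f i) (wt_part M k ei) + scl M (f j) (wt_part M k ej)"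
        by (simp only: R.wt_part_add R.wt_part_scale ec M.car_scale)
      also have "\<dots> = 0"
        using k by (simp add: R.wt_part_of_weight[OF wi] R.wt_part_of_weight[OF wj] fun_eq_iff)
      finally show ?thesis .
    qed
    moreover have "0 \<in> weight_space M k" by simp
    ultimately show False using that by blast
  qed
  then have "highest_weight M q" unfolding highest_weight_def using wi ei0 by blast
  then show ?thesis using simp by (simp add: M_def q_def)
qed

lemma L_power2:
  assumes "CHAR('k::alg_closed_field) = 2"
  shows "simple_module (L (2 ^ n) :: ('k, 'i::infinite \<Rightarrow> 'k) gmod) \<and>
    highest_weight (L (2 ^ n) :: ('k, 'i \<Rightarrow> 'k) gmod) (2 ^ n)"
proof -
  obtain i j :: 'i where "i \<noteq> j"
    using infinite_UNIV by (metis (full_types) finite.simps UNIV_eq_I insertI1)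
  from frobenius_module_simple[OF assms this]
  have "\<exists>M :: ('k, 'i \<Rightarrow> 'k) gmod. simple_module M \<and> highest_weight M (2 ^ n)" by blast
  from someI_ex[OF this] show ?thesis unfolding L_def .
qed

section \<open>Counting monomials\<close>

text \<open>
  Multisets of leaf depths of binary trees with \<open>m\<close> leaves. Either two of the deepest leaves
  or one of them and one of its children grow two children each; the number of deepest
  leaves tells the two cases apart.
\<close>

definition leaf_depths :: "nat \<Rightarrow> nat multiset \<Rightarrow> nat \<Rightarrow> bool" where
  "leaf_depths m \<delta> D \<longleftrightarrow> size \<delta> = m \<and> (\<forall>d\<in>#\<delta>. d \<le> D) \<and> 2 \<le> count \<delta> D \<and> D < m \<and>
     (\<Sum>d\<in>#\<delta>. (1/2) ^ d) = (1::real)"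

lemma leaf_depths_split:
  assumes "leaf_depths m \<delta> D"
  obtains \<rho> where "\<delta> = add_mset D (add_mset D \<rho>)" "\<forall>d\<in>#\<rho>. d \<le> D"
proof -
  have "{#D, D#} \<subseteq># \<delta>" using assms by (auto simp: leaf_depths_def subseteq_mset_def)
  then obtain \<rho> where "\<delta> = {#D, D#} + \<rho>" by (metis subset_mset.le_iff_add)
  then show ?thesis using that[of \<rho>] assms by (auto simp: leaf_depths_def)
qed

lemma leaf_depths_Max: "leaf_depths m \<delta> D \<Longrightarrow> Max (set_mset \<delta>) = D"
  by (rule Max_eqI) (auto simp: leaf_depths_def intro: count_inI)

definition grow_two :: "nat multiset \<Rightarrow> nat multiset" where
  "grow_two \<delta> = (let D = Max (set_mset \<delta>) in
     \<delta> - {#D, D#} + {#Suc D, Suc D, Suc D, Suc D#})"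

definition grow_child :: "nat multiset \<Rightarrow> nat multiset" where
  "grow_child \<delta> = (let D = Max (set_mset \<delta>) in
     \<delta> - {#D#} + {#Suc D, Suc (Suc D), Suc (Suc D)#})"

text \<open>Replacing a leaf by two leaves one level deeper preserves the sum. The last claim
  recovers the tree once the maximal depth is known, which gives injectivity of the growth
  step.\<close>

lemma leaf_depths_grow_two:
  assumes "leaf_depths m \<delta> D"
  shows "leaf_depths (m + 2) (grow_two \<delta>) (Suc D)" "count (grow_two \<delta>) (Suc D) = 4"
    "grow_two \<delta> - {#Suc D, Suc D, Suc D, Suc D#} + {#D, D#} = \<delta>"
proof -
  obtain \<rho> where \<rho>: "\<delta> = add_mset D (add_mset D \<rho>)" "\<forall>d\<in>#\<rho>. d \<le> D"
    by (rule leaf_depths_split[OF assms])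
  have c0: "count \<rho> (Suc D) = 0" using \<rho>(2) by (metis count_eq_zero_iff not_less_eq_eq le_refl)
  have g: "grow_two \<delta> = \<rho> + {#Suc D, Suc D, Suc D, Suc D#}"
    unfolding grow_two_def Let_def leaf_depths_Max[OF assms] by (simp add: \<rho>(1))
  show "count (grow_two \<delta>) (Suc D) = 4" by (simp add: g c0)
  show "leaf_depths (m + 2) (grow_two \<delta>) (Suc D)"
    using assms[unfolded leaf_depths_def \<rho>(1)] \<rho>(2) c0 unfolding leaf_depths_def g by auto
  show "grow_two \<delta> - {#Suc D, Suc D, Suc D, Suc D#} + {#D, D#} = \<delta>" unfolding g by (simp add: \<rho>(1))
qed

lemma leaf_depths_grow_child:
  assumes "leaf_depths m \<delta> D"
  shows "leaf_depths (m + 2) (grow_child \<delta>) (Suc (Suc D))" "count (grow_child \<delta>) (Suc (Suc D)) = 2"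
    "grow_child \<delta> - {#Suc D, Suc (Suc D), Suc (Suc D)#} + {#D#} = \<delta>"
proof -
  obtain \<rho> where \<rho>: "\<delta> = add_mset D (add_mset D \<rho>)" "\<forall>d\<in>#\<rho>. d \<le> D"
    by (rule leaf_depths_split[OF assms])
  have c0: "count \<rho> (Suc (Suc D)) = 0" using \<rho>(2) by (metis count_eq_zero_iff Suc_n_not_le_n Suc_leD)
  have g: "grow_child \<delta> = add_mset D \<rho> + {#Suc D, Suc (Suc D), Suc (Suc D)#}"
    unfolding grow_child_def Let_def leaf_depths_Max[OF assms] by (simp add: \<rho>(1))
  show "count (grow_child \<delta>) (Suc (Suc D)) = 2" by (simp add: g c0)
  show "leaf_depths (m + 2) (grow_child \<delta>) (Suc (Suc D))"
    using assms[unfolded leaf_depths_def \<rho>(1)] \<rho>(2) c0 unfolding leaf_depths_def g by (auto simp: le_Suc_eq)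
  show "grow_child \<delta> - {#Suc D, Suc (Suc D), Suc (Suc D)#} + {#D#} = \<delta>" unfolding g by (simp add: \<rho>(1))
qed

text \<open>Each step adds two leaves and doubles the family; single trees with 2 and with 3 leaves
  start the even and the odd case.\<close>

lemma many_leaf_depths:
  assumes "2 \<le> m"
  shows "\<exists>F. finite F \<and> card F = 2 ^ ((m - 2) div 2) \<and> (\<forall>\<delta>\<in>F. \<exists>D. leaf_depths m \<delta> D)"
  using assms
proof (induction m rule: less_induct)
  case (less m)
  consider "m = 2" | "m = 3" | "m \<ge> 4" using less.prems by linarith
  then show ?case
  proof cases
    case 1
    then have "leaf_depths m {#1, 1#} 1" by (simp add: leaf_depths_def)
    then show ?thesis using 1 by (intro exI[of _ "{{#1, 1#}}"]) auto
  next
    case 2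
    then have "leaf_depths m {#1, 2, 2#} 2" by (simp add: leaf_depths_def power2_eq_square)
    then show ?thesis using 2 by (intro exI[of _ "{{#1, 2, 2#}}"]) auto
  next
    case 3
    define k where "k = m - 2"
    have k: "2 \<le> k" "k < m" "m = k + 2" using 3 by (auto simp: k_def)
    obtain F where F: "finite F" "card F = 2 ^ ((k - 2) div 2)" "\<forall>\<delta>\<in>F. \<exists>D. leaf_depths k \<delta> D"
      using less.IH[OF k(2,1)] by blast
    have inj2: "inj_on grow_two F"
    proof (rule inj_onI)
      fix \<delta> \<epsilon> assume *: "\<delta> \<in> F" "\<epsilon> \<in> F" "grow_two \<delta> = grow_two \<epsilon>"
      obtain D E where DE: "leaf_depths k \<delta> D" "leaf_depths k \<epsilon> E" using F(3) * by blast
      have "Suc D = Suc E"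
        using leaf_depths_Max[OF leaf_depths_grow_two(1)[OF DE(1)]]
          leaf_depths_Max[OF leaf_depths_grow_two(1)[OF DE(2)]] *(3) by metis
      then show "\<delta> = \<epsilon>"
        using leaf_depths_grow_two(3)[OF DE(1)] leaf_depths_grow_two(3)[OF DE(2)] *(3) by (metis nat.inject)
    qed
    have injc: "inj_on grow_child F"
    proof (rule inj_onI)
      fix \<delta> \<epsilon> assume *: "\<delta> \<in> F" "\<epsilon> \<in> F" "grow_child \<delta> = grow_child \<epsilon>"
      obtain D E where DE: "leaf_depths k \<delta> D" "leaf_depths k \<epsilon> E" using F(3) * by blast
      have "Suc (Suc D) = Suc (Suc E)"
        using leaf_depths_Max[OF leaf_depths_grow_child(1)[OF DE(1)]]
          leaf_depths_Max[OF leaf_depths_grow_child(1)[OF DE(2)]] *(3) by metis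
      then show "\<delta> = \<epsilon>"
        using leaf_depths_grow_child(3)[OF DE(1)] leaf_depths_grow_child(3)[OF DE(2)] *(3) by (metis nat.inject)
    qed
    have disj: "grow_two ` F \<inter> grow_child ` F = {}"
    proof (rule ccontr)
      assume "grow_two ` F \<inter> grow_child ` F \<noteq> {}"
      then obtain \<delta> \<epsilon> where *: "\<delta> \<in> F" "\<epsilon> \<in> F" "grow_two \<delta> = grow_child \<epsilon>" by blast
      obtain D E where DE: "leaf_depths k \<delta> D" "leaf_depths k \<epsilon> E" using F(3) * by blast
      have "Suc D = Suc (Suc E)"
        using leaf_depths_Max[OF leaf_depths_grow_two(1)[OF DE(1)]]
          leaf_depths_Max[OF leaf_depths_grow_child(1)[OF DE(2)]] *(3) by metis
      then show False
        using leaf_depths_grow_two(2)[OF DE(1)] leaf_depths_grow_child(2)[OF DE(2)] *(3) by simp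
    qed
    let ?G = "grow_two ` F \<union> grow_child ` F"
    have "card ?G = card F + card F"
      using F(1) disj by (simp add: card_Un_disjoint card_image inj2 injc)
    also have "\<dots> = 2 ^ ((m - 2) div 2)"
    proof -
      have "(m - 2) div 2 = Suc ((k - 2) div 2)" using k by (simp add: div_if)
      then show ?thesis by (simp add: F(2))
    qed
    finally have "card ?G = 2 ^ ((m - 2) div 2)" .
    moreover have "\<exists>D. leaf_depths m \<delta> D" if "\<delta> \<in> ?G" for \<delta>
      using that F(3) leaf_depths_grow_two(1) leaf_depths_grow_child(1) unfolding k(3) by blast
    ultimately show ?thesis using F(1) by (intro exI[of _ ?G]) auto
  qed
qed

lemma many_monomials:
  assumes m: "2 \<le> m"
  shows "\<exists>X. finite X \<and> card X = 2 ^ ((m - 2) div 2) \<and> (\<forall>\<mu>\<in>X. size \<mu> = m \<and> mweight \<mu> = 2 ^ m)"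
proof -
  obtain F where F: "finite F" "card F = 2 ^ ((m - 2) div 2)" "\<forall>\<delta>\<in>F. \<exists>D. leaf_depths m \<delta> D"
    using many_leaf_depths[OF m] by blast
  \<comment> \<open>A leaf of depth d becomes the generator of index m - 1 - d, whose weight is 2^(m
    - d) up to sign, so the total is 2^m times the sum 1. Depths are below \<open>m\<close>, which
    makes this substitution its own inverse despite truncated subtraction.\<close>
  let ?h = "image_mset (\<lambda>d. m - 1 - d)"
  have dm: "d < m" if "\<delta> \<in> F" "d \<in># \<delta>" for \<delta> d
    using F(3) that unfolding leaf_depths_def by (meson le_less_trans)
  have hh: "?h (?h \<delta>) = \<delta>" if "\<delta> \<in> F" for \<delta>
  proof -
    have "?h (?h \<delta>) = image_mset (\<lambda>d. d) \<delta>"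
      unfolding multiset.map_comp by (rule image_mset_cong) (use dm[OF that] in force)
    then show ?thesis by simp
  qed
  then have inj: "inj_on ?h F" by (rule inj_on_inverseI)
  have X: "size (?h \<delta>) = m \<and> mweight (?h \<delta>) = 2 ^ m" if \<delta>: "\<delta> \<in> F" for \<delta>
  proof -
    have sz: "size \<delta> = m" and sm: "(\<Sum>d\<in>#\<delta>. (1/2) ^ d) = (1::real)"
      using F(3) \<delta> by (auto simp: leaf_depths_def)
    have "real_of_int (mweight (?h \<delta>)) = (\<Sum>d\<in>#\<delta>. 2 ^ m * (1/2) ^ d)"
    proof -
      have *: "real_of_int (\<Sum>i\<in>#\<nu>. 2 ^ (F i)) = (\<Sum>i\<in>#\<nu>. 2 ^ (F i))" for \<nu> :: "nat multiset" and F
        by (induction \<nu>) auto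
      have "mweight (?h \<delta>) = (\<Sum>d\<in>#\<delta>. 2 ^ (m - 1 - d + 1))"
        by (simp add: mweight_def multiset.map_comp comp_def)
      then have "real_of_int (mweight (?h \<delta>)) = (\<Sum>d\<in>#\<delta>. 2 ^ (m - 1 - d + 1))"
        by (simp only: *)
      also have "\<dots> = (\<Sum>d\<in>#\<delta>. 2 ^ m * (1/2) ^ d)"
      proof (rule arg_cong[where f = sum_mset], rule image_mset_cong)
        fix d assume "d \<in># \<delta>"
        then have "d < m" by (rule dm[OF \<delta>])
        then have "m - 1 - d + 1 = m - d" "d \<le> m" by auto
        then show "(2::real) ^ (m - 1 - d + 1) = 2 ^ m * (1/2) ^ d"
          by (simp add: power_diff power_divide)
      qed
      finally show ?thesis .
    qed
    also have "\<dots> = 2 ^ m" using sm by (simp add: sum_mset_distrib_left[symmetric])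
    also have "\<dots> = real_of_int (2 ^ m)" by simp
    finally have "mweight (?h \<delta>) = 2 ^ m" by (simp only: of_int_eq_iff)
    then show ?thesis using sz by simp
  qed
  have "card (?h ` F) = 2 ^ ((m - 2) div 2)" unfolding card_image[OF inj] by (rule F(2))
  moreover have "finite (?h ` F)" using F(1) by (rule finite_imageI)
  moreover have "\<forall>\<mu>\<in>?h ` F. size \<mu> = m \<and> mweight \<mu> = 2 ^ m" using X by blast
  ultimately show ?thesis by blast
qed

lemma H_dim_L_power2:
  assumes char2: "CHAR('k::alg_closed_field) = 2" and m: "2 \<le> m"
  shows "H_dim m (L (2 ^ m) :: ('k, 'i::infinite \<Rightarrow> 'k) gmod) \<ge> enat (2 ^ ((m - 2) div 2))"
proof -
  let ?L = "L (2 ^ m) :: ('k, 'i \<Rightarrow> 'k) gmod"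
  have L: "simple_module ?L" "highest_weight ?L (2 ^ m)" using L_power2[OF char2] by blast+
  have rL: "rational_module ?L" using L(1) by (simp add: simple_module_def)
  interpret L: rmodule2 ?L by (rule rmodule2I[OF rL char2])
  obtain q where q: "m = Suc q" using m by (cases m) auto
  obtain X where X: "finite X" "card X = 2 ^ ((m - 2) div 2)" "\<forall>\<mu>\<in>X. size \<mu> = m \<and> mweight \<mu> = 2 ^ m"
    using many_monomials[OF m] by blast
  obtain z where "indep_cocycles ?L q X z"
    using L.simple_indep_cocycles[OF L X(1), of q] X(3) q by auto
  from H_dim_ge[OF rL L.simple_countable_dim[OF L(1)] char2 X(1) this]
  show ?thesis by (simp only: X(2) q)
qed

theorem theorem2:
  assumes "CHAR('k::alg_closed_field) = 2"
  shows "(\<forall>m>2. H_dim (2 * m) (L (2 ^ (2 * m)) :: ('k, 'i::infinite \<Rightarrow> 'k) gmod)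
             \<ge> enat (2 ^ (m - 1)))
       \<and> (\<exists>(C::real) (c::real). C > 0 \<and> c > 1 \<and>
            (\<forall>\<^sub>F m in sequentially.
               ereal_of_enat (H_dim m (L (2 ^ m) :: ('k, 'i \<Rightarrow> 'k) gmod)) \<ge> ereal (C * c ^ m)))"
proof (intro conjI allI impI)
  fix m :: nat assume "2 < m"
  then have "(2 * m - 2) div 2 = m - 1" by linarith
  moreover have "2 \<le> 2 * m" using \<open>2 < m\<close> by simp
  ultimately show "enat (2 ^ (m - 1)) \<le> H_dim (2 * m) (L (2 ^ (2 * m)) :: ('k, 'i \<Rightarrow> 'k) gmod)"
    using H_dim_L_power2[OF assms, of "2 * m", where 'i = 'i] by (simp only:)
next
  have "ereal (1/4 * sqrt 2 ^ m) \<le> ereal_of_enat (H_dim m (L (2 ^ m) :: ('k, 'i \<Rightarrow> 'k) gmod))"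
    if m: "2 \<le> m" for m
  proof -
    define k where "k = (m - 2) div 2"
    \<comment> \<open>Halving loses at most one, so \<open>sqrt 2 ^ m\<close> is at most
      \<open>2 * sqrt 2\<close> times \<open>2 ^ k\<close>; the constant 1/4 absorbs this factor,
      which is below 4.\<close>
    have "m \<le> 2 * k + 3" using m by (simp add: k_def)
    then have "sqrt 2 ^ m \<le> sqrt 2 ^ (2 * k + 3)" by (rule power_increasing) simp
    also have "\<dots> = 2 ^ k * (2 * sqrt 2)"
      by (simp add: power_add power_mult power3_eq_cube)
    also have "\<dots> \<le> 2 ^ k * 4"
      using real_sqrt_le_mono[of 2 4] by (intro mult_left_mono) auto
    finally have "ereal (1/4 * sqrt 2 ^ m) \<le> ereal_of_enat (enat (2 ^ k))" by simp
    also have "\<dots> \<le> ereal_of_enat (H_dim m (L (2 ^ m) :: ('k, 'i \<Rightarrow> 'k) gmod))"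
      unfolding ereal_of_enat_le_iff k_def by (rule H_dim_L_power2[OF assms m])
    finally show ?thesis .
  qed
  then show "\<exists>(C::real) (c::real). C > 0 \<and> c > 1 \<and>
      (\<forall>\<^sub>F m in sequentially. ereal_of_enat (H_dim m (L (2 ^ m) :: ('k, 'i \<Rightarrow> 'k) gmod)) \<ge> ereal (C * c ^ m))"
    by (intro exI[of _ "1/4"] exI[of _ "sqrt 2"] conjI eventually_sequentiallyI[of 2]) auto
qed

end
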